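(* Let $G$ be a discrete group, $\Gamma$ a normal subgroup of $G$, and $d\geq 2$ an integer. If both $\Gamma$ and $G/\Gamma$ satisfy the $M_d$-approximation property ($M_d$-AP), then $G$ satisfies $M_d$-AP.
   Context: Let $G$ be a discrete group and $d\ge 2$ an integer. A bounded function $\varphi:G\to\mathbb{C}$ is an $M_d$-multiplier of $G$ if there are Hilbert spaces $\mathcal{H}_0,\ldots,\mathcal{H}_d$ with $\mathcal{H}_0=\mathcal{H}_d=\mathbb{C}$ and bounded maps $\xi_i:G\to\mathbf{B}(\mathcal{H}_i,\mathcal{H}_{i-1})$ ($i=1,\ldots,d$) such that $$\varphi(t_1\cdots t_d)=\xi_1(t_1)\cdots\xi_d(t_d)1\quad\text{for all } t_1,\ldots,t_d\in G,$$ where $\mathbf{B}(E,F)$ denotes the bounded linear operators from $E$ to $F$. $M_d(G)$ is the space of all $M_d$-multipliers, with norm $\|\varphi\|_{M_d(G)}=\inf\{\sup_{t_1\in G}\|\xi_1(t_1)\|\cdots\sup_{t_d\in G}\|\xi_d(t_d)\|\}$, the infimum being over all such decompositions. $X_d(G)$ is the completion of $\ell^1(G)$ for the norm $\|g\|_{X_d(G)}=\sup\{|\sum_{t\in G}\varphi(t)g(t)| : \varphi\in M_d(G),\ \|\varphi\|_{M_d(G)}\le 1\}$. It is known that $X_d(G)^*=M_d(G)$ for the duality $\langle\varphi,g\rangle=\sum_{t\in G}\varphi(t)g(t)$, $g\in\ell^1(G)$. The group $G$ has the $M_d$-AP if the constant function $1$ belongs to the $\sigma(M_d(G),X_d(G))$-closure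 (weak*-closure), in $M_d(G)$, of the space of finitely supported functions $G\to\mathbb{C}$. *)

theory Defs
  imports "HOL-Analysis.Analysis" "HOL-Algebra.Module" "HOL-Algebra.Coset"
begin

section \<open>Complex Hilbert spaces on carriers\<close>

text \<open>
  Multipliers are defined by an existential quantification over Hilbert spaces, so Hilbert spaces
  have to be objects and not types: they are complex vector spaces in the sense of HOL-Algebra
  (modules over the field of complex numbers) with an inner product that is linear in the first
  argument.  The multiplication and the unit which the record inherits from the ring records
  are irrelevant.
\<close>

definition complex_ring :: "complex ring" where
  "complex_ring = \<lparr>carrier = UNIV, mult = (*), one = 1, zero = 0, add = (+)\<rparr>"

record 'h inner_space = "(complex, 'h) module" +
  ip :: "'h \<Rightarrow> 'h \<Rightarrow> complex"

definition hnorm :: "'h inner_space \<Rightarrow> 'h \<Rightarrow> real" where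
  "hnorm H x = sqrt (Re (ip H x x))"

locale pre_hilbert_space = Module.module complex_ring H for H :: "'h inner_space" (structure) +
  assumes ip_add_left: "\<lbrakk>x \<in> carrier H; y \<in> carrier H; z \<in> carrier H\<rbrakk>
      \<Longrightarrow> ip H (x \<oplus> y) z = ip H x z + ip H y z"
    and ip_smult_left: "\<lbrakk>x \<in> carrier H; y \<in> carrier H\<rbrakk> \<Longrightarrow> ip H (a \<odot> x) y = a * ip H x y"
    and ip_cnj: "\<lbrakk>x \<in> carrier H; y \<in> carrier H\<rbrakk> \<Longrightarrow> ip H y x = cnj (ip H x y)"
    and ip_pos: "\<lbrakk>x \<in> carrier H; x \<noteq> \<zero>\<rbrakk> \<Longrightarrow> Re (ip H x x) > 0"

locale hilbert_space = pre_hilbert_space H for H :: "'h inner_space" (structure) +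
  assumes complete:
    "\<lbrakk>\<And>n::nat. \<sigma> n \<in> carrier H;
      \<And>e. e > 0 \<Longrightarrow> \<exists>N. \<forall>m\<ge>N. \<forall>n\<ge>N. hnorm H (\<sigma> m \<ominus> \<sigma> n) < e\<rbrakk>
     \<Longrightarrow> \<exists>x\<in>carrier H. (\<lambda>n. hnorm H (\<sigma> n \<ominus> x)) \<longlonglongrightarrow> 0"

definition complex_space :: "complex inner_space" where
  "complex_space = \<lparr>carrier = UNIV, mult = (*), one = 1, zero = 0, add = (+),
     smult = (*), ip = (\<lambda>x y. x * cnj y)\<rparr>"

definition bounded_ops :: "'h inner_space \<Rightarrow> 'k inner_space \<Rightarrow> ('h \<Rightarrow> 'k) set" where
  "bounded_ops H K = {T. T \<in> carrier H \<rightarrow> carrier K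
     \<and> (\<forall>x\<in>carrier H. \<forall>y\<in>carrier H. T (x \<oplus>\<^bsub>H\<^esub> y) = T x \<oplus>\<^bsub>K\<^esub> T y)
     \<and> (\<forall>a. \<forall>x\<in>carrier H. T (a \<odot>\<^bsub>H\<^esub> x) = a \<odot>\<^bsub>K\<^esub> T x)
     \<and> (\<exists>C. \<forall>x\<in>carrier H. hnorm K (T x) \<le> C * hnorm H x)}"

definition opnorm :: "'h inner_space \<Rightarrow> 'k inner_space \<Rightarrow> ('h \<Rightarrow> 'k) \<Rightarrow> real" where
  "opnorm H K T = (SUP x\<in>{x \<in> carrier H. hnorm H x \<le> 1}. hnorm K (T x))"

definition bounded_map ::
    "('a, 'b) monoid_scheme \<Rightarrow> 'h inner_space \<Rightarrow> 'k inner_space \<Rightarrow> ('a \<Rightarrow> 'h \<Rightarrow> 'k) \<Rightarrow> bool" where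
  "bounded_map G H K \<xi> \<longleftrightarrow> (\<forall>t\<in>carrier G. \<xi> t \<in> bounded_ops H K)
     \<and> bdd_above ((\<lambda>t. opnorm H K (\<xi> t)) ` carrier G)"

definition sup_norm ::
    "('a, 'b) monoid_scheme \<Rightarrow> 'h inner_space \<Rightarrow> 'k inner_space \<Rightarrow> ('a \<Rightarrow> 'h \<Rightarrow> 'k) \<Rightarrow> real" where
  "sup_norm G H K \<xi> = (SUP t\<in>carrier G. opnorm H K (\<xi> t))"


section \<open>Multipliers\<close>

text \<open>Functions on a group are represented by functions that vanish off its carrier.\<close>

definition functions_on :: "('a, 'b) monoid_scheme \<Rightarrow> ('a \<Rightarrow> complex) set" where
  "functions_on G = {f. \<forall>t. t \<notin> carrier G \<longrightarrow> f t = 0}"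

definition const_one :: "('a, 'b) monoid_scheme \<Rightarrow> 'a \<Rightarrow> complex" where
  "const_one G t = (if t \<in> carrier G then 1 else 0)"

text \<open>\<open>op_prod \<xi> i [t\<^sub>1, \<dots>, t\<^sub>n] v\<close> is \<open>\<xi> i t\<^sub>1 (\<xi> (i + 1) t\<^sub>2 (\<dots> (\<xi> (i + n - 1) t\<^sub>n v)))\<close>.\<close>

primrec op_prod :: "(nat \<Rightarrow> 'a \<Rightarrow> 'h \<Rightarrow> 'h) \<Rightarrow> nat \<Rightarrow> 'a list \<Rightarrow> 'h \<Rightarrow> 'h" where
  "op_prod \<xi> i [] v = v"
| "op_prod \<xi> i (t # ts) v = \<xi> i t (op_prod \<xi> (Suc i) ts v)"

text \<open>
  For \<open>d \<ge> 2\<close>.  The two outermost spaces are the complex numbers, which need not live in the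
  type \<open>'h\<close> of the vectors of \<open>H 1, \<dots>, H (d - 1)\<close>; hence the first map \<open>\<alpha>\<close> (into functionals on
  \<open>H 1\<close>) and the last map \<open>\<beta>\<close> (into operators from the complex numbers to \<open>H (d - 1)\<close>) are kept
  apart from the maps \<open>\<xi> i\<close>, \<open>2 \<le> i \<le> d - 1\<close>, into the operators from \<open>H i\<close> to \<open>H (i - 1)\<close>.
  In the last clause \<open>t\<^sub>1 = s\<close>, \<open>[t\<^sub>2, \<dots>, t\<^sub>d\<^sub>-\<^sub>1] = ts\<close> and \<open>t\<^sub>d = u\<close>.
\<close>

definition Md_factorization ::
    "('a, 'b) monoid_scheme \<Rightarrow> nat \<Rightarrow> ('a \<Rightarrow> complex) \<Rightarrow> (nat \<Rightarrow> 'h inner_space)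
     \<Rightarrow> ('a \<Rightarrow> 'h \<Rightarrow> complex) \<Rightarrow> (nat \<Rightarrow> 'a \<Rightarrow> 'h \<Rightarrow> 'h) \<Rightarrow> ('a \<Rightarrow> complex \<Rightarrow> 'h) \<Rightarrow> bool" where
  "Md_factorization G d \<phi> H \<alpha> \<xi> \<beta> \<longleftrightarrow>
     (\<forall>i\<in>{1..<d}. hilbert_space (H i))
     \<and> bounded_map G (H 1) complex_space \<alpha>
     \<and> (\<forall>i\<in>{2..<d}. bounded_map G (H i) (H (i - 1)) (\<xi> i))
     \<and> bounded_map G complex_space (H (d - 1)) \<beta>
     \<and> (\<forall>s\<in>carrier G. \<forall>ts\<in>lists (carrier G). \<forall>u\<in>carrier G. length ts = d - 2 \<longrightarrow>
          \<phi> (s \<otimes>\<^bsub>G\<^esub> foldr (\<otimes>\<^bsub>G\<^esub>) ts u) = \<alpha> s (op_prod \<xi> 2 ts (\<beta> u 1)))"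

definition Md_bound ::
    "('a, 'b) monoid_scheme \<Rightarrow> nat \<Rightarrow> (nat \<Rightarrow> 'h inner_space)
     \<Rightarrow> ('a \<Rightarrow> 'h \<Rightarrow> complex) \<Rightarrow> (nat \<Rightarrow> 'a \<Rightarrow> 'h \<Rightarrow> 'h) \<Rightarrow> ('a \<Rightarrow> complex \<Rightarrow> 'h) \<Rightarrow> real" where
  "Md_bound G d H \<alpha> \<xi> \<beta> = sup_norm G (H 1) complex_space \<alpha>
     * (\<Prod>i\<in>{2..<d}. sup_norm G (H i) (H (i - 1)) (\<xi> i)) * sup_norm G complex_space (H (d - 1)) \<beta>"

text \<open>
  A definition cannot quantify over the type of the vectors of the Hilbert spaces, so it is
  fixed to be \<open>'a list \<Rightarrow> complex\<close>, used as a mere set of labels (the Hilbert space structure on a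
  subset of it is arbitrary).  This loses nothing: by the theorem \<open>Md_factorization_universal\<close>
  below, a factorization through Hilbert spaces in any type whatsoever yields one through Hilbert
  spaces in this type, with at most the same bound.
\<close>

definition Md :: "('a, 'b) monoid_scheme \<Rightarrow> nat \<Rightarrow> ('a \<Rightarrow> complex) set" where
  "Md G d = {\<phi> \<in> functions_on G. bounded (\<phi> ` carrier G) \<and>
     (\<exists>(H :: nat \<Rightarrow> ('a list \<Rightarrow> complex) inner_space) \<alpha> \<xi> \<beta>. Md_factorization G d \<phi> H \<alpha> \<xi> \<beta>)}"

definition Md_norm :: "('a, 'b) monoid_scheme \<Rightarrow> nat \<Rightarrow> ('a \<Rightarrow> complex) \<Rightarrow> real" where
  "Md_norm G d \<phi> = Inf {Md_bound G d H \<alpha> \<xi> \<beta> | (H :: nat \<Rightarrow> ('a list \<Rightarrow> complex) inner_space) \<alpha> \<xi> \<beta>.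
     Md_factorization G d \<phi> H \<alpha> \<xi> \<beta>}"


section \<open>The predual and the approximation property\<close>

definition l1 :: "('a, 'b) monoid_scheme \<Rightarrow> ('a \<Rightarrow> complex) set" where
  "l1 G = {g \<in> functions_on G. (\<lambda>t. norm (g t)) summable_on carrier G}"

definition pairing :: "('a, 'b) monoid_scheme \<Rightarrow> ('a \<Rightarrow> complex) \<Rightarrow> ('a \<Rightarrow> complex) \<Rightarrow> complex" where
  "pairing G \<phi> g = (\<Sum>\<^sub>\<infinity>t\<in>carrier G. \<phi> t * g t)"

definition Xd_norm :: "('a, 'b) monoid_scheme \<Rightarrow> nat \<Rightarrow> ('a \<Rightarrow> complex) \<Rightarrow> real" where
  "Xd_norm G d g = (SUP \<phi>\<in>{\<phi> \<in> Md G d. Md_norm G d \<phi> \<le> 1}. cmod (pairing G \<phi> g))"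

text \<open>The completion of \<open>l1 G\<close>: Cauchy sequences modulo null sequences.\<close>

definition Xd_Cauchy :: "('a, 'b) monoid_scheme \<Rightarrow> nat \<Rightarrow> (nat \<Rightarrow> 'a \<Rightarrow> complex) set" where
  "Xd_Cauchy G d = {g. (\<forall>n. g n \<in> l1 G) \<and>
     (\<forall>e>0. \<exists>N. \<forall>m\<ge>N. \<forall>n\<ge>N. Xd_norm G d (\<lambda>t. g m t - g n t) < e)}"

definition Xd_rel :: "('a, 'b) monoid_scheme \<Rightarrow> nat
    \<Rightarrow> ((nat \<Rightarrow> 'a \<Rightarrow> complex) \<times> (nat \<Rightarrow> 'a \<Rightarrow> complex)) set" where
  "Xd_rel G d = {(g, h). g \<in> Xd_Cauchy G d \<and> h \<in> Xd_Cauchy G d \<and>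
     (\<lambda>n. Xd_norm G d (\<lambda>t. g n t - h n t)) \<longlonglongrightarrow> 0}"

definition Xd :: "('a, 'b) monoid_scheme \<Rightarrow> nat \<Rightarrow> (nat \<Rightarrow> 'a \<Rightarrow> complex) set set" where
  "Xd G d = Xd_Cauchy G d // Xd_rel G d"

text \<open>The duality between \<open>Md G d\<close> and \<open>Xd G d\<close>: the continuous extension of \<open>pairing G \<phi>\<close>
  (see \<open>duality_eq\<close> below).\<close>

definition duality ::
    "('a, 'b) monoid_scheme \<Rightarrow> ('a \<Rightarrow> complex) \<Rightarrow> (nat \<Rightarrow> 'a \<Rightarrow> complex) set \<Rightarrow> complex" where
  "duality G \<phi> x = (THE z. \<forall>g\<in>x. (\<lambda>n. pairing G \<phi> (g n)) \<longlonglongrightarrow> z)"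

text \<open>The coarsest topology on \<open>Md G d\<close> for which all \<open>\<lambda>\<phi>. duality G \<phi> x\<close>, \<open>x \<in> Xd G d\<close>, are
  continuous.\<close>

definition Md_weak_star :: "('a, 'b) monoid_scheme \<Rightarrow> nat \<Rightarrow> ('a \<Rightarrow> complex) topology" where
  "Md_weak_star G d = pullback_topology (Md G d) (\<lambda>\<phi>. \<lambda>x\<in>Xd G d. duality G \<phi> x)
     (product_topology (\<lambda>_. euclidean) (Xd G d))"

text \<open>\<open>closure_of\<close> intersects with the topological space, so the finitely supported functions
  are implicitly those in \<open>Md G d\<close> (in fact all of them are).\<close>

definition Md_AP :: "('a, 'b) monoid_scheme \<Rightarrow> nat \<Rightarrow> bool" where
  "Md_AP G d \<longleftrightarrow> const_one G \<in>
     Md_weak_star G d closure_of {\<phi> \<in> functions_on G. finite {t. \<phi> t \<noteq> 0}}"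

section \<open>Independence of the type of the Hilbert spaces\<close>

lemma complex_ring_simps [simp]:
  "carrier complex_ring = UNIV" "mult complex_ring = (*)" "add complex_ring = (+)"
  "one complex_ring = 1" "zero complex_ring = 0"
  by (simp_all add: complex_ring_def)

lemma cring_complex_ring: "cring complex_ring"
  by (unfold_locales)
    (auto simp: algebra_simps Units_def intro: exI[of _ "- x" for x] add.left_inverse add.right_inverse)

lemma complex_space_simps [simp]:
  "carrier complex_space = UNIV" "add complex_space = (+)" "zero complex_space = 0"
  "smult complex_space = (*)" "ip complex_space x y = x * cnj y"
  by (simp_all add: complex_space_def)

lemma hnorm_complex_space [simp]: "hnorm complex_space x = cmod x"
  by (simp add: hnorm_def cmod_def power2_eq_square)

context pre_hilbert_space
begin

lemma minus_smult: "x \<in> carrier H \<Longrightarrow> \<ominus> x = (-1) \<odot> x"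
  using smult_l_minus[of 1 x] cring.cring_simprules R.minus_equality[of "-1" 1]
  by (simp add: smult_one[simplified])

lemma ip_minus_left: "\<lbrakk>x \<in> carrier H; y \<in> carrier H\<rbrakk> \<Longrightarrow> ip H (\<ominus> x) y = - ip H x y"
  by (simp add: minus_smult ip_smult_left)

lemma ip_diff_left:
  "\<lbrakk>x \<in> carrier H; y \<in> carrier H; z \<in> carrier H\<rbrakk> \<Longrightarrow> ip H (x \<ominus> y) z = ip H x z - ip H y z"
  by (simp add: a_minus_def ip_add_left ip_minus_left)

lemma ip_zero_left [simp]: "y \<in> carrier H \<Longrightarrow> ip H \<zero> y = 0"
  using ip_add_left[of \<zero> \<zero> y] by simp

lemma ip_add_right:
  "\<lbrakk>x \<in> carrier H; y \<in> carrier H; z \<in> carrier H\<rbrakk> \<Longrightarrow> ip H z (x \<oplus> y) = ip H z x + ip H z y"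
  by (metis M.a_closed complex_cnj_add ip_add_left ip_cnj)

lemma ip_smult_right:
  "\<lbrakk>x \<in> carrier H; y \<in> carrier H\<rbrakk> \<Longrightarrow> ip H y (a \<odot> x) = cnj a * ip H y x"
  by (metis UNIV_I complex_cnj_mult complex_ring_simps(1) ip_cnj ip_smult_left smult_closed)

lemma ip_zero_right [simp]: "y \<in> carrier H \<Longrightarrow> ip H y \<zero> = 0"
  by (metis M.zero_closed complex_cnj_zero ip_cnj ip_zero_left)

lemma ip_diff_right:
  "\<lbrakk>x \<in> carrier H; y \<in> carrier H; z \<in> carrier H\<rbrakk> \<Longrightarrow> ip H z (x \<ominus> y) = ip H z x - ip H z y"
  by (metis M.minus_closed complex_cnj_diff ip_cnj ip_diff_left)

lemma ip_self_nonneg: "x \<in> carrier H \<Longrightarrow> Re (ip H x x) \<ge> 0"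
  by (cases "x = \<zero>") (auto intro: less_imp_le ip_pos)

lemma ip_self: "x \<in> carrier H \<Longrightarrow> ip H x x = complex_of_real ((hnorm H x)\<^sup>2)"
  using ip_cnj[of x x] ip_self_nonneg[of x]
  by (auto simp: hnorm_def complex_eq_iff)

lemma ip_self_eq_0: "x \<in> carrier H \<Longrightarrow> ip H x x = 0 \<Longrightarrow> x = \<zero>"
  using ip_pos by force

lemma hnorm_nonneg [simp]: "x \<in> carrier H \<Longrightarrow> hnorm H x \<ge> 0"
  by (simp add: hnorm_def ip_self_nonneg)

lemma hnorm_zero [simp]: "hnorm H \<zero> = 0"
  by (simp add: hnorm_def)

lemma hnorm_eq_0: "x \<in> carrier H \<Longrightarrow> hnorm H x = 0 \<Longrightarrow> x = \<zero>"
  by (rule ip_self_eq_0) (simp_all add: ip_self)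

lemma hnorm_smult: "x \<in> carrier H \<Longrightarrow> hnorm H (a \<odot> x) = cmod a * hnorm H x"
proof -
  assume x: "x \<in> carrier H"
  have "ip H (a \<odot> x) (a \<odot> x) = a * cnj a * ip H x x"
    using x by (simp add: ip_smult_left ip_smult_right)
  also have "\<dots> = complex_of_real ((cmod a)\<^sup>2 * (hnorm H x)\<^sup>2)"
    using x by (simp only: ip_self complex_norm_square of_real_mult)
  finally have "hnorm H (a \<odot> x) = sqrt ((cmod a * hnorm H x)\<^sup>2)"
    by (simp add: hnorm_def power_mult_distrib)
  then show ?thesis using x by simp
qed

lemma Cauchy_Schwarz:
  assumes x: "x \<in> carrier H" and y: "y \<in> carrier H"
  shows "cmod (ip H x y) \<le> hnorm H x * hnorm H y"
proof (cases "y = \<zero>")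
  case False
  then have n: "hnorm H y > 0" using y hnorm_eq_0[of y] hnorm_nonneg[of y] by linarith
  define c where "c = ip H x y"
  define a where "a = c / complex_of_real ((hnorm H y)\<^sup>2)"
  have yx: "ip H y x = cnj c" by (simp add: c_def ip_cnj[OF x y])
  have ay: "a \<odot> y \<in> carrier H" using y by simp
  have xy: "ip H x y = c" by (simp add: c_def)
  define N where "N = complex_of_real ((hnorm H y)\<^sup>2)"
  have N: "N \<noteq> 0" "cnj N = N" "ip H y y = N" "a = c / N"
    using n y by (simp_all add: N_def ip_self a_def)
  have "ip H (x \<ominus> a \<odot> y) (x \<ominus> a \<odot> y)
      = ip H x x - a * cnj c - cnj a * (c - a * N)"
    using x y ay by (simp only: ip_diff_left ip_diff_right ip_smult_left ip_smult_right
      M.minus_closed xy yx N(3))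
  also have "\<dots> = ip H x x - c * cnj c / N"
    using N(1,2) by (simp add: N(4))
  also have "\<dots> = complex_of_real ((hnorm H x)\<^sup>2 - (cmod c)\<^sup>2 / (hnorm H y)\<^sup>2)"
    using x by (simp only: ip_self N_def complex_norm_square[symmetric] of_real_diff of_real_divide of_real_power)
  finally have "0 \<le> (hnorm H x)\<^sup>2 - (cmod c)\<^sup>2 / (hnorm H y)\<^sup>2"
    using ip_self_nonneg[of "x \<ominus> a \<odot> y"] x ay by simp
  then have "(cmod c)\<^sup>2 \<le> (hnorm H x * hnorm H y)\<^sup>2"
    using n by (simp add: field_simps power_mult_distrib)
  then have "cmod c \<le> hnorm H x * hnorm H y"
    by (rule power2_le_imp_le) (use x y in simp)
  then show ?thesis by (simp add: c_def)
qed (use x in simp)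

end

definition closed_subspace :: "'h inner_space \<Rightarrow> 'h set \<Rightarrow> bool" where
  "closed_subspace H S \<longleftrightarrow> S \<subseteq> carrier H \<and> \<zero>\<^bsub>H\<^esub> \<in> S
     \<and> (\<forall>x\<in>S. \<forall>y\<in>S. x \<oplus>\<^bsub>H\<^esub> y \<in> S) \<and> (\<forall>a. \<forall>x\<in>S. a \<odot>\<^bsub>H\<^esub> x \<in> S)
     \<and> (\<forall>\<sigma> x. (\<forall>n::nat. \<sigma> n \<in> S) \<and> x \<in> carrier H \<and> (\<lambda>n. hnorm H (\<sigma> n \<ominus>\<^bsub>H\<^esub> x)) \<longlonglongrightarrow> 0 \<longrightarrow> x \<in> S)"

lemma closed_subspaceD:
  assumes "closed_subspace H S" "\<And>n::nat. \<sigma> n \<in> S" "x \<in> carrier H"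
    "(\<lambda>n. hnorm H (\<sigma> n \<ominus>\<^bsub>H\<^esub> x)) \<longlonglongrightarrow> 0"
  shows "x \<in> S"
  using assms(1) unfolding closed_subspace_def using assms(2-4) by metis

definition closed_span :: "'h inner_space \<Rightarrow> 'h set \<Rightarrow> 'h set" where
  "closed_span H A = \<Inter> {S. closed_subspace H S \<and> A \<subseteq> S}"

text \<open>The Hilbert space structure of \<open>S\<close> carried over to \<open>f ` S\<close>.\<close>

definition transport :: "('h \<Rightarrow> 'k) \<Rightarrow> 'h set \<Rightarrow> 'h inner_space \<Rightarrow> 'k inner_space" where
  "transport f S H = (let g = inv_into S f in
     \<lparr>carrier = f ` S, mult = (\<lambda>x y. f (g x \<otimes>\<^bsub>H\<^esub> g y)), one = f \<one>\<^bsub>H\<^esub>, zero = f \<zero>\<^bsub>H\<^esub>,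
      add = (\<lambda>x y. f (g x \<oplus>\<^bsub>H\<^esub> g y)), smult = (\<lambda>a x. f (a \<odot>\<^bsub>H\<^esub> g x)),
      ip = (\<lambda>x y. ip H (g x) (g y))\<rparr>)"

lemma (in pre_hilbert_space) carrier_closed_subspace: "closed_subspace H (carrier H)"
  by (auto simp: closed_subspace_def)

lemma (in pre_hilbert_space) closed_subspace_orthogonal:
  assumes v: "v \<in> carrier H"
  shows "closed_subspace H {u \<in> carrier H. ip H u v = 0}"
  unfolding closed_subspace_def
proof (intro conjI ballI allI impI)
  fix \<sigma> :: "nat \<Rightarrow> _" and x
  assume *: "(\<forall>n. \<sigma> n \<in> {u \<in> carrier H. ip H u v = 0}) \<and> x \<in> carrier H
      \<and> (\<lambda>n. hnorm H (\<sigma> n \<ominus> x)) \<longlonglongrightarrow> 0"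
  have "cmod (ip H x v) \<le> hnorm H (\<sigma> n \<ominus> x) * hnorm H v" for n
    using * v Cauchy_Schwarz[of "\<sigma> n \<ominus> x" v] by (simp add: ip_diff_left)
  moreover have "(\<lambda>n. hnorm H (\<sigma> n \<ominus> x) * hnorm H v) \<longlonglongrightarrow> 0 * hnorm H v"
    using * by (intro tendsto_intros) auto
  ultimately have "cmod (ip H x v) \<le> 0"
    by (intro tendsto_lowerbound[of _ _ sequentially]) auto
  then show "x \<in> {u \<in> carrier H. ip H u v = 0}" using * by simp
qed (auto simp: v ip_add_left ip_smult_left)

lemma closed_subspace_closed_span:
  assumes "hilbert_space H" "A \<subseteq> carrier H"
  shows "closed_subspace H (closed_span H A)"
proof -
  interpret hilbert_space H by fact
  have "closed_span H A \<subseteq> carrier H"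
    using carrier_closed_subspace assms(2) by (auto simp: closed_span_def)
  moreover have "\<zero>\<^bsub>H\<^esub> \<in> S" "\<And>x y. x \<in> S \<Longrightarrow> y \<in> S \<Longrightarrow> x \<oplus>\<^bsub>H\<^esub> y \<in> S"
    "\<And>a x. x \<in> S \<Longrightarrow> a \<odot>\<^bsub>H\<^esub> x \<in> S"
    "\<And>\<sigma> x. \<lbrakk>\<forall>n::nat. \<sigma> n \<in> S; x \<in> carrier H; (\<lambda>n. hnorm H (\<sigma> n \<ominus>\<^bsub>H\<^esub> x)) \<longlonglongrightarrow> 0\<rbrakk> \<Longrightarrow> x \<in> S"
    if "closed_subspace H S" for S
    using that unfolding closed_subspace_def by blast+
  moreover have "x \<in> closed_span H A \<longleftrightarrow> (\<forall>S. closed_subspace H S \<and> A \<subseteq> S \<longrightarrow> x \<in> S)" for x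
    by (auto simp: closed_span_def)
  ultimately show ?thesis
    unfolding closed_subspace_def[of H "closed_span H A"] by meson
qed

lemma closed_span_superset: "A \<subseteq> closed_span H A"
  by (auto simp: closed_span_def)

lemma closed_span_minimal: "closed_subspace H S \<Longrightarrow> A \<subseteq> S \<Longrightarrow> closed_span H A \<subseteq> S"
  by (auto simp: closed_span_def)

lemma carrier_transport [simp]: "carrier (transport f S H) = f ` S"
  by (simp add: transport_def Let_def)

lemma transport_simps:
  assumes "inj_on f S"
  shows "zero (transport f S H) = f \<zero>\<^bsub>H\<^esub>"
    and "\<lbrakk>x \<in> S; y \<in> S\<rbrakk> \<Longrightarrow> f x \<oplus>\<^bsub>transport f S H\<^esub> f y = f (x \<oplus>\<^bsub>H\<^esub> y)"
    and "x \<in> S \<Longrightarrow> a \<odot>\<^bsub>transport f S H\<^esub> f x = f (a \<odot>\<^bsub>H\<^esub> x)"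
    and "\<lbrakk>x \<in> S; y \<in> S\<rbrakk> \<Longrightarrow> ip (transport f S H) (f x) (f y) = ip H x y"
    and "x \<in> S \<Longrightarrow> hnorm (transport f S H) (f x) = hnorm H x"
  using assms by (simp_all add: transport_def Let_def hnorm_def)

lemma transport_id_complex_space [simp]: "transport id UNIV complex_space = complex_space"
  by (simp add: transport_def complex_space_def Let_def)

lemma pre_hilbert_space_transport:
  fixes H :: "'h inner_space" (structure)
  assumes "pre_hilbert_space H" and S: "closed_subspace H S" and f: "inj_on f S"
  shows "pre_hilbert_space (transport f S H)"
proof -
  interpret pre_hilbert_space H by fact
  let ?T = "transport f S H"
  note T = transport_simps[OF f]
  have sub: "x \<in> S \<Longrightarrow> x \<in> carrier H" and z: "\<zero> \<in> S"
    and add: "\<lbrakk>x \<in> S; y \<in> S\<rbrakk> \<Longrightarrow> x \<oplus> y \<in> S" and sm: "x \<in> S \<Longrightarrow> a \<odot> x \<in> S" for x y a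
    using S by (auto simp: closed_subspace_def)
  have inv: "\<exists>y\<in>S. y \<oplus> x = \<zero>" if "x \<in> S" for x
    using that sm[of x "-1"] minus_smult[of x] sub[of x] M.l_neg[of x] by force
  have grp: "abelian_group ?T"
  proof (rule abelian_groupI)
    fix x assume "x \<in> carrier ?T"
    then obtain u where u: "u \<in> S" "x = f u" by auto
    then obtain v where "v \<in> S" "v \<oplus> u = \<zero>" using inv by blast
    then show "\<exists>y\<in>carrier ?T. y \<oplus>\<^bsub>?T\<^esub> x = \<zero>\<^bsub>?T\<^esub>" using u by (auto simp: T intro!: bexI[of _ v])
  qed (auto simp: T z add sub M.a_ac)
  interpret T: Module.module complex_ring ?T
    by (rule moduleI[OF cring_complex_ring grp])
      (auto simp: T add sm sub smult_l_distr[simplified] smult_r_distr[simplified]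
        smult_assoc1[simplified] smult_one[simplified])
  show ?thesis
  proof
    fix x y z assume "x \<in> carrier ?T" "y \<in> carrier ?T" "z \<in> carrier ?T"
    then show "ip ?T (x \<oplus>\<^bsub>?T\<^esub> y) z = ip ?T x z + ip ?T y z"
      by (auto simp: T add sub ip_add_left)
  next
    fix x y a assume "x \<in> carrier ?T" "y \<in> carrier ?T"
    then show "ip ?T (a \<odot>\<^bsub>?T\<^esub> x) y = a * ip ?T x y"
      by (auto simp: T sm sub ip_smult_left)
  next
    fix x y assume "x \<in> carrier ?T" "y \<in> carrier ?T"
    then obtain u v where uv: "u \<in> S" "v \<in> S" "x = f u" "y = f v" by auto
    show "ip ?T y x = cnj (ip ?T x y)"
      using ip_cnj[of u v] uv by (simp add: T sub)
  next
    fix x assume "x \<in> carrier ?T" "x \<noteq> \<zero>\<^bsub>?T\<^esub>"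
    then obtain u where u: "u \<in> S" "x = f u" "u \<noteq> \<zero>" by (auto simp: T)
    then show "Re (ip ?T x x) > 0"
      using ip_pos[of u] by (simp add: T sub)
  qed
qed

lemma transport_minus:
  fixes H :: "'h inner_space" (structure)
  assumes "pre_hilbert_space H" and S: "closed_subspace H S" and f: "inj_on f S"
    and x: "x \<in> S" and y: "y \<in> S"
  shows "f x \<ominus>\<^bsub>transport f S H\<^esub> f y = f (x \<ominus>\<^bsub>H\<^esub> y)" "x \<ominus>\<^bsub>H\<^esub> y \<in> S"
proof -
  interpret pre_hilbert_space H by fact
  interpret T: pre_hilbert_space "transport f S H"
    using assms pre_hilbert_space_transport by blast
  have yc: "y \<in> carrier H" and sm: "(-1) \<odot> y \<in> S" using S y by (auto simp: closed_subspace_def)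
  show "f x \<ominus>\<^bsub>transport f S H\<^esub> f y = f (x \<ominus> y)"
    using x y yc sm
    by (simp add: a_minus_def T.minus_smult minus_smult transport_simps[OF f])
  show "x \<ominus> y \<in> S"
    using S x sm yc by (simp add: a_minus_def minus_smult closed_subspace_def)
qed

lemma hilbert_space_transport:
  fixes H :: "'h inner_space" (structure)
  assumes "hilbert_space H" and S: "closed_subspace H S" and f: "inj_on f S"
  shows "hilbert_space (transport f S H)"
proof -
  interpret hilbert_space H by fact
  have pre: "pre_hilbert_space H" ..
  let ?T = "transport f S H"
  interpret T: pre_hilbert_space ?T
    using pre_hilbert_space_transport[OF pre S f] .
  note T = transport_simps[OF f] transport_minus[OF pre S f]
  show ?thesis
  proof
    fix \<sigma> :: "nat \<Rightarrow> _"
    assume \<sigma>: "\<And>n. \<sigma> n \<in> carrier ?T"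
      and Cauchy: "\<And>e. e > 0 \<Longrightarrow> \<exists>N. \<forall>m\<ge>N. \<forall>n\<ge>N. hnorm ?T (\<sigma> m \<ominus>\<^bsub>?T\<^esub> \<sigma> n) < e"
    have "\<forall>n. \<exists>u\<in>S. \<sigma> n = f u"
      using \<sigma> by (metis carrier_transport imageE)
    then obtain \<tau> where \<tau>: "\<And>n. \<tau> n \<in> S" "\<And>n. \<sigma> n = f (\<tau> n)" by metis
    have "\<exists>x\<in>carrier H. (\<lambda>n. hnorm H (\<tau> n \<ominus> x)) \<longlonglongrightarrow> 0"
    proof (rule complete)
      show "\<tau> n \<in> carrier H" for n using \<tau> S by (auto simp: closed_subspace_def)
      show "\<exists>N. \<forall>m\<ge>N. \<forall>n\<ge>N. hnorm H (\<tau> m \<ominus> \<tau> n) < e" if "e > 0" for e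
        using Cauchy[OF that] \<tau> by (simp add: T)
    qed
    then obtain x where x: "x \<in> carrier H" "(\<lambda>n. hnorm H (\<tau> n \<ominus> x)) \<longlonglongrightarrow> 0" by blast
    then have "x \<in> S" by (intro closed_subspaceD[where \<sigma> = \<tau>, OF S \<tau>(1)])
    then show "\<exists>x\<in>carrier ?T. (\<lambda>n. hnorm ?T (\<sigma> n \<ominus>\<^bsub>?T\<^esub> x)) \<longlonglongrightarrow> 0"
      using x \<tau> by (auto simp: T intro!: bexI[of _ x])
  qed
qed

lemma pre_hilbert_space_complex_space: "pre_hilbert_space complex_space"
proof -
  have "abelian_group complex_space"
    by (rule abelian_groupI) (auto intro: exI[of _ "- x" for x])
  then interpret Module.module complex_ring complex_space
    by (intro moduleI cring_complex_ring) (auto simp: algebra_simps)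
  show ?thesis
    by unfold_locales
      (auto simp: algebra_simps complex_eq_iff simp del: complex_space_simps(5)
        simp: complex_space_simps(5) intro: sum_squares_gt_zero_iff[THEN iffD2])
qed

lemma hilbert_space_complex_space: "hilbert_space complex_space"
proof -
  interpret pre_hilbert_space complex_space by (rule pre_hilbert_space_complex_space)
  have minus: "x \<ominus>\<^bsub>complex_space\<^esub> y = x - y" for x y :: complex
    using minus_smult[of y] by (simp add: a_minus_def)
  show ?thesis
  proof
    fix \<sigma> :: "nat \<Rightarrow> complex"
    assume "\<And>e. e > 0 \<Longrightarrow>
      \<exists>N. \<forall>m\<ge>N. \<forall>n\<ge>N. hnorm complex_space (\<sigma> m \<ominus>\<^bsub>complex_space\<^esub> \<sigma> n) < e"
    then have "Cauchy \<sigma>"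
      by (simp add: minus Cauchy_def dist_norm)
    then obtain x where "\<sigma> \<longlonglongrightarrow> x"
      using Cauchy_convergent convergentD by blast
    then have "(\<lambda>n. cmod (\<sigma> n - x)) \<longlonglongrightarrow> 0"
      by (simp add: LIM_zero tendsto_norm_zero)
    then show "\<exists>x\<in>carrier complex_space.
        (\<lambda>n. hnorm complex_space (\<sigma> n \<ominus>\<^bsub>complex_space\<^esub> x)) \<longlonglongrightarrow> 0"
      by (auto simp: minus)
  qed
qed

lemma bdd_above_opnorm:
  assumes "pre_hilbert_space H" "T \<in> bounded_ops H K"
  shows "bdd_above ((\<lambda>x. hnorm K (T x)) ` {x \<in> carrier H. hnorm H x \<le> 1})"
proof -
  interpret pre_hilbert_space H by fact
  obtain C where C: "\<And>x. x \<in> carrier H \<Longrightarrow> hnorm K (T x) \<le> C * hnorm H x"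
    using assms unfolding bounded_ops_def by blast
  have "hnorm K (T x) \<le> max C 0" if "x \<in> carrier H" "hnorm H x \<le> 1" for x
  proof -
    have "C * hnorm H x \<le> max C 0 * 1"
      using that by (intro mult_mono) auto
    then show ?thesis using C[OF that(1)] by linarith
  qed
  then show ?thesis by (auto intro!: bdd_aboveI2)
qed

lemma opnorm_nonneg:
  assumes "pre_hilbert_space H" "pre_hilbert_space K" "T \<in> bounded_ops H K"
  shows "opnorm H K T \<ge> 0"
proof -
  interpret H: pre_hilbert_space H by fact
  interpret K: pre_hilbert_space K by fact
  have "T \<zero>\<^bsub>H\<^esub> \<in> carrier K" using assms(3) by (auto simp: bounded_ops_def)
  then have "0 \<le> hnorm K (T \<zero>\<^bsub>H\<^esub>)" by simp
  also have "\<dots> \<le> opnorm H K T"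
    unfolding opnorm_def by (rule cSUP_upper) (auto intro: bdd_above_opnorm assms)
  finally show ?thesis .
qed

lemma hnorm_le_opnorm:
  assumes "pre_hilbert_space H" "pre_hilbert_space K" "T \<in> bounded_ops H K" "x \<in> carrier H"
  shows "hnorm K (T x) \<le> opnorm H K T * hnorm H x"
proof -
  interpret H: pre_hilbert_space H by fact
  interpret K: pre_hilbert_space K by fact
  have Tx: "T x \<in> carrier K" using assms by (auto simp: bounded_ops_def)
  show ?thesis
  proof (cases "hnorm H x = 0")
    case True
    then show ?thesis using assms(3,4) by (auto simp: bounded_ops_def)
  next
    case False
    then have n: "hnorm H x > 0" using H.hnorm_nonneg[OF assms(4)] by linarith
    define y where "y = complex_of_real (inverse (hnorm H x)) \<odot>\<^bsub>H\<^esub> x"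
    have y: "y \<in> carrier H" "hnorm H y \<le> 1"
      using n assms(4) by (auto simp: y_def H.hnorm_smult norm_inverse)
    have "hnorm K (T y) \<le> opnorm H K T"
      unfolding opnorm_def using y by (intro cSUP_upper bdd_above_opnorm assms) auto
    moreover have "hnorm K (T y) = inverse (hnorm H x) * hnorm K (T x)"
      using assms(3,4) n Tx by (auto simp: y_def bounded_ops_def K.hnorm_smult norm_inverse)
    ultimately show ?thesis using n by (simp add: field_simps)
  qed
qed

lemma opnorm_le:
  assumes "pre_hilbert_space H"
    and "\<And>x. x \<in> carrier H \<Longrightarrow> hnorm H x \<le> 1 \<Longrightarrow> hnorm K (T x) \<le> c"
  shows "opnorm H K T \<le> c"
proof -
  interpret H: pre_hilbert_space H by fact
  show ?thesis unfolding opnorm_def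
    by (rule cSUP_least) (use assms in \<open>auto intro!: exI[of _ "\<zero>\<^bsub>H\<^esub>"]\<close>)
qed

lemma opnorm_le_sup_norm:
  "bounded_map G H K \<xi> \<Longrightarrow> t \<in> carrier G \<Longrightarrow> opnorm H K (\<xi> t) \<le> sup_norm G H K \<xi>"
  unfolding sup_norm_def by (rule cSUP_upper) (auto simp: bounded_map_def)

lemma sup_norm_nonneg:
  assumes "pre_hilbert_space H" "pre_hilbert_space K" "bounded_map G H K \<xi>" "carrier G \<noteq> {}"
  shows "sup_norm G H K \<xi> \<ge> 0"
proof -
  obtain t where t: "t \<in> carrier G" using assms by blast
  then have "0 \<le> opnorm H K (\<xi> t)"
    using assms by (intro opnorm_nonneg) (auto simp: bounded_map_def)
  then show ?thesis using opnorm_le_sup_norm[OF assms(3) t] by linarith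
qed

lemma bounded_map_transport:
  assumes H: "pre_hilbert_space H" and K: "pre_hilbert_space K" and b: "bounded_map G H K \<xi>"
    and S: "closed_subspace H S" "inj_on f S" and R: "closed_subspace K R" "inj_on g R"
    and SR: "\<And>t x. t \<in> carrier G \<Longrightarrow> x \<in> S \<Longrightarrow> \<xi> t x \<in> R" and G: "carrier G \<noteq> {}"
  defines "\<xi>' \<equiv> \<lambda>t x. g (\<xi> t (inv_into S f x))"
  shows "bounded_map G (transport f S H) (transport g R K) \<xi>'"
    and "sup_norm G (transport f S H) (transport g R K) \<xi>' \<le> sup_norm G H K \<xi>"
proof -
  let ?H = "transport f S H" and ?K = "transport g R K"
  interpret H: pre_hilbert_space H by fact
  interpret H': pre_hilbert_space ?H using H S by (rule pre_hilbert_space_transport)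
  have H': "pre_hilbert_space ?H" ..
  note T = transport_simps[OF S(2)] transport_simps[OF R(2)]
  have sub: "x \<in> S \<Longrightarrow> x \<in> carrier H" and add: "\<lbrakk>x \<in> S; y \<in> S\<rbrakk> \<Longrightarrow> x \<oplus>\<^bsub>H\<^esub> y \<in> S"
    and sm: "x \<in> S \<Longrightarrow> a \<odot>\<^bsub>H\<^esub> x \<in> S" for x y a
    using S by (auto simp: closed_subspace_def)
  have xi': "\<xi>' t (f x) = g (\<xi> t x)" if "x \<in> S" for t x
    using that S(2) by (simp add: \<xi>'_def)
  have ops: "\<xi>' t \<in> bounded_ops ?H ?K" if t: "t \<in> carrier G" for t
  proof -
    have "\<xi> t \<in> bounded_ops H K" using b t by (simp add: bounded_map_def)
    then obtain C where C: "\<forall>x\<in>carrier H. hnorm K (\<xi> t x) \<le> C * hnorm H x"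
      and *: "\<And>x y. \<lbrakk>x \<in> carrier H; y \<in> carrier H\<rbrakk> \<Longrightarrow> \<xi> t (x \<oplus>\<^bsub>H\<^esub> y) = \<xi> t x \<oplus>\<^bsub>K\<^esub> \<xi> t y"
        "\<And>a x. x \<in> carrier H \<Longrightarrow> \<xi> t (a \<odot>\<^bsub>H\<^esub> x) = a \<odot>\<^bsub>K\<^esub> \<xi> t x"
      by (auto simp: bounded_ops_def)
    show ?thesis unfolding bounded_ops_def
      using C by (auto simp: xi' T * sub add sm SR[OF t] intro!: exI[of _ C])
  qed
  have le: "opnorm ?H ?K (\<xi>' t) \<le> sup_norm G H K \<xi>" if t: "t \<in> carrier G" for t
  proof (rule opnorm_le[OF H'])
    fix y assume "y \<in> carrier ?H" "hnorm ?H y \<le> 1"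
    then obtain x where x: "x \<in> S" "y = f x" "hnorm H x \<le> 1" by (auto simp: T)
    have "\<xi> t \<in> bounded_ops H K" using b t by (simp add: bounded_map_def)
    then have "hnorm K (\<xi> t x) \<le> opnorm H K (\<xi> t) * hnorm H x"
      using H K x sub by (intro hnorm_le_opnorm)
    also have "\<dots> \<le> sup_norm G H K \<xi> * 1"
      using x sub H K b t sup_norm_nonneg[OF H K b G]
      by (intro mult_mono opnorm_le_sup_norm) auto
    finally show "hnorm ?K (\<xi>' t y) \<le> sup_norm G H K \<xi>"
      using x by (simp add: xi' T SR[OF t])
  qed
  show "bounded_map G ?H ?K \<xi>'"
    unfolding bounded_map_def using ops le by (auto intro!: bdd_aboveI2)
  show "sup_norm G ?H ?K \<xi>' \<le> sup_norm G H K \<xi>"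
    unfolding sup_norm_def[of G ?H] by (rule cSUP_least) (use le G in auto)
qed

lemma closed_subspace_vimage:
  assumes H: "hilbert_space H" and K: "hilbert_space K" and T: "T \<in> bounded_ops H K"
    and R: "closed_subspace K R"
  shows "closed_subspace H {x \<in> carrier H. T x \<in> R}"
proof -
  interpret H: hilbert_space H by fact
  interpret K: hilbert_space K by fact
  have lin: "\<And>x y. \<lbrakk>x \<in> carrier H; y \<in> carrier H\<rbrakk> \<Longrightarrow> T (x \<oplus>\<^bsub>H\<^esub> y) = T x \<oplus>\<^bsub>K\<^esub> T y"
      "\<And>a x. x \<in> carrier H \<Longrightarrow> T (a \<odot>\<^bsub>H\<^esub> x) = a \<odot>\<^bsub>K\<^esub> T x"
    and car: "\<And>x. x \<in> carrier H \<Longrightarrow> T x \<in> carrier K"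
    using T by (auto simp: bounded_ops_def)
  obtain C where C: "\<And>x. x \<in> carrier H \<Longrightarrow> hnorm K (T x) \<le> C * hnorm H x"
    using T unfolding bounded_ops_def by blast
  have zero: "T \<zero>\<^bsub>H\<^esub> = \<zero>\<^bsub>K\<^esub>"
    using lin(2)[of "\<zero>\<^bsub>H\<^esub>" 0] car[of "\<zero>\<^bsub>H\<^esub>"] H.smult_l_null[of "\<zero>\<^bsub>H\<^esub>"] K.smult_l_null by simp
  have diff: "T (x \<ominus>\<^bsub>H\<^esub> y) = T x \<ominus>\<^bsub>K\<^esub> T y" if "x \<in> carrier H" "y \<in> carrier H" for x y
    using that car by (simp add: a_minus_def H.minus_smult K.minus_smult lin H.smult_closed[simplified])
  show ?thesis
    unfolding closed_subspace_def
  proof (intro conjI ballI allI impI)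
    fix \<sigma> :: "nat \<Rightarrow> _" and x
    assume *: "(\<forall>n. \<sigma> n \<in> {x \<in> carrier H. T x \<in> R}) \<and> x \<in> carrier H
      \<and> (\<lambda>n. hnorm H (\<sigma> n \<ominus>\<^bsub>H\<^esub> x)) \<longlonglongrightarrow> 0"
    then have \<sigma>: "\<And>n. \<sigma> n \<in> carrier H" "\<And>n. T (\<sigma> n) \<in> R" and x: "x \<in> carrier H"
      and lim: "(\<lambda>n. hnorm H (\<sigma> n \<ominus>\<^bsub>H\<^esub> x)) \<longlonglongrightarrow> 0" by auto
    have "(\<lambda>n. C * hnorm H (\<sigma> n \<ominus>\<^bsub>H\<^esub> x)) \<longlonglongrightarrow> C * 0"
      by (intro tendsto_mult tendsto_const lim)
    moreover have "hnorm K (T (\<sigma> n) \<ominus>\<^bsub>K\<^esub> T x) \<le> C * hnorm H (\<sigma> n \<ominus>\<^bsub>H\<^esub> x)" for n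
      using C[of "\<sigma> n \<ominus>\<^bsub>H\<^esub> x"] diff[OF \<sigma>(1) x] H.minus_closed[OF \<sigma>(1) x] by simp
    moreover have "0 \<le> hnorm K (T (\<sigma> n) \<ominus>\<^bsub>K\<^esub> T x)" for n
      by (rule K.hnorm_nonneg[OF K.minus_closed[OF car[OF \<sigma>(1)] car[OF x]]])
    ultimately have "(\<lambda>n. hnorm K (T (\<sigma> n) \<ominus>\<^bsub>K\<^esub> T x)) \<longlonglongrightarrow> 0"
      by - (rule Lim_null_comparison[OF always_eventually, rotated], simp only: mult_zero_right, simp)
    then have "T x \<in> R" by (rule closed_subspaceD[OF R \<sigma>(2) car[OF x]])
    then show "x \<in> {x \<in> carrier H. T x \<in> R}" using x by simp
  qed (use R in \<open>auto simp: closed_subspace_def zero lin\<close>)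
qed

theorem Md_factorization_universal:
  fixes G :: "('a, 'b) monoid_scheme" and H :: "nat \<Rightarrow> 'h inner_space"
  assumes d: "d \<ge> 2" and G: "carrier G \<noteq> {}" and F: "Md_factorization G d \<phi> H \<alpha> \<xi> \<beta>"
  obtains H' :: "nat \<Rightarrow> ('a list \<Rightarrow> complex) inner_space" and \<alpha>' \<xi>' \<beta>'
  where "Md_factorization G d \<phi> H' \<alpha>' \<xi>' \<beta>'"
    and "Md_bound G d H' \<alpha>' \<xi>' \<beta>' \<le> Md_bound G d H \<alpha> \<xi> \<beta>"
proof -
  have hil: "hilbert_space (H i)" if "1 \<le> i" "i < d" for i
    using F that by (auto simp: Md_factorization_def)
  then have pre: "pre_hilbert_space (H i)" if "1 \<le> i" "i < d" for i
    using that hilbert_space.axioms(1) by blast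
  have b: "bounded_map G (H 1) complex_space \<alpha>"
      "\<And>i. 2 \<le> i \<Longrightarrow> i < d \<Longrightarrow> bounded_map G (H i) (H (i - 1)) (\<xi> i)"
      "bounded_map G complex_space (H (d - 1)) \<beta>"
    and eq: "\<And>s ts u. \<lbrakk>s \<in> carrier G; set ts \<subseteq> carrier G; u \<in> carrier G; length ts = d - 2\<rbrakk>
      \<Longrightarrow> \<phi> (s \<otimes>\<^bsub>G\<^esub> foldr (\<otimes>\<^bsub>G\<^esub>) ts u) = \<alpha> s (op_prod \<xi> 2 ts (\<beta> u 1))"
    using F by (auto simp: Md_factorization_def lists_eq_set)
  define vec where "vec i l = op_prod \<xi> (Suc i) (butlast l) (\<beta> (last l) 1)" for i and l :: "'a list"
  define W where "W i = {l. l \<noteq> [] \<and> set l \<subseteq> carrier G \<and> length l = d - i}" for i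
  define S where "S i = closed_span (H i) (vec i ` W i)" for i
  define f where "f i v = (\<lambda>l. if l \<in> W i then ip (H i) v (vec i l) else 0)" for i v
  have \<beta>1: "\<beta> u z \<in> carrier (H (d - 1))" if "u \<in> carrier G" for u z
    using b(3) that by (auto simp: bounded_map_def bounded_ops_def Pi_iff)
  have \<xi>c: "\<xi> i t v \<in> carrier (H (i - 1))"
    if "2 \<le> i" "i < d" "t \<in> carrier G" "v \<in> carrier (H i)" for i t v
    using b(2)[OF that(1,2)] that by (auto simp: bounded_map_def bounded_ops_def)
  have opc: "op_prod \<xi> (Suc i) ts v \<in> carrier (H i)"
    if "1 \<le> i" "i + length ts = d - 1" "set ts \<subseteq> carrier G" "v \<in> carrier (H (d - 1))" for i ts v
    using that
  proof (induction ts arbitrary: i)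
    case (Cons t ts)
    then have "op_prod \<xi> (Suc (Suc i)) ts v \<in> carrier (H (Suc i))" by simp
    then show ?case using Cons.prems \<xi>c[of "Suc i" t] by simp
  qed simp
  have vec: "vec i ` W i \<subseteq> carrier (H i)" if "1 \<le> i" "i < d" for i
  proof
    fix x assume "x \<in> vec i ` W i"
    then obtain l where l: "l \<noteq> []" "set l \<subseteq> carrier G" "length l = d - i" "x = vec i l"
      by (auto simp: W_def)
    then show "x \<in> carrier (H i)"
      unfolding l(4) vec_def using that
      by (intro opc \<beta>1) (auto dest: in_set_butlastD)
  qed
  have S: "closed_subspace (H i) (S i)" if "1 \<le> i" "i < d" for i
    unfolding S_def using that by (intro closed_subspace_closed_span hil vec)
  have Sc: "v \<in> S i \<Longrightarrow> v \<in> carrier (H i)" if "1 \<le> i" "i < d" for i v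
    using S[OF that] by (auto simp: closed_subspace_def)
  have vecS: "l \<in> W i \<Longrightarrow> vec i l \<in> S i" for i l
    using closed_span_superset[of "vec i ` W i" "H i"] by (auto simp: S_def)
  have inj: "inj_on (f i) (S i)" if i: "1 \<le> i" "i < d" for i
  proof (rule inj_onI)
    interpret hilbert_space "H i" using hil i by blast
    fix v w assume vw: "v \<in> S i" "w \<in> S i" and fvw: "f i v = f i w"
    have e: "ip (H i) v (vec i l) = ip (H i) w (vec i l)" if "l \<in> W i" for l
      using fun_cong[OF fvw, of l] that by (simp add: f_def)
    define x where "x = v \<ominus>\<^bsub>H i\<^esub> w"
    have c: "v \<in> carrier (H i)" "w \<in> carrier (H i)" using vw Sc i by auto
    then have x: "x \<in> carrier (H i)" by (simp add: x_def)
    have xS: "x \<in> S i"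
      unfolding x_def by (rule transport_minus(2)[OF pre[OF i] S[OF i] inj_on_id vw])
    have "S i \<subseteq> {u \<in> carrier (H i). ip (H i) u x = 0}"
      unfolding S_def
    proof (rule closed_span_minimal[OF closed_subspace_orthogonal[OF x]])
      show "vec i ` W i \<subseteq> {u \<in> carrier (H i). ip (H i) u x = 0}"
      proof
        fix u assume "u \<in> vec i ` W i"
        then obtain l where l: "l \<in> W i" "u = vec i l" by blast
        have u: "u \<in> carrier (H i)" using vec[OF i] l by blast
        have "ip (H i) x u = 0"
          using e[OF l(1)] ip_diff_left[OF c u] l(2) by (simp add: x_def)
        then show "u \<in> {u \<in> carrier (H i). ip (H i) u x = 0}"
          using u ip_cnj[OF x u] by simp
      qed
    qed
    then have "ip (H i) x x = 0" using xS by auto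
    then have "x = \<zero>\<^bsub>H i\<^esub>" by (rule ip_self_eq_0[OF x])
    then show "v = w"
      using c M.minus_equality[of v "\<ominus>\<^bsub>H i\<^esub> w"] by (simp add: x_def a_minus_def)
  qed
  have \<xi>S: "\<xi> i t v \<in> S (i - 1)" if i: "2 \<le> i" "i < d" and t: "t \<in> carrier G" and v: "v \<in> S i" for i t v
  proof -
    have "\<xi> i t \<in> bounded_ops (H i) (H (i - 1))"
      using b(2)[OF i] t by (simp add: bounded_map_def)
    then have "closed_subspace (H i) {x \<in> carrier (H i). \<xi> i t x \<in> S (i - 1)}"
      using i by (intro closed_subspace_vimage[OF hil[of i] hil[of "i - 1"] _ S[of "i - 1"]]) auto
    moreover have "vec i ` W i \<subseteq> {x \<in> carrier (H i). \<xi> i t x \<in> S (i - 1)}"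
    proof
      fix x assume x: "x \<in> vec i ` W i"
      then obtain l where l: "l \<in> W i" "x = vec i l" by blast
      have "t # l \<in> W (i - 1)" using l t i by (auto simp: W_def)
      moreover have "\<xi> i t (vec i l) = vec (i - 1) (t # l)"
        using l i by (auto simp: vec_def W_def)
      ultimately show "x \<in> {x \<in> carrier (H i). \<xi> i t x \<in> S (i - 1)}"
        using x vec[of i] i vecS l by auto
    qed
    ultimately have "S i \<subseteq> {x \<in> carrier (H i). \<xi> i t x \<in> S (i - 1)}"
      unfolding S_def[of i] by (rule closed_span_minimal)
    then show ?thesis using v by auto
  qed
  have \<beta>S: "\<beta> u z \<in> S (d - 1)" if u: "u \<in> carrier G" for u z
  proof -
    have "\<beta> u \<in> bounded_ops complex_space (H (d - 1))"
      using b(3) u by (simp add: bounded_map_def)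
    then have "\<beta> u (z * 1) = z \<odot>\<^bsub>H (d - 1)\<^esub> \<beta> u 1"
      unfolding bounded_ops_def by (simp del: mult_1_right)
    moreover have "\<beta> u 1 = vec (d - 1) [u]" "[u] \<in> W (d - 1)"
      using u d by (auto simp: vec_def W_def)
    ultimately show ?thesis
      using vecS S[of "d - 1"] d by (auto simp: closed_subspace_def)
  qed
  define H' where "H' i = transport (f i) (S i) (H i)" for i
  define \<alpha>' where "\<alpha>' t x = \<alpha> t (inv_into (S 1) (f 1) x)" for t x
  define \<xi>' where "\<xi>' i t x = f (i - 1) (\<xi> i t (inv_into (S i) (f i) x))" for i t x
  define \<beta>' where "\<beta>' t z = f (d - 1) (\<beta> t z)" for t z
  note C = pre_hilbert_space_complex_space
  have CS: "closed_subspace complex_space UNIV"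
    using pre_hilbert_space.carrier_closed_subspace[OF C] by simp
  have a: "bounded_map G (H' 1) complex_space \<alpha>'"
    "sup_norm G (H' 1) complex_space \<alpha>' \<le> sup_norm G (H 1) complex_space \<alpha>"
    using bounded_map_transport[OF pre C b(1) S inj CS inj_on_id _ G] d
    by (simp_all add: H'_def \<alpha>'_def[abs_def])
  have x: "bounded_map G (H' i) (H' (i - 1)) (\<xi>' i)"
    "sup_norm G (H' i) (H' (i - 1)) (\<xi>' i) \<le> sup_norm G (H i) (H (i - 1)) (\<xi> i)"
    if "2 \<le> i" "i < d" for i
    using bounded_map_transport[OF pre pre b(2) S inj S inj \<xi>S G] that
    by (simp_all add: H'_def \<xi>'_def[abs_def])
  have be: "bounded_map G complex_space (H' (d - 1)) \<beta>'"
    "sup_norm G complex_space (H' (d - 1)) \<beta>' \<le> sup_norm G complex_space (H (d - 1)) \<beta>"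
    using bounded_map_transport[OF C pre b(3) CS inj_on_id S inj \<beta>S G] d
    by (simp_all add: H'_def \<beta>'_def[abs_def])
  have hil': "hilbert_space (H' i)" if "1 \<le> i" "i < d" for i
    unfolding H'_def using that by (intro hilbert_space_transport hil S inj)
  then have pre': "pre_hilbert_space (H' i)" if "1 \<le> i" "i < d" for i
    using that hilbert_space.axioms(1) by blast
  have \<xi>'f: "\<xi>' i t (f i v) = f (i - 1) (\<xi> i t v)" if "2 \<le> i" "i < d" "v \<in> S i" for i t v
    using inj[of i] that by (simp add: \<xi>'_def)
  have op: "op_prod \<xi>' (Suc i) ts (f (d - 1) v) = f i (op_prod \<xi> (Suc i) ts v)
      \<and> op_prod \<xi> (Suc i) ts v \<in> S i"
    if "1 \<le> i" "i + length ts = d - 1" "set ts \<subseteq> carrier G" "v \<in> S (d - 1)" for i ts v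
    using that
  proof (induction ts arbitrary: i)
    case (Cons t ts)
    then have "op_prod \<xi>' (Suc (Suc i)) ts (f (d - 1) v) = f (Suc i) (op_prod \<xi> (Suc (Suc i)) ts v)"
      "op_prod \<xi> (Suc (Suc i)) ts v \<in> S (Suc i)" by simp_all
    then show ?case using Cons.prems \<xi>S[of "Suc i" t] \<xi>'f[of "Suc i"] by auto
  qed simp
  have fac: "Md_factorization G d \<phi> H' \<alpha>' \<xi>' \<beta>'"
    unfolding Md_factorization_def
  proof (intro conjI ballI impI)
    fix s ts u assume h: "s \<in> carrier G" "ts \<in> lists (carrier G)" "u \<in> carrier G" "length ts = d - 2"
    then have "op_prod \<xi>' (Suc 1) ts (\<beta>' u 1) = f 1 (op_prod \<xi> (Suc 1) ts (\<beta> u 1))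
        \<and> op_prod \<xi> (Suc 1) ts (\<beta> u 1) \<in> S 1"
      unfolding \<beta>'_def using d by (intro op \<beta>S) auto
    then have "\<alpha>' s (op_prod \<xi>' 2 ts (\<beta>' u 1)) = \<alpha> s (op_prod \<xi> 2 ts (\<beta> u 1))"
      using inj[of 1] d by (simp add: \<alpha>'_def numeral_2_eq_2)
    then show "\<phi> (s \<otimes>\<^bsub>G\<^esub> foldr (\<otimes>\<^bsub>G\<^esub>) ts u) = \<alpha>' s (op_prod \<xi>' 2 ts (\<beta>' u 1))"
      using eq[of s ts u] h by (auto simp: lists_eq_set)
  qed (use a x be hil' in auto)
  have "Md_bound G d H' \<alpha>' \<xi>' \<beta>' \<le> Md_bound G d H \<alpha> \<xi> \<beta>"
    unfolding Md_bound_def using d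
    by (intro mult_mono prod_mono a x be conjI prod_nonneg mult_nonneg_nonneg)
      (auto intro!: sup_norm_nonneg pre pre' C G a[unfolded One_nat_def] x[unfolded One_nat_def]
        be[unfolded One_nat_def] b[unfolded One_nat_def])
  with fac show thesis by (rule that)
qed

section \<open>The duality is well defined\<close>

lemma Md_factorization_pre_hilbert:
  "Md_factorization G d \<phi> H \<alpha> \<xi> \<beta> \<Longrightarrow> 1 \<le> i \<Longrightarrow> i < d \<Longrightarrow> pre_hilbert_space (H i)"
  by (auto simp: Md_factorization_def intro: hilbert_space.axioms(1))

lemma hnorm_le_sup_norm:
  assumes H: "pre_hilbert_space H" and K: "pre_hilbert_space K" and b: "bounded_map G H K \<xi>"
    and t: "t \<in> carrier G" and x: "x \<in> carrier H"
  shows "hnorm K (\<xi> t x) \<le> sup_norm G H K \<xi> * hnorm H x" "\<xi> t x \<in> carrier K"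
proof -
  interpret H: pre_hilbert_space H by fact
  have T: "\<xi> t \<in> bounded_ops H K" using b t by (simp add: bounded_map_def)
  have "hnorm K (\<xi> t x) \<le> opnorm H K (\<xi> t) * hnorm H x"
    by (rule hnorm_le_opnorm[OF H K T x])
  also have "\<dots> \<le> sup_norm G H K \<xi> * hnorm H x"
    using x by (intro mult_right_mono opnorm_le_sup_norm b t) auto
  finally show "hnorm K (\<xi> t x) \<le> sup_norm G H K \<xi> * hnorm H x" .
  show "\<xi> t x \<in> carrier K" using T x by (auto simp: bounded_ops_def)
qed

lemma Md_bound_nonneg:
  assumes "d \<ge> 2" "carrier G \<noteq> {}" "Md_factorization G d \<phi> H \<alpha> \<xi> \<beta>"
  shows "Md_bound G d H \<alpha> \<xi> \<beta> \<ge> 0"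
  unfolding Md_bound_def using assms Md_factorization_pre_hilbert[OF assms(3)]
  by (intro mult_nonneg_nonneg prod_nonneg)
    (auto simp: Md_factorization_def intro!: sup_norm_nonneg pre_hilbert_space_complex_space)

lemma cmod_le_Md_bound:
  assumes d: "d \<ge> 2" and "group G" and F: "Md_factorization G d \<phi> H \<alpha> \<xi> \<beta>" and t: "t \<in> carrier G"
  shows "cmod (\<phi> t) \<le> Md_bound G d H \<alpha> \<xi> \<beta>"
proof -
  interpret group G by fact
  have pre: "pre_hilbert_space (H i)" if "1 \<le> i" "i < d" for i
    using Md_factorization_pre_hilbert[OF F] that .
  note C = pre_hilbert_space_complex_space
  have b: "bounded_map G (H 1) complex_space \<alpha>"
      "\<And>i. 2 \<le> i \<Longrightarrow> i < d \<Longrightarrow> bounded_map G (H i) (H (i - 1)) (\<xi> i)"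
      "bounded_map G complex_space (H (d - 1)) \<beta>"
    using F by (auto simp: Md_factorization_def)
  have ne: "carrier G \<noteq> {}" using t by blast
  let ?N = "\<lambda>i. sup_norm G (H i) (H (i - 1)) (\<xi> i)"
  have N: "?N i \<ge> 0" if "2 \<le> i" "i < d" for i
    using that by (intro sup_norm_nonneg pre b ne) auto
  have op: "op_prod \<xi> (Suc i) ts v \<in> carrier (H i)
      \<and> hnorm (H i) (op_prod \<xi> (Suc i) ts v) \<le> (\<Prod>j\<in>{Suc i..<d}. ?N j) * hnorm (H (d - 1)) v"
    if "1 \<le> i" "i + length ts = d - 1" "set ts \<subseteq> carrier G" "v \<in> carrier (H (d - 1))" for i ts v
    using that
  proof (induction ts arbitrary: i)
    case Nil
    then have "{Suc i..<d} = {}" "i = d - 1" by auto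
    then show ?case using Nil by simp
  next
    case (Cons s ts)
    let ?w = "op_prod \<xi> (Suc (Suc i)) ts v"
    have w: "?w \<in> carrier (H (Suc i))"
      "hnorm (H (Suc i)) ?w \<le> (\<Prod>j\<in>{Suc (Suc i)..<d}. ?N j) * hnorm (H (d - 1)) v"
      using Cons by auto
    have lt: "Suc i < d" using Cons.prems by auto
    have bi: "bounded_map G (H (Suc i)) (H i) (\<xi> (Suc i))"
      using b(2)[of "Suc i"] lt Cons.prems by simp
    have "hnorm (H i) (\<xi> (Suc i) s ?w) \<le> ?N (Suc i) * hnorm (H (Suc i)) ?w"
      using hnorm_le_sup_norm(1)[OF pre pre bi _ w(1)] Cons.prems lt by simp
    also have "\<dots> \<le> ?N (Suc i) * ((\<Prod>j\<in>{Suc (Suc i)..<d}. ?N j) * hnorm (H (d - 1)) v)"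
      using w N[of "Suc i"] lt Cons.prems by (intro mult_left_mono) auto
    also have "\<dots> = (\<Prod>j\<in>{Suc i..<d}. ?N j) * hnorm (H (d - 1)) v"
      using lt by (simp add: prod.atLeast_Suc_lessThan)
    finally show ?case
      using hnorm_le_sup_norm(2)[OF pre pre bi _ w(1)] Cons.prems lt by simp
  qed
  define ts where "ts = replicate (d - 2) \<one>\<^bsub>G\<^esub>"
  have ts: "ts \<in> lists (carrier G)" "length ts = d - 2" "foldr (\<otimes>\<^bsub>G\<^esub>) ts \<one>\<^bsub>G\<^esub> = \<one>\<^bsub>G\<^esub>"
  proof -
    have "foldr (\<otimes>\<^bsub>G\<^esub>) (replicate n \<one>\<^bsub>G\<^esub>) \<one>\<^bsub>G\<^esub> = \<one>\<^bsub>G\<^esub>" for n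
      by (induction n) (auto simp del: foldr_replicate)
    then show "foldr (\<otimes>\<^bsub>G\<^esub>) ts \<one>\<^bsub>G\<^esub> = \<one>\<^bsub>G\<^esub>" unfolding ts_def .
  qed (auto simp: ts_def)
  have \<beta>: "hnorm (H (d - 1)) (\<beta> \<one>\<^bsub>G\<^esub> 1) \<le> sup_norm G complex_space (H (d - 1)) \<beta>"
    "\<beta> \<one>\<^bsub>G\<^esub> 1 \<in> carrier (H (d - 1))"
    using hnorm_le_sup_norm[OF C pre b(3) one_closed, of 1] d by auto
  let ?w = "op_prod \<xi> 2 ts (\<beta> \<one>\<^bsub>G\<^esub> 1)"
  have w: "?w \<in> carrier (H 1)"
    "hnorm (H 1) ?w \<le> (\<Prod>j\<in>{2..<d}. ?N j) * hnorm (H (d - 1)) (\<beta> \<one>\<^bsub>G\<^esub> 1)"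
    using op[of 1 ts, OF _ _ _ \<beta>(2)] ts d by (auto simp: numeral_2_eq_2 in_lists_conv_set subset_iff)
  have "\<phi> t = \<alpha> t ?w"
    using F t ts unfolding Md_factorization_def by (metis one_closed r_one)
  then have "cmod (\<phi> t) \<le> sup_norm G (H 1) complex_space \<alpha> * hnorm (H 1) ?w"
    using hnorm_le_sup_norm(1)[OF pre C b(1) t w(1)] d by simp
  also have "\<dots> \<le> sup_norm G (H 1) complex_space \<alpha>
      * ((\<Prod>j\<in>{2..<d}. ?N j) * sup_norm G complex_space (H (d - 1)) \<beta>)"
    using d by (intro mult_left_mono order_trans[OF w(2)] \<beta> prod_nonneg N sup_norm_nonneg pre C b ne)
      auto
  finally show ?thesis by (simp add: Md_bound_def mult.assoc)
qed

lemma Md_factorization_scale: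
  assumes d: "d \<ge> 2" and G: "carrier G \<noteq> {}" and F: "Md_factorization G d \<phi> H \<alpha> \<xi> \<beta>" and c: "c > 0"
  defines "\<alpha>' \<equiv> \<lambda>t x. \<alpha> t x / complex_of_real c"
  shows "Md_factorization G d (\<lambda>t. \<phi> t / complex_of_real c) H \<alpha>' \<xi> \<beta>"
    and "Md_bound G d H \<alpha>' \<xi> \<beta> \<le> Md_bound G d H \<alpha> \<xi> \<beta> / c"
proof -
  have pre: "pre_hilbert_space (H i)" if "1 \<le> i" "i < d" for i
    using Md_factorization_pre_hilbert[OF F] that .
  note C = pre_hilbert_space_complex_space
  interpret H: pre_hilbert_space "H 1" using pre d by simp
  have H1: "pre_hilbert_space (H 1)" ..
  have b: "bounded_map G (H 1) complex_space \<alpha>"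
    using F by (simp add: Md_factorization_def)
  have le: "opnorm (H 1) complex_space (\<alpha>' t) \<le> sup_norm G (H 1) complex_space \<alpha> / c"
    if t: "t \<in> carrier G" for t
  proof (rule opnorm_le[OF H1])
    fix x assume x: "x \<in> carrier (H 1)" "hnorm (H 1) x \<le> 1"
    have "cmod (\<alpha> t x) \<le> sup_norm G (H 1) complex_space \<alpha> * hnorm (H 1) x"
      using hnorm_le_sup_norm(1)[OF H1 C b t x(1)] by simp
    also have "\<dots> \<le> sup_norm G (H 1) complex_space \<alpha>"
      using x sup_norm_nonneg[OF H1 C b G] by (intro mult_left_le) auto
    finally show "hnorm complex_space (\<alpha>' t x) \<le> sup_norm G (H 1) complex_space \<alpha> / c"
      using c by (simp add: \<alpha>'_def norm_divide divide_right_mono)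
  qed
  have ops: "\<alpha>' t \<in> bounded_ops (H 1) complex_space" if t: "t \<in> carrier G" for t
  proof -
    have \<alpha>: "\<alpha> t \<in> bounded_ops (H 1) complex_space" using b t by (simp add: bounded_map_def)
    have "\<exists>K. \<forall>x\<in>carrier (H 1). cmod (\<alpha>' t x) \<le> K * hnorm (H 1) x"
      using hnorm_le_sup_norm(1)[OF H1 C b t] c
      by (intro exI[of _ "sup_norm G (H 1) complex_space \<alpha> / c"])
        (auto simp: \<alpha>'_def norm_divide divide_right_mono)
    then show ?thesis
      using \<alpha> by (auto simp: bounded_ops_def \<alpha>'_def add_divide_distrib)
  qed
  have "bounded_map G (H 1) complex_space \<alpha>'"
    unfolding bounded_map_def using ops le by (auto intro!: bdd_aboveI2)
  then show "Md_factorization G d (\<lambda>t. \<phi> t / complex_of_real c) H \<alpha>' \<xi> \<beta>"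
    using F by (simp add: Md_factorization_def \<alpha>'_def)
  have "sup_norm G (H 1) complex_space \<alpha>' \<le> sup_norm G (H 1) complex_space \<alpha> / c"
    unfolding sup_norm_def[of _ _ _ \<alpha>'] by (rule cSUP_least) (use le G in auto)
  then have "Md_bound G d H \<alpha>' \<xi> \<beta> \<le> (sup_norm G (H 1) complex_space \<alpha> / c)
      * (\<Prod>i\<in>{2..<d}. sup_norm G (H i) (H (i - 1)) (\<xi> i)) * sup_norm G complex_space (H (d - 1)) \<beta>"
    unfolding Md_bound_def using F d pre
    by (intro mult_right_mono prod_nonneg) (auto simp: Md_factorization_def intro!: sup_norm_nonneg C G)
  then show "Md_bound G d H \<alpha>' \<xi> \<beta> \<le> Md_bound G d H \<alpha> \<xi> \<beta> / c"
    by (simp add: Md_bound_def)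
qed

lemma Md_norm_le:
  fixes G :: "('a, 'b) monoid_scheme" and H :: "nat \<Rightarrow> ('a list \<Rightarrow> complex) inner_space"
  assumes "d \<ge> 2" "carrier G \<noteq> {}" "Md_factorization G d \<phi> H \<alpha> \<xi> \<beta>"
  shows "Md_norm G d \<phi> \<le> Md_bound G d H \<alpha> \<xi> \<beta>"
  unfolding Md_norm_def
  by (rule cInf_lower) (use assms in \<open>auto intro!: bdd_belowI[of _ 0] Md_bound_nonneg\<close>)

lemma cmod_le_Md_norm:
  assumes "d \<ge> 2" "group G" "\<phi> \<in> Md G d" "t \<in> carrier G"
  shows "cmod (\<phi> t) \<le> Md_norm G d \<phi>"
  unfolding Md_norm_def
  by (rule cInf_greatest) (use assms in \<open>auto simp: Md_def intro!: cmod_le_Md_bound\<close>)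

lemma Md_l1_summable:
  assumes "\<phi> \<in> Md G d" "g \<in> l1 G"
  shows "(\<lambda>t. norm (\<phi> t * g t)) summable_on carrier G"
proof -
  obtain B where B: "\<And>t. t \<in> carrier G \<Longrightarrow> cmod (\<phi> t) \<le> B"
    using assms(1) by (auto simp: Md_def bounded_iff)
  have "(\<lambda>t. B * norm (g t)) summable_on carrier G"
    using assms(2) by (intro summable_on_cmult_right) (simp add: l1_def)
  then show ?thesis
    by (rule Infinite_Sum.abs_summable_on_comparison_test') (auto simp: norm_mult intro!: mult_right_mono B)
qed

lemma pairing_diff:
  assumes "\<phi> \<in> Md G d" "g \<in> l1 G" "h \<in> l1 G"
  shows "pairing G \<phi> (\<lambda>t. g t - h t) = pairing G \<phi> g - pairing G \<phi> h"
proof -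
  note sm = Md_l1_summable[OF assms(1), THEN Infinite_Sum.abs_summable_summable]
  have "(\<Sum>\<^sub>\<infinity>t\<in>carrier G. \<phi> t * g t + (- 1) * (\<phi> t * h t))
      = (\<Sum>\<^sub>\<infinity>t\<in>carrier G. \<phi> t * g t) + (\<Sum>\<^sub>\<infinity>t\<in>carrier G. (- 1) * (\<phi> t * h t))"
    by (intro infsum_add summable_on_cmult_right sm assms)
  then show ?thesis
    unfolding pairing_def infsum_cmult_right' by (simp add: right_diff_distrib)
qed

lemma cmod_pairing_le_Xd_norm:
  assumes d: "d \<ge> 2" and G: "group G" and g: "g \<in> l1 G" and \<phi>: "\<phi> \<in> Md G d" "Md_norm G d \<phi> \<le> 1"
  shows "cmod (pairing G \<phi> g) \<le> Xd_norm G d g"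
  unfolding Xd_norm_def
proof (rule cSUP_upper)
  show "bdd_above ((\<lambda>\<phi>. cmod (pairing G \<phi> g)) ` {\<phi> \<in> Md G d. Md_norm G d \<phi> \<le> 1})"
  proof (rule bdd_aboveI2)
    fix \<psi> assume "\<psi> \<in> {\<phi> \<in> Md G d. Md_norm G d \<phi> \<le> 1}"
    then have \<psi>: "\<psi> \<in> Md G d" and le: "\<And>t. t \<in> carrier G \<Longrightarrow> cmod (\<psi> t) \<le> 1"
      using cmod_le_Md_norm[OF d G] by fastforce+
    have "cmod (pairing G \<psi> g) \<le> (\<Sum>\<^sub>\<infinity>t\<in>carrier G. norm (\<psi> t * g t))"
      unfolding pairing_def by (rule norm_infsum_bound[OF Md_l1_summable[OF \<psi> g]])
    also have "\<dots> \<le> (\<Sum>\<^sub>\<infinity>t\<in>carrier G. norm (g t))"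
      using g by (intro infsum_mono Md_l1_summable[OF \<psi> g])
        (auto simp: l1_def norm_mult intro!: mult_left_le_one_le le)
    finally show "cmod (pairing G \<psi> g) \<le> (\<Sum>\<^sub>\<infinity>t\<in>carrier G. norm (g t))" .
  qed
qed (use \<phi> in simp)

lemma Md_unit_multiple:
  assumes d: "d \<ge> 2" and G: "group G" and \<phi>: "\<phi> \<in> Md G d"
  obtains c \<psi> where "c > 0" "\<psi> \<in> Md G d" "Md_norm G d \<psi> \<le> 1" "\<And>t. \<phi> t = complex_of_real c * \<psi> t"
proof -
  interpret group G by fact
  have ne: "carrier G \<noteq> {}" by blast
  obtain H :: "nat \<Rightarrow> ('a list \<Rightarrow> complex) inner_space" and \<alpha> \<xi> \<beta>
    where F: "Md_factorization G d \<phi> H \<alpha> \<xi> \<beta>"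
    using \<phi> by (auto simp: Md_def)
  define c where "c = Md_bound G d H \<alpha> \<xi> \<beta> + 1"
  have c: "c > 0" using Md_bound_nonneg[OF d ne F] by (simp add: c_def)
  define \<psi> where "\<psi> t = \<phi> t / complex_of_real c" for t
  obtain \<alpha>' where F': "Md_factorization G d \<psi> H \<alpha>' \<xi> \<beta>"
    and le: "Md_bound G d H \<alpha>' \<xi> \<beta> \<le> Md_bound G d H \<alpha> \<xi> \<beta> / c"
    using Md_factorization_scale[OF d ne F c] unfolding \<psi>_def[abs_def] by blast
  have "bounded (\<psi> ` carrier G)"
    using cmod_le_Md_bound[OF d G F'] by (auto simp: bounded_iff)
  then have M: "\<psi> \<in> Md G d"
    using \<phi> F' by (auto simp: Md_def functions_on_def \<psi>_def)
  have "Md_bound G d H \<alpha> \<xi> \<beta> / c \<le> 1" using c by (simp add: c_def)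
  then have N: "Md_norm G d \<psi> \<le> 1"
    using Md_norm_le[OF d ne F'] le by linarith
  show thesis
    by (rule that[OF c M N]) (use c in \<open>simp add: \<psi>_def\<close>)
qed

lemma pairing_bounded:
  assumes d: "d \<ge> 2" and G: "group G" and \<phi>: "\<phi> \<in> Md G d"
  obtains C where "\<And>g. g \<in> l1 G \<Longrightarrow> cmod (pairing G \<phi> g) \<le> C * Xd_norm G d g"
proof -
  obtain c \<psi> where c: "c > 0" and M: "\<psi> \<in> Md G d" and N: "Md_norm G d \<psi> \<le> 1"
    and eq: "\<And>t. \<phi> t = complex_of_real c * \<psi> t"
    using Md_unit_multiple[OF assms] by blast
  show thesis
  proof (rule that)
    fix g assume g: "g \<in> l1 G"
    have "pairing G \<phi> g = (\<Sum>\<^sub>\<infinity>t\<in>carrier G. complex_of_real c * (\<psi> t * g t))"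
      unfolding pairing_def by (simp add: eq mult.assoc)
    also have "\<dots> = complex_of_real c * pairing G \<psi> g"
      unfolding pairing_def by (rule infsum_cmult_right')
    finally show "cmod (pairing G \<phi> g) \<le> c * Xd_norm G d g"
      using cmod_pairing_le_Xd_norm[OF d G g M N] c by (simp add: norm_mult)
  qed
qed

theorem duality_eq:
  assumes d: "d \<ge> 2" and G: "group G" and \<phi>: "\<phi> \<in> Md G d" and x: "x \<in> Xd G d" and g: "g \<in> x"
  shows "(\<lambda>n. pairing G \<phi> (g n)) \<longlonglongrightarrow> duality G \<phi> x"
proof -
  obtain C where C: "\<And>g. g \<in> l1 G \<Longrightarrow> cmod (pairing G \<phi> g) \<le> C * Xd_norm G d g"
    using pairing_bounded[OF d G \<phi>] by blast
  have l1_diff: "(\<lambda>t. g t - h t) \<in> l1 G" if "g \<in> l1 G" "h \<in> l1 G" for g h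
  proof -
    have "(\<lambda>t. norm (g t) + norm (h t)) summable_on carrier G"
      using that by (intro summable_on_add) (auto simp: l1_def)
    then have "(\<lambda>t. norm (g t - h t)) summable_on carrier G"
      by (rule Infinite_Sum.abs_summable_on_comparison_test') (auto intro: norm_triangle_ineq4)
    then show ?thesis using that by (auto simp: l1_def functions_on_def)
  qed
  have nonneg: "Xd_norm G d g \<ge> 0" if "g \<in> l1 G" for g
    using Md_unit_multiple[OF d G \<phi>] cmod_pairing_le_Xd_norm[OF d G that] by (metis norm_ge_zero order_trans)
  have le: "cmod (pairing G \<phi> g - pairing G \<phi> h) \<le> \<bar>C\<bar> * Xd_norm G d (\<lambda>t. g t - h t)"
    if "g \<in> l1 G" "h \<in> l1 G" for g h
    using C[OF l1_diff[OF that]] pairing_diff[OF \<phi> that]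
      mult_right_mono[OF abs_ge_self[of C] nonneg[OF l1_diff[OF that]]] by simp
  obtain g0 where g0: "g0 \<in> Xd_Cauchy G d" "x = Xd_rel G d `` {g0}"
    using x by (auto simp: Xd_def quotient_def)
  have l1: "g0 n \<in> l1 G" for n using g0 by (simp add: Xd_Cauchy_def)
  have "Cauchy (\<lambda>n. pairing G \<phi> (g0 n))"
  proof (rule metric_CauchyI)
    fix e :: real assume e: "e > 0"
    have "e / (\<bar>C\<bar> + 1) > 0" using e by simp
    then obtain N where N: "\<And>m n. m \<ge> N \<Longrightarrow> n \<ge> N \<Longrightarrow>
        Xd_norm G d (\<lambda>t. g0 m t - g0 n t) < e / (\<bar>C\<bar> + 1)"
      using g0 unfolding Xd_Cauchy_def by blast
    have "dist (pairing G \<phi> (g0 m)) (pairing G \<phi> (g0 n)) < e" if mn: "m \<ge> N" "n \<ge> N" for m n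
    proof -
      let ?X = "Xd_norm G d (\<lambda>t. g0 m t - g0 n t)"
      have "dist (pairing G \<phi> (g0 m)) (pairing G \<phi> (g0 n)) \<le> \<bar>C\<bar> * ?X"
        unfolding dist_norm by (rule le[OF l1 l1])
      also have "\<dots> \<le> (\<bar>C\<bar> + 1) * ?X"
        using nonneg[OF l1_diff[OF l1 l1]] by (intro mult_right_mono) auto
      also have "\<dots> < e"
        using N[OF mn] by (simp add: field_simps)
      finally show ?thesis .
    qed
    then show "\<exists>N. \<forall>m\<ge>N. \<forall>n\<ge>N. dist (pairing G \<phi> (g0 m)) (pairing G \<phi> (g0 n)) < e" by blast
  qed
  then obtain z where z: "(\<lambda>n. pairing G \<phi> (g0 n)) \<longlonglongrightarrow> z"
    using Cauchy_convergent convergentD by blast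
  have lim: "(\<lambda>n. pairing G \<phi> (h n)) \<longlonglongrightarrow> z" if "h \<in> x" for h
  proof -
    have h: "\<And>n. h n \<in> l1 G" "(\<lambda>n. Xd_norm G d (\<lambda>t. g0 n t - h n t)) \<longlonglongrightarrow> 0"
      using that g0 by (auto simp: Xd_rel_def Xd_Cauchy_def)
    have "(\<lambda>n. \<bar>C\<bar> * Xd_norm G d (\<lambda>t. g0 n t - h n t)) \<longlonglongrightarrow> \<bar>C\<bar> * 0"
      by (intro tendsto_intros h)
    then have "(\<lambda>n. pairing G \<phi> (g0 n) - pairing G \<phi> (h n)) \<longlonglongrightarrow> 0"
      using le[OF l1 h(1)] by - (rule Lim_null_comparison[OF always_eventually, rotated], simp only: mult_zero_right, simp)
    from tendsto_diff[OF z this] show ?thesis by simp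
  qed
  have "duality G \<phi> x = z"
    unfolding duality_def
    by (rule the_equality) (use lim g in \<open>auto intro: LIMSEQ_unique\<close>)
  then show ?thesis using lim[OF g] by simp
qed

end

theory Submission
  imports Defs
begin

text \<open>
  Fix a section \<open>\<sigma>\<close> of \<open>G \<rightarrow> G/\<Gamma>\<close> and write \<open>t = \<sigma>(t\<Gamma>) r(t)\<close> with \<open>r(t) \<in> \<Gamma>\<close>.  For functions \<open>c\<close> on
  \<open>G/\<Gamma>\<close> and \<open>\<phi>\<close> on \<open>\<Gamma>\<close> put \<open>(c \<otimes> \<phi>)(t) = c(t\<Gamma>) \<phi>(r(t))\<close>.  If \<open>c\<close> has finite support, then
  \<open>\<phi> \<mapsto> c \<otimes> \<phi>\<close> is a bounded map from the multipliers of \<open>\<Gamma>\<close> to those of \<open>G\<close>: induce the operators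
  of a factorization of \<open>\<phi>\<close> to \<open>\<ell>\<^sup>2(G/\<Gamma>; H i)\<close>.  Likewise \<open>c \<mapsto> c \<otimes> 1\<close>, composition with the quotient
  map, is a contraction from the multipliers of \<open>G/\<Gamma>\<close> to those of \<open>G\<close>.  By Fubini both maps have
  preadjoints on \<open>\<ell>\<^sup>1(G)\<close>, hence they are weak*-continuous.  The first one maps finitely supported
  functions to finitely supported functions, so the weak*-closure \<open>W\<close> of the latter contains
  \<open>c \<otimes> 1\<close> for all finitely supported \<open>c\<close>; by continuity of the second one, \<open>1 = 1 \<otimes> 1\<close> is in \<open>W\<close>.
\<close>

section \<open>Hilbert sums\<close>

context pre_hilbert_space
begin

lemma hnorm_sq: "x \<in> carrier H \<Longrightarrow> (hnorm H x)\<^sup>2 = Re (ip H x x)"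
  by (simp add: hnorm_def ip_self_nonneg)

lemma hnorm_triangle:
  assumes x: "x \<in> carrier H" and y: "y \<in> carrier H"
  shows "hnorm H (x \<oplus> y) \<le> hnorm H x + hnorm H y"
proof (rule power2_le_imp_le)
  have "Re (ip H x y) \<le> hnorm H x * hnorm H y"
    using Cauchy_Schwarz[OF x y] complex_Re_le_cmod order_trans by blast
  moreover have "Re (ip H y x) = Re (ip H x y)"
    by (simp add: ip_cnj[OF x y])
  ultimately show "(hnorm H (x \<oplus> y))\<^sup>2 \<le> (hnorm H x + hnorm H y)\<^sup>2"
    using x y by (simp add: hnorm_sq ip_add_left ip_add_right power2_sum)
qed (use x y in simp)

lemma hnorm_minus: "x \<in> carrier H \<Longrightarrow> hnorm H (\<ominus> x) = hnorm H x"
  by (simp add: minus_smult hnorm_smult)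

lemma hnorm_diff_triangle:
  assumes "x \<in> carrier H" "y \<in> carrier H" "z \<in> carrier H"
  shows "hnorm H (x \<ominus> z) \<le> hnorm H (x \<ominus> y) + hnorm H (y \<ominus> z)"
proof -
  have "x \<ominus> z = (x \<ominus> y) \<oplus> (y \<ominus> z)"
    using assms by (simp add: a_minus_def M.a_ac M.r_neg1 M.r_neg2)
  then show ?thesis using assms hnorm_triangle[of "x \<ominus> y" "y \<ominus> z"] by simp
qed

text \<open>From \<open>(a - b)^2 \<ge> 0\<close>. This is the domination that makes square-summable
  families closed under addition in \<open>hilbert_sum_add\<close>.\<close>

lemma hnorm_add_sq_le:
  assumes x: "x \<in> carrier H" and y: "y \<in> carrier H"
  shows "(hnorm H (x \<oplus> y))\<^sup>2 \<le> 2 * (hnorm H x)\<^sup>2 + 2 * (hnorm H y)\<^sup>2"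
proof -
  have "(hnorm H (x \<oplus> y))\<^sup>2 \<le> (hnorm H x + hnorm H y)\<^sup>2"
    using hnorm_triangle[OF x y] x y by (intro power_mono) auto
  also have "\<dots> \<le> 2 * (hnorm H x)\<^sup>2 + 2 * (hnorm H y)\<^sup>2"
    using sum_squares_ge_zero[of "hnorm H x - hnorm H y" 0]
    by (simp add: power2_eq_square algebra_simps)
  finally show ?thesis .
qed

end

text \<open>The space \<open>\<ell>^2(I; H)\<close>. Vectors are total functions, and forcing the
  value \<open>\<zero>\<close> off \<open>I\<close> makes equality of vectors the same as equality
  on \<open>I\<close>.\<close>

definition hilbert_sum :: "'i set \<Rightarrow> 'h inner_space \<Rightarrow> ('i \<Rightarrow> 'h) inner_space" where
  "hilbert_sum I H = \<lparr>carrier = {f. (\<forall>x. f x \<in> carrier H) \<and> (\<forall>x. x \<notin> I \<longrightarrow> f x = \<zero>\<^bsub>H\<^esub>)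
       \<and> (\<lambda>x. (hnorm H (f x))\<^sup>2) summable_on I},
     mult = (\<lambda>f g. f), one = (\<lambda>_. \<zero>\<^bsub>H\<^esub>), zero = (\<lambda>_. \<zero>\<^bsub>H\<^esub>), add = (\<lambda>f g x. f x \<oplus>\<^bsub>H\<^esub> g x),
     smult = (\<lambda>a f x. a \<odot>\<^bsub>H\<^esub> f x), ip = (\<lambda>f g. \<Sum>\<^sub>\<infinity>x\<in>I. ip H (f x) (g x))\<rparr>"

lemma hilbert_sum_simps [simp]:
  "zero (hilbert_sum I H) = (\<lambda>_. \<zero>\<^bsub>H\<^esub>)"
  "add (hilbert_sum I H) = (\<lambda>f g x. f x \<oplus>\<^bsub>H\<^esub> g x)"
  "smult (hilbert_sum I H) = (\<lambda>a f x. a \<odot>\<^bsub>H\<^esub> f x)"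
  "ip (hilbert_sum I H) = (\<lambda>f g. \<Sum>\<^sub>\<infinity>x\<in>I. ip H (f x) (g x))"
  by (simp_all add: hilbert_sum_def)

lemma mem_hilbert_sum:
  "f \<in> carrier (hilbert_sum I H) \<longleftrightarrow> (\<forall>x. f x \<in> carrier H) \<and> (\<forall>x. x \<notin> I \<longrightarrow> f x = \<zero>\<^bsub>H\<^esub>)
     \<and> (\<lambda>x. (hnorm H (f x))\<^sup>2) summable_on I"
  by (simp add: hilbert_sum_def)

lemma hilbert_sum_memD:
  assumes "f \<in> carrier (hilbert_sum I H)"
  shows "f x \<in> carrier H" "x \<notin> I \<Longrightarrow> f x = \<zero>\<^bsub>H\<^esub>" "(\<lambda>x. (hnorm H (f x))\<^sup>2) summable_on I"
  using assms by (auto simp: mem_hilbert_sum)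

context pre_hilbert_space
begin

lemma hilbert_sum_add:
  assumes f: "f \<in> carrier (hilbert_sum I H)" and g: "g \<in> carrier (hilbert_sum I H)"
  shows "(\<lambda>x. f x \<oplus> g x) \<in> carrier (hilbert_sum I H)"
proof -
  note fg = hilbert_sum_memD[OF f] hilbert_sum_memD[OF g]
  have "(\<lambda>x. 2 * (hnorm H (f x))\<^sup>2 + 2 * (hnorm H (g x))\<^sup>2) summable_on I"
    by (intro summable_on_add summable_on_cmult_right fg)
  then have "(\<lambda>x. (hnorm H (f x \<oplus> g x))\<^sup>2) summable_on I"
    by (rule summable_on_comparison_test) (auto intro: hnorm_add_sq_le fg)
  then show ?thesis using fg by (auto simp: mem_hilbert_sum)
qed

lemma hilbert_sum_smult:
  assumes f: "f \<in> carrier (hilbert_sum I H)"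
  shows "(\<lambda>x. a \<odot> f x) \<in> carrier (hilbert_sum I H)"
proof -
  note f = hilbert_sum_memD[OF f]
  have "(\<lambda>x. (cmod a)\<^sup>2 * (hnorm H (f x))\<^sup>2) summable_on I"
    by (intro summable_on_cmult_right f)
  then show ?thesis using f by (auto simp: mem_hilbert_sum hnorm_smult power_mult_distrib)
qed

text \<open>By Cauchy-Schwarz in each coordinate and \<open>a * b \<le> a^2 + b^2\<close> for
  nonnegative reals, the terms are dominated by the sum of two summable families.\<close>

lemma hilbert_sum_ip_summable:
  assumes f: "f \<in> carrier (hilbert_sum I H)" and g: "g \<in> carrier (hilbert_sum I H)"
  shows "(\<lambda>x. ip H (f x) (g x)) summable_on I"
proof -
  note fg = hilbert_sum_memD[OF f] hilbert_sum_memD[OF g]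
  have le: "cmod (ip H (f x) (g x)) \<le> (hnorm H (f x))\<^sup>2 + (hnorm H (g x))\<^sup>2" for x
  proof -
    have "cmod (ip H (f x) (g x)) \<le> hnorm H (f x) * hnorm H (g x)"
      by (rule Cauchy_Schwarz[OF fg(1,4)])
    also have "\<dots> \<le> 2 * hnorm H (f x) * hnorm H (g x)"
      using fg by simp
    also have "\<dots> \<le> (hnorm H (f x))\<^sup>2 + (hnorm H (g x))\<^sup>2"
      by (rule sum_squares_bound)
    finally show ?thesis .
  qed
  have "(\<lambda>x. (hnorm H (f x))\<^sup>2 + (hnorm H (g x))\<^sup>2) summable_on I"
    by (intro summable_on_add fg)
  then have "(\<lambda>x. cmod (ip H (f x) (g x))) summable_on I"
    by (rule Infinite_Sum.abs_summable_on_comparison_test') (rule le)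
  then show ?thesis by (rule Infinite_Sum.abs_summable_summable)
qed

lemma hilbert_sum_ip_self:
  assumes f: "f \<in> carrier (hilbert_sum I H)"
  shows "ip (hilbert_sum I H) f f = complex_of_real (\<Sum>\<^sub>\<infinity>x\<in>I. (hnorm H (f x))\<^sup>2)"
proof -
  note f = hilbert_sum_memD[OF f]
  have "ip (hilbert_sum I H) f f = (\<Sum>\<^sub>\<infinity>x\<in>I. complex_of_real ((hnorm H (f x))\<^sup>2))"
    using f by (simp only: hilbert_sum_simps ip_self)
  also have "\<dots> = complex_of_real (\<Sum>\<^sub>\<infinity>x\<in>I. (hnorm H (f x))\<^sup>2)"
    by (rule infsumI[OF has_sum_of_real[OF has_sum_infsum[OF f(3)]]])
  finally show ?thesis .
qed

lemma pre_hilbert_space_hilbert_sum: "pre_hilbert_space (hilbert_sum I H)"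
proof -
  let ?S = "hilbert_sum I H"
  note c = hilbert_sum_memD(1)
  have grp: "abelian_group ?S"
  proof (rule abelian_groupI)
    fix f assume f: "f \<in> carrier ?S"
    then show "\<exists>g\<in>carrier ?S. g \<oplus>\<^bsub>?S\<^esub> f = \<zero>\<^bsub>?S\<^esub>"
      using hilbert_sum_smult[OF f, of "-1"] c[OF f]
      by (intro bexI[of _ "\<lambda>x. (-1) \<odot> f x"]) (auto simp: minus_smult[symmetric] M.l_neg)
  next
    show "\<zero>\<^bsub>?S\<^esub> \<in> carrier ?S" by (simp add: mem_hilbert_sum)
  qed (auto simp: hilbert_sum_add c M.a_ac)
  interpret S: Module.module complex_ring ?S
    by (rule moduleI[OF cring_complex_ring grp])
      (auto simp: hilbert_sum_smult c smult_l_distr[simplified] smult_r_distr[simplified]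
        smult_assoc1[simplified] smult_one[simplified])
  show ?thesis
  proof
    fix f g h assume fgh: "f \<in> carrier ?S" "g \<in> carrier ?S" "h \<in> carrier ?S"
    show "ip ?S (f \<oplus>\<^bsub>?S\<^esub> g) h = ip ?S f h + ip ?S g h"
      using fgh by (simp add: c ip_add_left infsum_add hilbert_sum_ip_summable)
  next
    fix f g a assume fg: "f \<in> carrier ?S" "g \<in> carrier ?S"
    then show "ip ?S (a \<odot>\<^bsub>?S\<^esub> f) g = a * ip ?S f g"
      by (simp add: c ip_smult_left infsum_cmult_right')
  next
    fix f g assume fg: "f \<in> carrier ?S" "g \<in> carrier ?S"
    have "ip ?S g f = (\<Sum>\<^sub>\<infinity>x\<in>I. cnj (ip H (f x) (g x)))"
      using ip_cnj[OF c[OF fg(1)] c[OF fg(2)]] by simp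
    then show "ip ?S g f = cnj (ip ?S f g)" by simp
  next
    fix f assume f: "f \<in> carrier ?S" "f \<noteq> \<zero>\<^bsub>?S\<^esub>"
    then obtain x where x: "f x \<noteq> \<zero>" by (auto simp: fun_eq_iff)
    then have xI: "x \<in> I" using hilbert_sum_memD(2)[OF f(1)] by blast
    have "0 < (hnorm H (f x))\<^sup>2"
      using x hnorm_eq_0[OF c[OF f(1), of x]] by (simp add: zero_less_power2) blast
    also have "\<dots> = sum (\<lambda>x. (hnorm H (f x))\<^sup>2) {x}" by simp
    also have "\<dots> \<le> (\<Sum>\<^sub>\<infinity>x\<in>I. (hnorm H (f x))\<^sup>2)"
      using xI by (intro finite_sum_le_infsum hilbert_sum_memD(3)[OF f(1)]) auto
    finally show "Re (ip ?S f f) > 0"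
      by (subst hilbert_sum_ip_self[OF f(1)]) simp
  qed
qed

lemma hnorm_hilbert_sum:
  assumes "f \<in> carrier (hilbert_sum I H)"
  shows "hnorm (hilbert_sum I H) f = sqrt (\<Sum>\<^sub>\<infinity>x\<in>I. (hnorm H (f x))\<^sup>2)"
  by (simp only: hnorm_def[of "hilbert_sum I H"] hilbert_sum_ip_self[OF assms] Re_complex_of_real)

lemma hnorm_component_le:
  assumes f: "f \<in> carrier (hilbert_sum I H)"
  shows "hnorm H (f x) \<le> hnorm (hilbert_sum I H) f"
proof (cases "x \<in> I")
  case True
  have "sum (\<lambda>x. (hnorm H (f x))\<^sup>2) {x} \<le> (\<Sum>\<^sub>\<infinity>x\<in>I. (hnorm H (f x))\<^sup>2)"
    using True by (intro finite_sum_le_infsum hilbert_sum_memD(3)[OF f]) auto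
  then show ?thesis
    unfolding hnorm_hilbert_sum[OF f] by (intro real_le_rsqrt) simp
next
  case False
  then show ?thesis
    using hilbert_sum_memD(2)[OF f] by (simp add: hnorm_hilbert_sum[OF f] infsum_nonneg)
qed

lemma hilbert_sum_minus:
  assumes f: "f \<in> carrier (hilbert_sum I H)" and g: "g \<in> carrier (hilbert_sum I H)"
  shows "f \<ominus>\<^bsub>hilbert_sum I H\<^esub> g = (\<lambda>x. f x \<ominus> g x)"
proof -
  interpret S: pre_hilbert_space "hilbert_sum I H" by (rule pre_hilbert_space_hilbert_sum)
  show ?thesis
    using hilbert_sum_memD(1)[OF g] by (simp add: a_minus_def S.minus_smult[OF g] minus_smult)
qed

text \<open>A Fatou argument: the bound on \<open>\<sigma> m - \<sigma> n\<close> restricts to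
  finite sets of coordinates, survives the limit in \<open>m\<close> there, and then holds for the
  full sum because the finite sums exhaust it. It is the step from pointwise convergence to
  convergence in norm.\<close>

lemma hilbert_sum_limit:
  fixes \<sigma> :: "nat \<Rightarrow> 'i \<Rightarrow> 'h"
  assumes \<sigma>: "\<And>n. \<sigma> n \<in> carrier (hilbert_sum I H)"
    and x: "\<And>i. x i \<in> carrier H" "\<And>i. i \<notin> I \<Longrightarrow> x i = \<zero>"
    and lim: "\<And>i. (\<lambda>n. hnorm H (\<sigma> n i \<ominus> x i)) \<longlonglongrightarrow> 0"
    and e: "e \<ge> 0" and le: "\<And>m. m \<ge> N \<Longrightarrow> hnorm (hilbert_sum I H) (\<sigma> m \<ominus>\<^bsub>hilbert_sum I H\<^esub> \<sigma> n) \<le> e"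
  shows "x \<in> carrier (hilbert_sum I H)" "hnorm (hilbert_sum I H) (\<sigma> n \<ominus>\<^bsub>hilbert_sum I H\<^esub> x) \<le> e"
proof -
  let ?S = "hilbert_sum I H"
  interpret S: pre_hilbert_space ?S by (rule pre_hilbert_space_hilbert_sum)
  note c = hilbert_sum_memD(1)[OF \<sigma>]
  define D where "D i = \<sigma> n i \<ominus> x i" for i
  have Dc: "D i \<in> carrier H" for i using c x by (simp add: D_def)
  have fin: "(\<Sum>i\<in>F. (hnorm H (D i))\<^sup>2) \<le> e\<^sup>2" if F: "finite F" "F \<subseteq> I" for F
  proof -
    have le': "(\<Sum>i\<in>F. (hnorm H (\<sigma> n i \<ominus> \<sigma> m i))\<^sup>2) \<le> e\<^sup>2" if m: "m \<ge> N" for m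
    proof -
      have d: "(\<lambda>i. \<sigma> m i \<ominus> \<sigma> n i) \<in> carrier ?S"
        using S.M.minus_closed[OF \<sigma> \<sigma>, of m n] by (simp only: hilbert_sum_minus[OF \<sigma> \<sigma>])
      have "(\<Sum>i\<in>F. (hnorm H (\<sigma> n i \<ominus> \<sigma> m i))\<^sup>2) = (\<Sum>i\<in>F. (hnorm H (\<sigma> m i \<ominus> \<sigma> n i))\<^sup>2)"
      proof (intro sum.cong refl)
        fix i
        have "\<sigma> n i \<ominus> \<sigma> m i = \<ominus> (\<sigma> m i \<ominus> \<sigma> n i)"
          using c by (simp add: a_minus_def M.minus_add M.a_ac)
        then show "(hnorm H (\<sigma> n i \<ominus> \<sigma> m i))\<^sup>2 = (hnorm H (\<sigma> m i \<ominus> \<sigma> n i))\<^sup>2"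
          using c by (simp add: hnorm_minus)
      qed
      also have "\<dots> \<le> (\<Sum>\<^sub>\<infinity>i\<in>I. (hnorm H (\<sigma> m i \<ominus> \<sigma> n i))\<^sup>2)"
        by (rule finite_sum_le_infsum[OF hilbert_sum_memD(3)[OF d]]) (use F in auto)
      also have "\<dots> = (hnorm ?S (\<sigma> m \<ominus>\<^bsub>?S\<^esub> \<sigma> n))\<^sup>2"
        unfolding hilbert_sum_minus[OF \<sigma> \<sigma>] hnorm_hilbert_sum[OF d] by (simp add: infsum_nonneg)
      also have "\<dots> \<le> e\<^sup>2"
        using le[OF m] by (intro power_mono) (auto simp: \<sigma>)
      finally show ?thesis .
    qed
    have "(\<lambda>m. \<Sum>i\<in>F. (hnorm H (\<sigma> n i \<ominus> \<sigma> m i))\<^sup>2) \<longlonglongrightarrow> (\<Sum>i\<in>F. (hnorm H (D i))\<^sup>2)"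
    proof (intro tendsto_intros)
      fix i
      \<comment> \<open>The reverse triangle inequality, which makes the norm of a difference
        continuous in its second argument.\<close>
      have "\<bar>hnorm H (\<sigma> n i \<ominus> \<sigma> m i) - hnorm H (D i)\<bar> \<le> hnorm H (\<sigma> m i \<ominus> x i)" for m
      proof -
        have "x i \<ominus> \<sigma> m i = \<ominus> (\<sigma> m i \<ominus> x i)"
          using c x by (simp add: a_minus_def M.minus_add M.a_ac)
        then have "hnorm H (x i \<ominus> \<sigma> m i) = hnorm H (\<sigma> m i \<ominus> x i)"
          using c x by (simp add: hnorm_minus)
        then show ?thesis
          using hnorm_diff_triangle[of "\<sigma> n i" "x i" "\<sigma> m i"]
            hnorm_diff_triangle[of "\<sigma> n i" "\<sigma> m i" "x i"] c x unfolding D_def by fastforce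
      qed
      then have "(\<lambda>m. hnorm H (\<sigma> n i \<ominus> \<sigma> m i) - hnorm H (D i)) \<longlonglongrightarrow> 0"
        by (intro Lim_null_comparison[OF always_eventually lim[of i]]) auto
      then show "(\<lambda>m. hnorm H (\<sigma> n i \<ominus> \<sigma> m i)) \<longlonglongrightarrow> hnorm H (D i)"
        by (rule LIM_zero_cancel)
    qed
    then show ?thesis
      by (rule tendsto_upperbound) (auto intro!: eventually_sequentiallyI[of N] le')
  qed
  have sm: "(\<lambda>i. (hnorm H (D i))\<^sup>2) summable_on I"
    by (rule nonneg_bdd_above_summable_on) (auto intro!: bdd_aboveI2 fin)
  have D: "D \<in> carrier ?S"
    unfolding mem_hilbert_sum using Dc sm hilbert_sum_memD(2)[OF \<sigma>] x
    by (auto simp: D_def a_minus_def)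
  \<comment> \<open>Square-summability of \<open>x\<close> is not visible directly; it follows
    because \<open>x\<close> is the difference of two vectors already known to lie in the
    sum.\<close>
  have "\<sigma> n \<ominus>\<^bsub>?S\<^esub> D = x"
  proof
    fix i show "(\<sigma> n \<ominus>\<^bsub>?S\<^esub> D) i = x i"
      unfolding hilbert_sum_minus[OF \<sigma> D] using c x
      by (simp add: D_def a_minus_def M.minus_add M.r_neg1 M.r_neg2)
  qed
  then show xS: "x \<in> carrier ?S" using S.M.minus_closed[OF \<sigma> D] by metis
  have "(\<Sum>\<^sub>\<infinity>i\<in>I. (hnorm H (D i))\<^sup>2) \<le> e\<^sup>2"
    by (rule infsum_le_finite_sums[OF sm fin])
  then have "hnorm ?S D \<le> e"
    unfolding hnorm_hilbert_sum[OF D] using e real_le_lsqrt by (simp add: infsum_nonneg)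
  then show "hnorm ?S (\<sigma> n \<ominus>\<^bsub>?S\<^esub> x) \<le> e"
    unfolding hilbert_sum_minus[OF \<sigma> xS] by (simp add: D_def[abs_def])
qed

end

text \<open>Coordinates have norm at most that of the vector, so a Cauchy sequence is Cauchy in each
  coordinate. Completeness of \<open>H\<close> gives a pointwise limit, and
  \<open>hilbert_sum_limit\<close> shows that it is the limit in norm.\<close>

lemma hilbert_space_hilbert_sum:
  fixes H :: "'h inner_space" and I :: "'i set"
  assumes "hilbert_space H"
  shows "hilbert_space (hilbert_sum I H)"
proof -
  interpret hilbert_space H by fact
  let ?S = "hilbert_sum I H"
  interpret S: pre_hilbert_space ?S by (rule pre_hilbert_space_hilbert_sum)
  show ?thesis
  proof
    fix \<sigma> :: "nat \<Rightarrow> 'i \<Rightarrow> 'h"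
    assume \<sigma>: "\<And>n. \<sigma> n \<in> carrier ?S"
      and Cauchy: "\<And>e. e > 0 \<Longrightarrow> \<exists>N. \<forall>m\<ge>N. \<forall>n\<ge>N. hnorm ?S (\<sigma> m \<ominus>\<^bsub>?S\<^esub> \<sigma> n) < e"
    note c = hilbert_sum_memD(1)[OF \<sigma>]
    have "\<exists>x\<in>carrier H. (i \<notin> I \<longrightarrow> x = \<zero>\<^bsub>H\<^esub>) \<and> (\<lambda>n. hnorm H (\<sigma> n i \<ominus>\<^bsub>H\<^esub> x)) \<longlonglongrightarrow> 0" for i
    proof (cases "i \<in> I")
      case True
      have "\<exists>x\<in>carrier H. (\<lambda>n. hnorm H (\<sigma> n i \<ominus>\<^bsub>H\<^esub> x)) \<longlonglongrightarrow> 0"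
      proof (rule complete)
        fix e :: real assume "e > 0"
        then obtain N where N: "\<And>m n. m \<ge> N \<Longrightarrow> n \<ge> N \<Longrightarrow> hnorm ?S (\<sigma> m \<ominus>\<^bsub>?S\<^esub> \<sigma> n) < e"
          using Cauchy by blast
        have "hnorm H (\<sigma> m i \<ominus>\<^bsub>H\<^esub> \<sigma> n i) \<le> hnorm ?S (\<sigma> m \<ominus>\<^bsub>?S\<^esub> \<sigma> n)" for m n
          using hnorm_component_le[OF S.M.minus_closed[OF \<sigma> \<sigma>, of m n], of i]
          by (simp add: hilbert_sum_minus[OF \<sigma> \<sigma>])
        then show "\<exists>N. \<forall>m\<ge>N. \<forall>n\<ge>N. hnorm H (\<sigma> m i \<ominus>\<^bsub>H\<^esub> \<sigma> n i) < e"
          using N le_less_trans by blast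
      qed (rule c)
      then show ?thesis using True by blast
    next
      case False
      then show ?thesis
        using hilbert_sum_memD(2)[OF \<sigma>] by (intro bexI[of _ "\<zero>\<^bsub>H\<^esub>"]) (auto simp: a_minus_def hnorm_minus)
    qed
    then obtain x where x: "\<And>i. x i \<in> carrier H" "\<And>i. i \<notin> I \<Longrightarrow> x i = \<zero>\<^bsub>H\<^esub>"
      "\<And>i. (\<lambda>n. hnorm H (\<sigma> n i \<ominus>\<^bsub>H\<^esub> x i)) \<longlonglongrightarrow> 0" by metis
    \<comment> \<open>Passing to the limit weakens the strict Cauchy estimate to
      \<open>\<le> e\<close>; using \<open>e / 2\<close> below restores strictness. Membership of
      \<open>x\<close> is carried along because the same lemma yields both.\<close>
    have main: "\<exists>N. \<forall>n\<ge>N. x \<in> carrier ?S \<and> hnorm ?S (\<sigma> n \<ominus>\<^bsub>?S\<^esub> x) \<le> e" if e: "e > 0" for e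
    proof -
      obtain N where N: "\<And>m n. m \<ge> N \<Longrightarrow> n \<ge> N \<Longrightarrow> hnorm ?S (\<sigma> m \<ominus>\<^bsub>?S\<^esub> \<sigma> n) < e"
        using Cauchy[OF e] by blast
      then show ?thesis
        using hilbert_sum_limit[OF \<sigma> x, of e N] e less_imp_le by blast
    qed
    then have xS: "x \<in> carrier ?S" using zero_less_one by blast
    have "(\<lambda>n. hnorm ?S (\<sigma> n \<ominus>\<^bsub>?S\<^esub> x)) \<longlonglongrightarrow> 0"
    proof (rule LIMSEQ_I)
      fix e :: real assume e: "e > 0"
      then obtain N where "\<forall>n\<ge>N. hnorm ?S (\<sigma> n \<ominus>\<^bsub>?S\<^esub> x) \<le> e / 2"
        using main[of "e / 2"] by auto
      then show "\<exists>N. \<forall>n\<ge>N. norm (hnorm ?S (\<sigma> n \<ominus>\<^bsub>?S\<^esub> x) - 0) < e"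
        using e S.hnorm_nonneg[OF S.M.minus_closed[OF \<sigma> xS]] by (intro exI[of _ N]) fastforce
    qed
    then show "\<exists>x\<in>carrier ?S. (\<lambda>n. hnorm ?S (\<sigma> n \<ominus>\<^bsub>?S\<^esub> x)) \<longlonglongrightarrow> 0"
      using xS by blast
  qed
qed

section \<open>Bounded maps and operators between Hilbert sums\<close>

lemma bounded_opsD:
  assumes "T \<in> bounded_ops H K"
  shows "x \<in> carrier H \<Longrightarrow> T x \<in> carrier K"
    and "x \<in> carrier H \<Longrightarrow> y \<in> carrier H \<Longrightarrow> T (x \<oplus>\<^bsub>H\<^esub> y) = T x \<oplus>\<^bsub>K\<^esub> T y"
    and "x \<in> carrier H \<Longrightarrow> T (a \<odot>\<^bsub>H\<^esub> x) = a \<odot>\<^bsub>K\<^esub> T x"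
  using assms by (auto simp: bounded_ops_def)

lemma bounded_ops_zero:
  assumes "pre_hilbert_space H" "pre_hilbert_space K" "T \<in> bounded_ops H K"
  shows "T \<zero>\<^bsub>H\<^esub> = \<zero>\<^bsub>K\<^esub>"
proof -
  interpret H: pre_hilbert_space H by fact
  interpret K: pre_hilbert_space K by fact
  show ?thesis
    using bounded_opsD(3)[OF assms(3), of "\<zero>\<^bsub>H\<^esub>" 0] bounded_opsD(1)[OF assms(3), of "\<zero>\<^bsub>H\<^esub>"]
      H.smult_l_null[of "\<zero>\<^bsub>H\<^esub>"] K.smult_l_null by simp
qed

text \<open>One uniform estimate controls all operator norms, hence gives boundedness and the bound
  of the supremum together. \<open>C \<ge> 0\<close> lets the factor
  \<open>hnorm H x \<le> 1\<close> be dropped on the unit ball; \<open>ne\<close> makes the supremum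
  one over a nonempty set.\<close>

lemma bounded_mapI:
  assumes H: "pre_hilbert_space H" and ne: "carrier G \<noteq> {}" and C: "C \<ge> 0"
    and car: "\<And>t x. t \<in> carrier G \<Longrightarrow> x \<in> carrier H \<Longrightarrow> \<xi> t x \<in> carrier K"
    and add: "\<And>t x y. t \<in> carrier G \<Longrightarrow> x \<in> carrier H \<Longrightarrow> y \<in> carrier H
      \<Longrightarrow> \<xi> t (x \<oplus>\<^bsub>H\<^esub> y) = \<xi> t x \<oplus>\<^bsub>K\<^esub> \<xi> t y"
    and smult: "\<And>t x a. t \<in> carrier G \<Longrightarrow> x \<in> carrier H \<Longrightarrow> \<xi> t (a \<odot>\<^bsub>H\<^esub> x) = a \<odot>\<^bsub>K\<^esub> \<xi> t x"
    and le: "\<And>t x. t \<in> carrier G \<Longrightarrow> x \<in> carrier H \<Longrightarrow> hnorm K (\<xi> t x) \<le> C * hnorm H x"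
  shows "bounded_map G H K \<xi>" "sup_norm G H K \<xi> \<le> C"
proof -
  interpret H: pre_hilbert_space H by fact
  have op: "opnorm H K (\<xi> t) \<le> C" if t: "t \<in> carrier G" for t
  proof (rule opnorm_le[OF H])
    fix x assume x: "x \<in> carrier H" "hnorm H x \<le> 1"
    have "hnorm K (\<xi> t x) \<le> C * hnorm H x" by (rule le[OF t x(1)])
    also have "\<dots> \<le> C" using x C by (intro mult_left_le) auto
    finally show "hnorm K (\<xi> t x) \<le> C" .
  qed
  show "bounded_map G H K \<xi>"
    unfolding bounded_map_def bounded_ops_def
    using car add smult le op by (auto intro!: bdd_aboveI2 exI[of _ C])
  show "sup_norm G H K \<xi> \<le> C"
    unfolding sup_norm_def by (rule cSUP_least) (use op ne in auto)
qed

text \<open>A permutation of the coordinates followed by a block diagonal operator, the form in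
  which group elements act on an induced space.\<close>

definition shift_op :: "'i set \<Rightarrow> 'k inner_space \<Rightarrow> ('i \<Rightarrow> 'i) \<Rightarrow> ('i \<Rightarrow> 'h \<Rightarrow> 'k) \<Rightarrow> ('i \<Rightarrow> 'h) \<Rightarrow> 'i \<Rightarrow> 'k" where
  "shift_op I K p T f y = (if y \<in> I then T y (f (p y)) else \<zero>\<^bsub>K\<^esub>)"

text \<open>The elementary tensor of the basis vector at \<open>a\<close> with \<open>v\<close>,
  when \<open>\<ell>^2(I; H)\<close> is read as \<open>\<ell>^2(I) \<otimes> H\<close>.\<close>

definition single :: "'h inner_space \<Rightarrow> 'i \<Rightarrow> 'h \<Rightarrow> 'i \<Rightarrow> 'h" where
  "single H a v = (\<lambda>x. if x = a then v else \<zero>\<^bsub>H\<^esub>)"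

text \<open>Each squared coordinate norm is at most \<open>C^2\<close> times that of
  \<open>f\<close> at \<open>p y\<close>, and the bijection \<open>p\<close> only rearranges the sum
  of these. So the operator norm is governed by the largest block and not by the number of
  blocks.\<close>

lemma shift_op_hilbert_sum:
  assumes H: "pre_hilbert_space H" and K: "pre_hilbert_space K" and p: "bij_betw p I I"
    and T: "\<And>y x. y \<in> I \<Longrightarrow> x \<in> carrier H \<Longrightarrow> T y x \<in> carrier K"
    and le: "\<And>y x. y \<in> I \<Longrightarrow> x \<in> carrier H \<Longrightarrow> hnorm K (T y x) \<le> C * hnorm H x"
    and C: "C \<ge> 0" and f: "f \<in> carrier (hilbert_sum I H)"
  shows "shift_op I K p T f \<in> carrier (hilbert_sum I K)"
    and "hnorm (hilbert_sum I K) (shift_op I K p T f) \<le> C * hnorm (hilbert_sum I H) f"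
proof -
  interpret H: pre_hilbert_space H by fact
  interpret K: pre_hilbert_space K by fact
  note f' = hilbert_sum_memD[OF f]
  have le2: "(hnorm K (shift_op I K p T f y))\<^sup>2 \<le> C\<^sup>2 * (hnorm H (f (p y)))\<^sup>2" if "y \<in> I" for y
    unfolding power_mult_distrib[symmetric] using that T f' le
    by (intro power_mono) (auto simp: shift_op_def)
  have "(\<lambda>y. (hnorm H (f (p y)))\<^sup>2) summable_on I"
    using f'(3) summable_on_reindex_bij_betw[OF p, of "\<lambda>x. (hnorm H (f x))\<^sup>2"] by simp
  then have sm: "(\<lambda>y. C\<^sup>2 * (hnorm H (f (p y)))\<^sup>2) summable_on I"
    by (rule summable_on_cmult_right)
  have sm2: "(\<lambda>y. (hnorm K (shift_op I K p T f y))\<^sup>2) summable_on I"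
    by (rule summable_on_comparison_test[OF sm le2]) simp_all
  then show mem: "shift_op I K p T f \<in> carrier (hilbert_sum I K)"
    using f' T by (auto simp: mem_hilbert_sum shift_op_def)
  have "(\<Sum>\<^sub>\<infinity>y\<in>I. (hnorm K (shift_op I K p T f y))\<^sup>2) \<le> (\<Sum>\<^sub>\<infinity>y\<in>I. C\<^sup>2 * (hnorm H (f (p y)))\<^sup>2)"
    by (rule infsum_mono[OF sm2 sm le2])
  also have "\<dots> = C\<^sup>2 * (\<Sum>\<^sub>\<infinity>x\<in>I. (hnorm H (f x))\<^sup>2)"
    using infsum_reindex_bij_betw[OF p, of "\<lambda>x. (hnorm H (f x))\<^sup>2"] by (simp add: infsum_cmult_right')
  finally have "sqrt (\<Sum>\<^sub>\<infinity>y\<in>I. (hnorm K (shift_op I K p T f y))\<^sup>2)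
      \<le> sqrt (C\<^sup>2 * (\<Sum>\<^sub>\<infinity>x\<in>I. (hnorm H (f x))\<^sup>2))"
    by (rule real_sqrt_le_mono)
  then show "hnorm (hilbert_sum I K) (shift_op I K p T f) \<le> C * hnorm (hilbert_sum I H) f"
    using C by (simp add: H.hnorm_hilbert_sum[OF f] K.hnorm_hilbert_sum[OF mem] real_sqrt_mult)
qed

lemma single_hilbert_sum:
  assumes H: "pre_hilbert_space H" and a: "a \<in> I" and v: "v \<in> carrier H"
  shows "single H a v \<in> carrier (hilbert_sum I H)"
    and "hnorm (hilbert_sum I H) (single H a v) = hnorm H v"
proof -
  interpret H: pre_hilbert_space H by fact
  have eq: "(hnorm H (single H a v x))\<^sup>2 = (if x = a then (hnorm H v)\<^sup>2 else 0)" for x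
    by (simp add: single_def)
  have "((\<lambda>x. if x = a then (hnorm H v)\<^sup>2 else 0) has_sum (hnorm H v)\<^sup>2) I"
    by (rule has_sum_finite_neutralI[of "{a}"]) (use a in auto)
  then have hs: "((\<lambda>x. (hnorm H (single H a v x))\<^sup>2) has_sum (hnorm H v)\<^sup>2) I"
    by (simp add: eq)
  then have sm: "(\<lambda>x. (hnorm H (single H a v x))\<^sup>2) summable_on I"
    by (rule has_sum_imp_summable)
  show mem: "single H a v \<in> carrier (hilbert_sum I H)"
    unfolding mem_hilbert_sum using sm a v by (auto simp: single_def)
  show "hnorm (hilbert_sum I H) (single H a v) = hnorm H v"
    using infsumI[OF hs] v by (simp add: H.hnorm_hilbert_sum[OF mem])
qed

section \<open>Weak* continuity\<close>

lemma topspace_Md_weak_star [simp]: "topspace (Md_weak_star G d) = Md G d"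
  by (auto simp: Md_weak_star_def topspace_pullback_topology)

text \<open>Pairing with \<open>x\<close> is a coordinate projection after the map into the product
  that defines the topology.\<close>

lemma continuous_map_duality:
  assumes "x \<in> Xd G d"
  shows "continuous_map (Md_weak_star G d) euclidean (\<lambda>\<phi>. duality G \<phi> x)"
proof -
  have "continuous_map (Md_weak_star G d) euclidean
      ((\<lambda>f. f x) \<circ> (\<lambda>\<phi>. \<lambda>x\<in>Xd G d. duality G \<phi> x))"
    unfolding Md_weak_star_def
    using assms by (intro continuous_map_pullback continuous_map_product_projection)
  then show ?thesis using assms by (simp add: o_def)
qed

text \<open>Constructions such as \<open>hilbert_sum\<close> leave the vector type built into
  \<open>Md\<close>; \<open>Md_factorization_universal\<close> brings their factorizations back
  without increasing the bound.\<close>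

lemma Md_if_factorization:
  fixes G :: "('a, 'b) monoid_scheme" and H :: "nat \<Rightarrow> 'h inner_space"
  assumes d: "d \<ge> 2" and G: "group G" and \<phi>: "\<phi> \<in> functions_on G" and F: "Md_factorization G d \<phi> H \<alpha> \<xi> \<beta>"
  shows "\<phi> \<in> Md G d" "Md_norm G d \<phi> \<le> Md_bound G d H \<alpha> \<xi> \<beta>"
proof -
  interpret group G by fact
  have ne: "carrier G \<noteq> {}" by blast
  obtain H' :: "nat \<Rightarrow> ('a list \<Rightarrow> complex) inner_space" and \<alpha>' \<xi>' \<beta>'
    where F': "Md_factorization G d \<phi> H' \<alpha>' \<xi>' \<beta>'"
      and le: "Md_bound G d H' \<alpha>' \<xi>' \<beta>' \<le> Md_bound G d H \<alpha> \<xi> \<beta>"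
    using Md_factorization_universal[OF d ne F] .
  have "bounded (\<phi> ` carrier G)"
    using cmod_le_Md_bound[OF d G F'] by (auto simp: bounded_iff)
  then show "\<phi> \<in> Md G d"
    using \<phi> F' by (auto simp: Md_def)
  show "Md_norm G d \<phi> \<le> Md_bound G d H \<alpha> \<xi> \<beta>"
    using Md_norm_le[OF d ne F'] le by simp
qed

text \<open>Division by \<open>C\<close> moves \<open>\<phi>\<close> into the unit ball over which
  \<open>Xd_norm\<close> is a supremum. A separate positive \<open>C\<close> is taken because the
  bound of the factorization may itself be zero.\<close>

lemma cmod_pairing_le_Md_bound:
  fixes G :: "('a, 'b) monoid_scheme" and H :: "nat \<Rightarrow> 'h inner_space"
  assumes d: "d \<ge> 2" and G: "group G" and \<phi>: "\<phi> \<in> functions_on G" and F: "Md_factorization G d \<phi> H \<alpha> \<xi> \<beta>"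
    and C: "C > 0" "Md_bound G d H \<alpha> \<xi> \<beta> \<le> C" and g: "g \<in> l1 G"
  shows "cmod (pairing G \<phi> g) \<le> C * Xd_norm G d g"
proof -
  interpret group G by fact
  have ne: "carrier G \<noteq> {}" by blast
  define \<psi> where "\<psi> t = \<phi> t / complex_of_real C" for t
  obtain \<alpha>' where F': "Md_factorization G d \<psi> H \<alpha>' \<xi> \<beta>"
    and le: "Md_bound G d H \<alpha>' \<xi> \<beta> \<le> Md_bound G d H \<alpha> \<xi> \<beta> / C"
    using Md_factorization_scale[OF d ne F C(1)] unfolding \<psi>_def[abs_def] by blast
  have "Md_bound G d H \<alpha> \<xi> \<beta> / C \<le> 1" using C by simp
  then have "Md_bound G d H \<alpha>' \<xi> \<beta> \<le> 1" using le by linarith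
  moreover have "\<psi> \<in> functions_on G" using \<phi> by (simp add: functions_on_def \<psi>_def)
  ultimately have \<psi>: "\<psi> \<in> Md G d" "Md_norm G d \<psi> \<le> 1"
    using Md_if_factorization[OF d G _ F'] by auto
  have "pairing G \<phi> g = (\<Sum>\<^sub>\<infinity>t\<in>carrier G. complex_of_real C * (\<psi> t * g t))"
    using C by (simp add: pairing_def \<psi>_def)
  also have "\<dots> = complex_of_real C * pairing G \<psi> g"
    unfolding pairing_def by (rule infsum_cmult_right')
  finally show ?thesis
    using cmod_pairing_le_Xd_norm[OF d G g \<psi>] C by (simp add: norm_mult)
qed

text \<open>The supremum is meaningful only over a nonempty set: rescaling any multiplier supplies a
  member of the unit ball, and all pairings with the zero function vanish.\<close>

lemma Xd_norm_zero:
  assumes "d \<ge> 2" "group G" "Md G d \<noteq> {}"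
  shows "Xd_norm G d (\<lambda>t. 0) = 0"
proof -
  have "{\<phi> \<in> Md G d. Md_norm G d \<phi> \<le> 1} \<noteq> {}"
    using assms Md_unit_multiple[of d G] by (metis (mono_tags, lifting) all_not_in_conv mem_Collect_eq)
  then show ?thesis by (simp add: Xd_norm_def pairing_def)
qed

lemma Xd_rel_refl:
  assumes "d \<ge> 2" "group G" "Md G d \<noteq> {}" "g \<in> Xd_Cauchy G d"
  shows "(g, g) \<in> Xd_rel G d"
  using assms by (simp add: Xd_rel_def Xd_norm_zero)

lemma l1_diff:
  assumes "g \<in> l1 G" "h \<in> l1 G"
  shows "(\<lambda>t. g t - h t) \<in> l1 G"
proof -
  have "(\<lambda>t. norm (g t) + norm (h t)) summable_on carrier G"
    using assms by (intro summable_on_add) (auto simp: l1_def)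
  then have "(\<lambda>t. norm (g t - h t)) summable_on carrier G"
    by (rule Infinite_Sum.abs_summable_on_comparison_test') (auto intro: norm_triangle_ineq4)
  then show ?thesis using assms by (auto simp: l1_def functions_on_def)
qed

text \<open>A criterion for weak* continuity. \<open>S\<close> is the preadjoint of \<open>T\<close>
  on \<open>\<ell>^1\<close> functions; the control of factorization bounds makes \<open>S\<close>
  bounded for the norms of the preduals, so it extends to the completions, and each functional
  \<open>\<phi> \<mapsto> duality B (T \<phi>) x\<close> is again given by an element of
  \<open>Xd A d\<close>.\<close>

lemma continuous_map_Md_weak_star:
  fixes A :: "('a, 'c) monoid_scheme" and B :: "('b, 'd) monoid_scheme"
    and T :: "('a \<Rightarrow> complex) \<Rightarrow> 'b \<Rightarrow> complex" and S :: "('b \<Rightarrow> complex) \<Rightarrow> 'a \<Rightarrow> complex"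
  assumes d: "d \<ge> 2" and A: "group A" and B: "group B" and ne: "Md A d \<noteq> {}"
    and T: "\<And>\<phi>. T \<phi> \<in> functions_on B"
    and fac: "\<And>\<phi> (H :: nat \<Rightarrow> ('a list \<Rightarrow> complex) inner_space) \<alpha> \<xi> \<beta>. Md_factorization A d \<phi> H \<alpha> \<xi> \<beta> \<Longrightarrow>
      \<exists>(H' :: nat \<Rightarrow> 'h inner_space) \<alpha>' \<xi>' \<beta>'. Md_factorization B d (T \<phi>) H' \<alpha>' \<xi>' \<beta>'
        \<and> Md_bound B d H' \<alpha>' \<xi>' \<beta>' \<le> K * Md_bound A d H \<alpha> \<xi> \<beta>"
    and K: "K \<ge> 0"
    and S: "\<And>g. g \<in> l1 B \<Longrightarrow> S g \<in> l1 A"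
    and S_diff: "\<And>g h. g \<in> l1 B \<Longrightarrow> h \<in> l1 B \<Longrightarrow> S (\<lambda>t. g t - h t) = (\<lambda>t. S g t - S h t)"
    and pairing: "\<And>\<phi> g. \<phi> \<in> Md A d \<Longrightarrow> g \<in> l1 B \<Longrightarrow> pairing B (T \<phi>) g = pairing A \<phi> (S g)"
  shows "continuous_map (Md_weak_star A d) (Md_weak_star B d) T"
proof -
  interpret A: group A by fact
  have TM: "T \<phi> \<in> Md B d" if \<phi>: "\<phi> \<in> Md A d" for \<phi>
  proof -
    obtain H :: "nat \<Rightarrow> ('a list \<Rightarrow> complex) inner_space" and \<alpha> \<xi> \<beta>
      where "Md_factorization A d \<phi> H \<alpha> \<xi> \<beta>"
      using \<phi> by (auto simp: Md_def)
    from fac[OF this] show ?thesis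
      using Md_if_factorization(1)[OF d B T] by metis
  qed
  then have neB: "Md B d \<noteq> {}" using ne by auto
  have unit_ne: "{\<phi> \<in> Md A d. Md_norm A d \<phi> \<le> 1} \<noteq> {}"
    using ne Md_unit_multiple[OF d A] by (metis (mono_tags, lifting) all_not_in_conv mem_Collect_eq)
  \<comment> \<open>The infimum in \<open>Md_norm\<close> need not be attained, but norm at most 1
    allows a factorization of bound below 2, which explains the factor 2. The summand 1 keeps
    \<open>C\<close> positive when \<open>K = 0\<close>.\<close>
  define C where "C = 2 * K + 1"
  have C: "C > 0" using K by (simp add: C_def)
  have S_norm: "Xd_norm A d (S g) \<le> C * Xd_norm B d g" if g: "g \<in> l1 B" for g
    unfolding Xd_norm_def[of A]
  proof (rule cSUP_least[OF unit_ne])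
    fix \<phi> assume "\<phi> \<in> {\<phi> \<in> Md A d. Md_norm A d \<phi> \<le> 1}"
    then have \<phi>: "\<phi> \<in> Md A d" "Md_norm A d \<phi> < 2" by auto
    define X where "X = {Md_bound A d H \<alpha> \<xi> \<beta> | (H :: nat \<Rightarrow> ('a list \<Rightarrow> complex) inner_space) \<alpha> \<xi> \<beta>.
      Md_factorization A d \<phi> H \<alpha> \<xi> \<beta>}"
    have "X \<noteq> {}" using \<phi>(1) by (auto simp: X_def Md_def)
    moreover have "Inf X < 2" using \<phi>(2) by (simp add: X_def Md_norm_def)
    ultimately obtain b where b: "b \<in> X" "b < 2"
      using cInf_lessD by blast
    then obtain H :: "nat \<Rightarrow> ('a list \<Rightarrow> complex) inner_space" and \<alpha> \<xi> \<beta>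
      where F: "Md_factorization A d \<phi> H \<alpha> \<xi> \<beta>" and b: "Md_bound A d H \<alpha> \<xi> \<beta> < 2"
      unfolding X_def by auto
    obtain H' :: "nat \<Rightarrow> 'h inner_space" and \<alpha>' \<xi>' \<beta>' where F': "Md_factorization B d (T \<phi>) H' \<alpha>' \<xi>' \<beta>'"
      and "Md_bound B d H' \<alpha>' \<xi>' \<beta>' \<le> K * Md_bound A d H \<alpha> \<xi> \<beta>"
      using fac[OF F] by blast
    moreover have "K * Md_bound A d H \<alpha> \<xi> \<beta> \<le> K * 2"
      using b K by (intro mult_left_mono) auto
    ultimately have "Md_bound B d H' \<alpha>' \<xi>' \<beta>' \<le> C" by (simp add: C_def)
    then show "cmod (pairing A \<phi> (S g)) \<le> C * Xd_norm B d g"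
      using cmod_pairing_le_Md_bound[OF d B T F' C _ g] pairing[OF \<phi>(1) g] by simp
  qed
  have S_Cauchy: "(\<lambda>n. S (g n)) \<in> Xd_Cauchy A d" if g: "g \<in> Xd_Cauchy B d" for g
  proof -
    have l1: "g n \<in> l1 B" for n using g by (simp add: Xd_Cauchy_def)
    have le: "Xd_norm A d (\<lambda>t. S (g m) t - S (g n) t) \<le> C * Xd_norm B d (\<lambda>t. g m t - g n t)" for m n
      using S_norm[OF l1_diff[OF l1 l1]] S_diff[OF l1 l1] by simp
    have "\<exists>N. \<forall>m\<ge>N. \<forall>n\<ge>N. Xd_norm A d (\<lambda>t. S (g m) t - S (g n) t) < e" if e: "e > 0" for e
    proof -
      have "e / C > 0" using e C by simp
      then obtain N where N: "\<And>m n. m \<ge> N \<Longrightarrow> n \<ge> N \<Longrightarrow> Xd_norm B d (\<lambda>t. g m t - g n t) < e / C"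
        using g unfolding Xd_Cauchy_def by blast
      have "Xd_norm A d (\<lambda>t. S (g m) t - S (g n) t) < e" if "m \<ge> N" "n \<ge> N" for m n
        using le[of m n] N[OF that] C by (simp add: field_simps)
      then show ?thesis by blast
    qed
    then show ?thesis using S l1 by (simp add: Xd_Cauchy_def)
  qed
  \<comment> \<open>The witness is the class of the image sequence under \<open>S\<close>. Both
    dualities are limits of the same sequence of numbers, by the pairing identity on
    \<open>\<ell>^1\<close>.\<close>
  have dual: "\<exists>y\<in>Xd A d. \<forall>\<phi>\<in>Md A d. duality B (T \<phi>) x = duality A \<phi> y" if x: "x \<in> Xd B d" for x
  proof -
    obtain g where g: "g \<in> Xd_Cauchy B d" "x = Xd_rel B d `` {g}"
      using x by (auto simp: Xd_def quotient_def)
    have gx: "g \<in> x" using Xd_rel_refl[OF d B neB g(1)] g(2) by simp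
    define y where "y = Xd_rel A d `` {\<lambda>n. S (g n)}"
    have y: "y \<in> Xd A d" using S_Cauchy[OF g(1)] by (auto simp: Xd_def y_def quotient_def)
    have Sy: "(\<lambda>n. S (g n)) \<in> y"
      using Xd_rel_refl[OF d A ne S_Cauchy[OF g(1)]] by (simp add: y_def)
    have "duality B (T \<phi>) x = duality A \<phi> y" if \<phi>: "\<phi> \<in> Md A d" for \<phi>
    proof -
      have "pairing B (T \<phi>) (g n) = pairing A \<phi> (S (g n))" for n
        using g(1) by (intro pairing \<phi>) (simp add: Xd_Cauchy_def)
      then have "(\<lambda>n. pairing A \<phi> (S (g n))) \<longlonglongrightarrow> duality B (T \<phi>) x"
        using duality_eq[OF d B TM[OF \<phi>] x gx] by simp
      then show ?thesis
        using duality_eq[OF d A \<phi> y Sy] LIMSEQ_unique by blast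
    qed
    then show ?thesis using y by blast
  qed
  show ?thesis
    unfolding Md_weak_star_def[of B]
  proof (rule continuous_map_pullback')
    show "continuous_map (Md_weak_star A d) (product_topology (\<lambda>_. euclidean) (Xd B d))
        ((\<lambda>\<phi>. \<lambda>x\<in>Xd B d. duality B \<phi> x) \<circ> T)"
      unfolding continuous_map_componentwise
    proof (intro conjI ballI)
      fix x assume x: "x \<in> Xd B d"
      then obtain y where y: "y \<in> Xd A d" "\<And>\<phi>. \<phi> \<in> Md A d \<Longrightarrow> duality B (T \<phi>) x = duality A \<phi> y"
        using dual by blast
      show "continuous_map (Md_weak_star A d) euclidean (\<lambda>\<phi>. ((\<lambda>\<phi>. \<lambda>x\<in>Xd B d. duality B \<phi> x) \<circ> T) \<phi> x)"
        by (rule continuous_map_eq[OF continuous_map_duality[OF y(1)]]) (use x y in auto)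
    qed auto
  qed (use TM in auto)
qed

section \<open>Cosets of a normal subgroup\<close>

text \<open>The quotient group is built from right cosets, while the decomposition of
  \<open>t\<close> puts the representative on the left and the remainder in \<open>\<Gamma>\<close>
  on the right. Normality reconciles the two, through \<open>coset_eq_iff\<close>.\<close>

locale coset_section = normal \<Gamma> G for \<Gamma> and G (structure) +
  fixes \<sigma> :: "'a set \<Rightarrow> 'a"
  assumes section_mem: "x \<in> rcosets \<Gamma> \<Longrightarrow> \<sigma> x \<in> x"
begin

definition remainder :: "'a \<Rightarrow> 'a" where
  "remainder t = inv \<sigma> (\<Gamma> #> t) \<otimes> t"

text \<open>Translation of the quotient by the inverse of \<open>t\<close>, written with a
  representative; \<open>shift_coset\<close> shows independence of that choice.\<close>

definition shift :: "'a \<Rightarrow> 'a set \<Rightarrow> 'a set" where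
  "shift t y = \<Gamma> #> (inv t \<otimes> \<sigma> y)"

text \<open>The defect of equivariance of the section: \<open>\<sigma> y\<close> and
  \<open>t \<otimes> \<sigma> (shift t y)\<close> represent the same coset, and this is the element
  of \<open>\<Gamma>\<close> by which they differ.\<close>

definition cocycle :: "'a \<Rightarrow> 'a set \<Rightarrow> 'a" where
  "cocycle t y = inv \<sigma> y \<otimes> t \<otimes> \<sigma> (shift t y)"

lemma is_sub: "subgroup \<Gamma> G" ..

lemma coset_in [simp]: "t \<in> carrier G \<Longrightarrow> \<Gamma> #> t \<in> rcosets \<Gamma>"
  using rcosetsI subset by blast

lemma section_closed [simp]: "x \<in> rcosets \<Gamma> \<Longrightarrow> \<sigma> x \<in> carrier G"
  using section_mem rcosets_part_G[OF is_sub] by blast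

lemma coset_section [simp]:
  assumes x: "x \<in> rcosets \<Gamma>"
  shows "\<Gamma> #> \<sigma> x = x"
proof -
  obtain g where g: "g \<in> carrier G" "x = \<Gamma> #> g"
    using x by (auto simp: RCOSETS_def)
  then show ?thesis
    using repr_independence[OF _ g(1) is_sub, of "\<sigma> x"] section_mem[OF x] by simp
qed

text \<open>For right cosets the membership test produces \<open>t \<otimes> inv s\<close>;
  conjugation by \<open>s\<close>, allowed by normality, turns it into
  \<open>inv s \<otimes> t\<close>.\<close>

lemma coset_eq_iff:
  assumes "s \<in> carrier G" "t \<in> carrier G"
  shows "\<Gamma> #> s = \<Gamma> #> t \<longleftrightarrow> inv s \<otimes> t \<in> \<Gamma>"
proof -
  have "\<Gamma> #> s = \<Gamma> #> t \<longleftrightarrow> t \<in> \<Gamma> #> s"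
    using assms repr_independence[OF _ _ is_sub, of t s] rcos_self[OF assms(2) is_sub] by auto
  also have "\<dots> \<longleftrightarrow> t \<otimes> inv s \<in> \<Gamma>"
    using assms by (intro rcos_module) (auto intro: is_group)
  also have "\<dots> \<longleftrightarrow> inv s \<otimes> t \<in> \<Gamma>"
  proof
    assume "t \<otimes> inv s \<in> \<Gamma>"
    from inv_op_closed1[OF assms(1) this] show "inv s \<otimes> t \<in> \<Gamma>"
      using assms by (simp add: m_assoc)
  next
    assume "inv s \<otimes> t \<in> \<Gamma>"
    from inv_op_closed2[OF assms(1) this] show "t \<otimes> inv s \<in> \<Gamma>"
      using assms by (simp add: m_assoc[symmetric])
  qed
  finally show ?thesis .
qed

lemma remainder_in [simp]: "t \<in> carrier G \<Longrightarrow> remainder t \<in> \<Gamma>"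
  unfolding remainder_def by (subst coset_eq_iff[symmetric]) auto

lemma section_remainder: "t \<in> carrier G \<Longrightarrow> \<sigma> (\<Gamma> #> t) \<otimes> remainder t = t"
  by (simp add: remainder_def m_assoc[symmetric])

lemma coset_section_mult [simp]:
  assumes "x \<in> rcosets \<Gamma>" "\<gamma> \<in> \<Gamma>"
  shows "\<Gamma> #> (\<sigma> x \<otimes> \<gamma>) = x"
proof -
  have "\<Gamma> #> \<sigma> x = \<Gamma> #> (\<sigma> x \<otimes> \<gamma>)"
    using assms by (subst coset_eq_iff) (auto simp: m_assoc[symmetric])
  then show ?thesis using assms by simp
qed

lemma remainder_section_mult [simp]:
  "\<lbrakk>x \<in> rcosets \<Gamma>; \<gamma> \<in> \<Gamma>\<rbrakk> \<Longrightarrow> remainder (\<sigma> x \<otimes> \<gamma>) = \<gamma>"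
  by (simp add: remainder_def m_assoc[symmetric])

text \<open>Coordinates on \<open>G\<close> with values in the product of quotient and subgroup;
  they turn sums over \<open>G\<close> into double sums.\<close>

lemma bij_betw_section_mult: "bij_betw (\<lambda>(x, \<gamma>). \<sigma> x \<otimes> \<gamma>) ((rcosets \<Gamma>) \<times> \<Gamma>) (carrier G)"
  by (rule bij_betw_byWitness[where f' = "\<lambda>t. (\<Gamma> #> t, remainder t)"])
    (auto simp: section_remainder)

lemma shift_in [simp]: "t \<in> carrier G \<Longrightarrow> y \<in> rcosets \<Gamma> \<Longrightarrow> shift t y \<in> rcosets \<Gamma>"
  by (simp add: shift_def)

lemma shift_coset:
  assumes "t \<in> carrier G" "p \<in> carrier G"
  shows "shift t (\<Gamma> #> p) = \<Gamma> #> (inv t \<otimes> p)"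
proof -
  have "(\<Gamma> #> inv t) <#> (\<Gamma> #> \<sigma> (\<Gamma> #> p)) = (\<Gamma> #> inv t) <#> (\<Gamma> #> p)"
    using assms by simp
  then show ?thesis using assms unfolding shift_def by (simp only: rcos_sum inv_closed section_closed coset_in)
qed

text \<open>Assuming \<open>s \<otimes> t = \<one>\<close> instead of fixing \<open>s\<close> as an
  inverse lets both compositions in \<open>bij_betw_shift\<close> be instances.\<close>

lemma shift_shift:
  assumes "s \<in> carrier G" "t \<in> carrier G" "y \<in> rcosets \<Gamma>" "s \<otimes> t = \<one>"
  shows "shift s (shift t y) = y"
proof -
  have t: "inv t = s" using assms inv_equality by blast
  have "shift s (shift t y) = \<Gamma> #> (inv s \<otimes> (s \<otimes> \<sigma> y))"
    using assms(1-3) by (simp add: shift_def[of t] t shift_coset)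
  also have "inv s \<otimes> (s \<otimes> \<sigma> y) = \<sigma> y"
    using assms(1,3) by (simp add: m_assoc[symmetric])
  finally show ?thesis using assms(3) by (simp only: coset_section)
qed

lemma bij_betw_shift: "t \<in> carrier G \<Longrightarrow> bij_betw (shift t) (rcosets \<Gamma>) (rcosets \<Gamma>)"
  by (intro bij_betw_byWitness[where f' = "shift (inv t)"] ballI shift_shift image_subsetI shift_in)
    simp_all

lemma cocycle_in [simp]:
  assumes t: "t \<in> carrier G" and y: "y \<in> rcosets \<Gamma>"
  shows "cocycle t y \<in> \<Gamma>"
proof -
  have "\<Gamma> #> (inv t \<otimes> \<sigma> y) = \<Gamma> #> \<sigma> (shift t y)"
    using t y by (simp add: shift_def)
  then have "inv (inv t \<otimes> \<sigma> y) \<otimes> \<sigma> (shift t y) \<in> \<Gamma>"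
    using t y by (subst (asm) coset_eq_iff) auto
  then show ?thesis
    using t y by (simp only: cocycle_def inv_mult_group inv_inv inv_closed section_closed)
qed

lemma shift_mult: "\<lbrakk>t \<in> carrier G; p \<in> carrier G\<rbrakk> \<Longrightarrow> shift t (\<Gamma> #> (t \<otimes> p)) = \<Gamma> #> p"
  by (simp add: shift_coset m_assoc[symmetric])

text \<open>The representative \<open>\<sigma> (\<Gamma> #> p)\<close> ending the cocycle recombines
  with \<open>remainder p\<close> to \<open>p\<close>. Iterating this turns a product in
  \<open>G\<close> into a product of cocycles in \<open>\<Gamma>\<close>.\<close>

lemma cocycle_remainder:
  assumes t: "t \<in> carrier G" and p: "p \<in> carrier G"
  shows "cocycle t (\<Gamma> #> (t \<otimes> p)) \<otimes> remainder p = remainder (t \<otimes> p)"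
proof -
  have "cocycle t (\<Gamma> #> (t \<otimes> p)) \<otimes> remainder p
      = inv \<sigma> (\<Gamma> #> (t \<otimes> p)) \<otimes> t \<otimes> (\<sigma> (\<Gamma> #> p) \<otimes> remainder p)"
    using t p subset by (simp add: cocycle_def shift_mult m_assoc subsetD[OF subset])
  then show ?thesis
    using t p by (simp add: section_remainder remainder_def[of "t \<otimes> p"] m_assoc)
qed

text \<open>In the coordinates \<open>t \<mapsto> (\<Gamma> #> t, remainder t)\<close> this is the tensor product of \<open>c\<close> and \<open>\<phi>\<close>.\<close>

definition twist :: "('a set \<Rightarrow> complex) \<Rightarrow> ('a \<Rightarrow> complex) \<Rightarrow> 'a \<Rightarrow> complex" where
  "twist c \<phi> t = (if t \<in> carrier G then c (\<Gamma> #> t) * \<phi> (remainder t) else 0)"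

end

section \<open>Multipliers of an extension\<close>

lemma Md_factorizationD:
  assumes "Md_factorization G d \<phi> H \<alpha> \<xi> \<beta>"
  shows "1 \<le> i \<Longrightarrow> i < d \<Longrightarrow> hilbert_space (H i)"
    and "bounded_map G (H 1) complex_space \<alpha>"
    and "2 \<le> i \<Longrightarrow> i < d \<Longrightarrow> bounded_map G (H i) (H (i - 1)) (\<xi> i)"
    and "bounded_map G complex_space (H (d - 1)) \<beta>"
    and "\<lbrakk>s \<in> carrier G; set ts \<subseteq> carrier G; u \<in> carrier G; length ts = d - 2\<rbrakk>
      \<Longrightarrow> \<phi> (s \<otimes>\<^bsub>G\<^esub> foldr (\<otimes>\<^bsub>G\<^esub>) ts u) = \<alpha> s (op_prod \<xi> 2 ts (\<beta> u 1))"
  using assms by (auto simp: Md_factorization_def lists_eq_set)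

context coset_section
begin

text \<open>
  Replacing each factor of a product by its cocycle at the coset reached so far turns the product
  into the remainder of the original one.  A vector of \<open>\<ell>\<^sup>2(G/\<Gamma>; H i)\<close> keeps track of that coset,
  and the weight \<open>c\<close> enters only the first map.
\<close>

lemma Md_factorization_twist:
  fixes H :: "nat \<Rightarrow> 'h inner_space"
  assumes d: "d \<ge> 2" and F: "Md_factorization (G\<lparr>carrier := \<Gamma>\<rparr>) d \<phi> H \<alpha> \<xi> \<beta>"
    and c: "finite {y. c y \<noteq> 0}" "{y. c y \<noteq> 0} \<subseteq> rcosets \<Gamma>"
  obtains H' :: "nat \<Rightarrow> ('a set \<Rightarrow> 'h) inner_space" and \<alpha>' \<xi>' \<beta>'
  where "Md_factorization G d (twist c \<phi>) H' \<alpha>' \<xi>' \<beta>'"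
    and "Md_bound G d H' \<alpha>' \<xi>' \<beta>'
      \<le> (\<Sum>y | c y \<noteq> 0. cmod (c y)) * Md_bound (G\<lparr>carrier := \<Gamma>\<rparr>) d H \<alpha> \<xi> \<beta>"
proof -
  let ?\<Gamma> = "G\<lparr>carrier := \<Gamma>\<rparr>" and ?I = "rcosets \<Gamma>"
  note F = Md_factorizationD[OF F]
  have hil: "hilbert_space (H i)" if "1 \<le> i" "i < d" for i
    using F(1) that by blast
  have pre: "pre_hilbert_space (H i)" if "1 \<le> i" "i < d" for i
    using hilbert_space.axioms(1)[OF hil[OF that]] .
  note C = pre_hilbert_space_complex_space
  have "\<Gamma> \<noteq> {}" using subgroup.one_closed[OF is_sub] by blast
  then have ne: "carrier G \<noteq> {}" "carrier ?\<Gamma> \<noteq> {}" by auto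
  have opsD: "T t \<in> bounded_ops K L" if "bounded_map ?\<Gamma> K L T" "t \<in> \<Gamma>"
    for T :: "'a \<Rightarrow> 'x \<Rightarrow> 'y" and K L t
    using that by (simp add: bounded_map_def)
  define A where "A = sup_norm ?\<Gamma> (H 1) complex_space \<alpha>"
  define X where "X i = sup_norm ?\<Gamma> (H i) (H (i - 1)) (\<xi> i)" for i
  define B where "B = sup_norm ?\<Gamma> complex_space (H (d - 1)) \<beta>"
  define S where "S = (\<Sum>y | c y \<noteq> 0. cmod (c y))"
  have nonneg: "A \<ge> 0" "\<And>i. 2 \<le> i \<Longrightarrow> i < d \<Longrightarrow> X i \<ge> 0" "B \<ge> 0" "S \<ge> 0"
    unfolding A_def X_def B_def S_def using d
    by (auto intro!: sup_norm_nonneg pre C F[unfolded One_nat_def] sum_nonneg ne)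
  have \<alpha>: "\<alpha> t \<in> bounded_ops (H 1) complex_space" "\<And>x. x \<in> carrier (H 1) \<Longrightarrow> cmod (\<alpha> t x) \<le> A * hnorm (H 1) x"
    if "t \<in> \<Gamma>" for t
    using opsD[OF F(2) that] hnorm_le_sup_norm(1)[OF pre C F(2)] that d by (auto simp: A_def)
  have \<xi>: "\<xi> i t \<in> bounded_ops (H i) (H (i - 1))"
    "\<And>x. x \<in> carrier (H i) \<Longrightarrow> hnorm (H (i - 1)) (\<xi> i t x) \<le> X i * hnorm (H i) x"
    if "2 \<le> i" "i < d" "t \<in> \<Gamma>" for i t
    using opsD[OF F(3) that(3)] hnorm_le_sup_norm(1)[OF pre pre F(3), of i] that by (auto simp: X_def)
  have \<beta>: "\<beta> t \<in> bounded_ops complex_space (H (d - 1))"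
    "\<And>z. hnorm (H (d - 1)) (\<beta> t z) \<le> B * cmod z" if "t \<in> \<Gamma>" for t
    using opsD[OF F(4) that] hnorm_le_sup_norm(1)[OF C pre F(4)] that d by (auto simp: B_def)
  have \<alpha>_lin: "\<lbrakk>x \<in> carrier (H 1); y \<in> carrier (H 1)\<rbrakk> \<Longrightarrow> \<alpha> k (x \<oplus>\<^bsub>H 1\<^esub> y) = \<alpha> k x + \<alpha> k y"
    "x \<in> carrier (H 1) \<Longrightarrow> \<alpha> k (z \<odot>\<^bsub>H 1\<^esub> x) = z * \<alpha> k x" if "k \<in> \<Gamma>" for k x y z
    using bounded_opsD(2,3)[OF \<alpha>(1)[OF that]] by simp_all
  have \<beta>_lin: "\<beta> k z \<in> carrier (H (d - 1))"
    "\<beta> k (y + z) = \<beta> k y \<oplus>\<^bsub>H (d - 1)\<^esub> \<beta> k z"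
    "\<beta> k (y * z) = y \<odot>\<^bsub>H (d - 1)\<^esub> \<beta> k z" if "k \<in> \<Gamma>" for k y z
    using bounded_opsD[OF \<beta>(1)[OF that]] by simp_all
  note \<xi>_lin = bounded_opsD[OF \<xi>(1)]
  \<comment> \<open>The induced factorization: \<open>\<beta>'\<close> places its vector at the
    coset of the last factor, \<open>\<xi>'\<close> at \<open>t\<close> moves a vector from the
    coset of \<open>p\<close> to that of \<open>t \<otimes> p\<close> while applying
    \<open>\<xi>\<close> at the cocycle, and \<open>\<alpha>'\<close> reads off the coordinates
    weighted by \<open>c\<close>.\<close>
  define H' where "H' i = hilbert_sum ?I (H i)" for i
  define \<alpha>' where "\<alpha>' t f = (\<Sum>y | c y \<noteq> 0. c y * \<alpha> (cocycle t y) (f (shift t y)))" for t f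
  define \<xi>' where "\<xi>' i t = shift_op ?I (H (i - 1)) (shift t) (\<lambda>y. \<xi> i (cocycle t y))" for i t
  define \<beta>' where "\<beta>' t z = single (H (d - 1)) (\<Gamma> #> t) (\<beta> (remainder t) z)" for t z
  have hil': "hilbert_space (H' i)" if "1 \<le> i" "i < d" for i
    unfolding H'_def using that by (intro hilbert_space_hilbert_sum hil)
  have pre': "pre_hilbert_space (H' i)" if "1 \<le> i" "i < d" for i
    using hilbert_space.axioms(1)[OF hil'[OF that]] .
  have mem: "f x \<in> carrier (H i)" if "f \<in> carrier (H' i)" for f x i
    using that unfolding H'_def by (rule hilbert_sum_memD(1))
  have cI: "y \<in> ?I" if "c y \<noteq> 0" for y using c(2) that by blast
  have a: "bounded_map G (H' 1) complex_space \<alpha>'" "sup_norm G (H' 1) complex_space \<alpha>' \<le> S * A"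
  proof -
    \<comment> \<open>Only the finitely many cosets in the support of \<open>c\<close> enter, and
      each coordinate of \<open>f\<close> has norm at most that of \<open>f\<close>. The price is
      the \<open>\<ell>^1\<close> norm \<open>S\<close> of \<open>c\<close>.\<close>
    have le: "cmod (\<alpha>' t f) \<le> S * A * hnorm (H' 1) f" if t: "t \<in> carrier G" and f: "f \<in> carrier (H' 1)" for t f
    proof -
      have "cmod (\<alpha>' t f) \<le> (\<Sum>y | c y \<noteq> 0. cmod (c y) * (A * hnorm (H' 1) f))"
        unfolding \<alpha>'_def
      proof (intro sum_norm_le)
        fix y assume "y \<in> {y. c y \<noteq> 0}"
        then have y: "y \<in> ?I" using cI by simp
        have "cmod (\<alpha> (cocycle t y) (f (shift t y))) \<le> A * hnorm (H 1) (f (shift t y))"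
          using \<alpha>(2)[OF cocycle_in[OF t y] mem[OF f]] .
        also have "\<dots> \<le> A * hnorm (H' 1) f"
          using pre_hilbert_space.hnorm_component_le[OF pre[of 1]] f d nonneg(1)
          by (intro mult_left_mono) (auto simp: H'_def)
        finally show "cmod (c y * \<alpha> (cocycle t y) (f (shift t y))) \<le> cmod (c y) * (A * hnorm (H' 1) f)"
          by (simp add: norm_mult mult_left_mono)
      qed
      also have "\<dots> = S * A * hnorm (H' 1) f"
        by (simp add: S_def sum_distrib_right mult.assoc)
      finally show ?thesis .
    qed
    have add: "\<alpha>' t (f \<oplus>\<^bsub>H' 1\<^esub> g) = \<alpha>' t f + \<alpha>' t g"
      if "t \<in> carrier G" "f \<in> carrier (H' 1)" "g \<in> carrier (H' 1)" for t f g
    proof -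
      have "\<alpha>' t (f \<oplus>\<^bsub>H' 1\<^esub> g) = (\<Sum>y | c y \<noteq> 0. c y * \<alpha> (cocycle t y) (f (shift t y))
          + c y * \<alpha> (cocycle t y) (g (shift t y)))"
        unfolding \<alpha>'_def
      proof (intro sum.cong refl)
        fix y assume "y \<in> {y. c y \<noteq> 0}"
        then have "cocycle t y \<in> \<Gamma>" using that(1) cI by simp
        from \<alpha>_lin(1)[OF this mem mem] that(2,3)
        show "c y * \<alpha> (cocycle t y) ((f \<oplus>\<^bsub>H' 1\<^esub> g) (shift t y))
            = c y * \<alpha> (cocycle t y) (f (shift t y)) + c y * \<alpha> (cocycle t y) (g (shift t y))"
          by (simp only: H'_def hilbert_sum_simps distrib_left)
      qed
      then show ?thesis by (simp only: \<alpha>'_def sum.distrib)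
    qed
    have smult: "\<alpha>' t (a \<odot>\<^bsub>H' 1\<^esub> f) = a * \<alpha>' t f"
      if "t \<in> carrier G" "f \<in> carrier (H' 1)" for t f a
      unfolding \<alpha>'_def sum_distrib_left
    proof (intro sum.cong refl)
      fix y assume "y \<in> {y. c y \<noteq> 0}"
      then have "cocycle t y \<in> \<Gamma>" using that(1) cI by simp
      from \<alpha>_lin(2)[OF this mem] that(2)
      show "c y * \<alpha> (cocycle t y) ((a \<odot>\<^bsub>H' 1\<^esub> f) (shift t y))
          = a * (c y * \<alpha> (cocycle t y) (f (shift t y)))"
        by (simp only: H'_def hilbert_sum_simps mult.left_commute)
    qed
    show "bounded_map G (H' 1) complex_space \<alpha>'"
      by (rule bounded_mapI(1)[where C = "S * A"]) (use d pre'[of 1] ne le add smult nonneg in auto)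
    show "sup_norm G (H' 1) complex_space \<alpha>' \<le> S * A"
      by (rule bounded_mapI(2)) (use d pre'[of 1] ne le add smult nonneg in auto)
  qed
  have x: "bounded_map G (H' i) (H' (i - 1)) (\<xi>' i)"
    "sup_norm G (H' i) (H' (i - 1)) (\<xi>' i) \<le> X i" if i: "2 \<le> i" "i < d" for i
  proof -
    have so: "\<xi>' i t f \<in> carrier (H' (i - 1))" "hnorm (H' (i - 1)) (\<xi>' i t f) \<le> X i * hnorm (H' i) f"
      if "t \<in> carrier G" "f \<in> carrier (H' i)" for t f
    proof -
      have "hilbert_space (H (i - 1))" using hil i by simp
      then have K: "pre_hilbert_space (H (i - 1))" by (rule hilbert_space.axioms(1))
      note so = shift_op_hilbert_sum[OF pre K bij_betw_shift[OF that(1)], of i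
          "\<lambda>y. \<xi> i (cocycle t y)" "X i" f]
      show "\<xi>' i t f \<in> carrier (H' (i - 1))"
        unfolding H'_def \<xi>'_def
        by (rule so(1)) (use i that \<xi>_lin(1) \<xi>(2) nonneg(2) in \<open>auto simp: H'_def\<close>)
      show "hnorm (H' (i - 1)) (\<xi>' i t f) \<le> X i * hnorm (H' i) f"
        unfolding H'_def \<xi>'_def
        by (rule so(2)) (use i that \<xi>_lin(1) \<xi>(2) nonneg(2) in \<open>auto simp: H'_def\<close>)
    qed
    have add: "\<xi>' i t (f \<oplus>\<^bsub>H' i\<^esub> g) = \<xi>' i t f \<oplus>\<^bsub>H' (i - 1)\<^esub> \<xi>' i t g"
      if "t \<in> carrier G" "f \<in> carrier (H' i)" "g \<in> carrier (H' i)" for t f g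
    proof -
      interpret K: pre_hilbert_space "H (i - 1)" using pre i by simp
      show ?thesis
        using that i K.M.l_zero[OF K.M.zero_closed] by (intro ext) (auto simp: \<xi>'_def H'_def shift_op_def \<xi>_lin(2) mem[unfolded H'_def])
    qed
    have smult: "\<xi>' i t (a \<odot>\<^bsub>H' i\<^esub> f) = a \<odot>\<^bsub>H' (i - 1)\<^esub> \<xi>' i t f"
      if "t \<in> carrier G" "f \<in> carrier (H' i)" for t f a
    proof -
      interpret K: pre_hilbert_space "H (i - 1)" using pre i by simp
      show ?thesis
        using that i K.smult_r_null[of a]
        by (intro ext) (auto simp: \<xi>'_def H'_def shift_op_def \<xi>_lin(3) mem[unfolded H'_def])
    qed
    show "bounded_map G (H' i) (H' (i - 1)) (\<xi>' i)"
      by (rule bounded_mapI(1)[where C = "X i"]) (use i pre'[of i] ne so add smult nonneg(2) in auto)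
    show "sup_norm G (H' i) (H' (i - 1)) (\<xi>' i) \<le> X i"
      by (rule bounded_mapI(2)) (use i pre'[of i] ne so add smult nonneg(2) in auto)
  qed
  have b: "bounded_map G complex_space (H' (d - 1)) \<beta>'"
    "sup_norm G complex_space (H' (d - 1)) \<beta>' \<le> B"
  proof -
    interpret K: pre_hilbert_space "H (d - 1)" using pre d by simp
    have K: "pre_hilbert_space (H (d - 1))" ..
    have si: "\<beta>' t z \<in> carrier (H' (d - 1))" "hnorm (H' (d - 1)) (\<beta>' t z) \<le> B * cmod z"
      if "t \<in> carrier G" for t z
      using that single_hilbert_sum[OF K coset_in[OF that], of "\<beta> (remainder t) z"] \<beta>(2) \<beta>_lin(1)
      by (simp_all add: \<beta>'_def H'_def)
    have add: "\<beta>' t (y + z) = \<beta>' t y \<oplus>\<^bsub>H' (d - 1)\<^esub> \<beta>' t z" if "t \<in> carrier G" for t y z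
      using that K.M.l_zero[OF K.M.zero_closed] by (intro ext) (auto simp: \<beta>'_def H'_def single_def \<beta>_lin(2))
    have smult: "\<beta>' t (a * z) = a \<odot>\<^bsub>H' (d - 1)\<^esub> \<beta>' t z" if "t \<in> carrier G" for t a z
      using that K.smult_r_null[of a] by (intro ext) (auto simp: \<beta>'_def H'_def single_def \<beta>_lin(3))
    show "bounded_map G complex_space (H' (d - 1)) \<beta>'"
      by (rule bounded_mapI(1)[where C = B]) (use C ne si add smult nonneg in auto)
    show "sup_norm G complex_space (H' (d - 1)) \<beta>' \<le> B"
      by (rule bounded_mapI(2)) (use C ne si add smult nonneg in auto)
  qed
  \<comment> \<open>Invariant of a partial product from the right: the vector sits at a single
    coset, with value the partial product over \<open>\<Gamma>\<close> along the cocycles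
    \<open>ts'\<close>. The list \<open>ts\<close> fills the positions from \<open>i + 1\<close> to
    \<open>d - 1\<close>, position \<open>d\<close> being that of \<open>\<beta>'\<close>.\<close>
  have op: "\<exists>ts'. set ts' \<subseteq> \<Gamma> \<and> length ts' = length ts
      \<and> foldr (\<otimes>) ts' (remainder u) = remainder (foldr (\<otimes>) ts u)
      \<and> foldr (\<otimes>) ts u \<in> carrier G
      \<and> op_prod \<xi> (Suc i) ts' (\<beta> (remainder u) 1) \<in> carrier (H i)
      \<and> op_prod \<xi>' (Suc i) ts (\<beta>' u 1)
        = single (H i) (\<Gamma> #> foldr (\<otimes>) ts u) (op_prod \<xi> (Suc i) ts' (\<beta> (remainder u) 1))"
    if "1 \<le> i" "i + length ts = d - 1" "set ts \<subseteq> carrier G" and u: "u \<in> carrier G" for i ts u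
    using that(1-3)
  proof (induction ts arbitrary: i)
    case Nil
    then show ?case using u \<beta>_lin(1)[OF remainder_in[OF u], of 1] by (intro exI[of _ "[]"]) (simp add: \<beta>'_def)
  next
    case (Cons t ts)
    then have i: "2 \<le> Suc i" "Suc i < d" and t: "t \<in> carrier G" by auto
    let ?p = "foldr (\<otimes>) ts u"
    obtain ts' where ts': "set ts' \<subseteq> \<Gamma>" "length ts' = length ts"
      "foldr (\<otimes>) ts' (remainder u) = remainder ?p" and p: "?p \<in> carrier G"
      and w: "op_prod \<xi> (Suc (Suc i)) ts' (\<beta> (remainder u) 1) \<in> carrier (H (Suc i))"
        "op_prod \<xi>' (Suc (Suc i)) ts (\<beta>' u 1)
          = single (H (Suc i)) (\<Gamma> #> ?p) (op_prod \<xi> (Suc (Suc i)) ts' (\<beta> (remainder u) 1))"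
      using Cons.IH[of "Suc i"] Cons.prems by auto
    let ?w = "op_prod \<xi> (Suc (Suc i)) ts' (\<beta> (remainder u) 1)"
    \<comment> \<open>The cocycle at the coset where the vector arrives; it becomes the new head of
      \<open>ts'\<close>.\<close>
    define k where "k = cocycle t (\<Gamma> #> (t \<otimes> ?p))"
    have k: "k \<in> \<Gamma>" using t p by (simp add: k_def)
    have "\<xi>' (Suc i) t (single (H (Suc i)) (\<Gamma> #> ?p) ?w) = single (H i) (\<Gamma> #> (t \<otimes> ?p)) (\<xi> (Suc i) k ?w)"
    proof
      fix y
      \<comment> \<open>Injectivity of the translation leaves exactly one coordinate at which the
        image can be nonzero; at the others the operator is applied to the zero vector.\<close>
      have eq: "shift t y = \<Gamma> #> ?p \<longleftrightarrow> y = \<Gamma> #> (t \<otimes> ?p)" if y: "y \<in> ?I"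
        using bij_betw_imp_inj_on[OF bij_betw_shift[OF t]] y t p
          inj_on_eq_iff[of "shift t" ?I y "\<Gamma> #> (t \<otimes> ?p)"] by (simp add: shift_mult)
      have zero: "\<xi> (Suc i) (cocycle t y) \<zero>\<^bsub>H (Suc i)\<^esub> = \<zero>\<^bsub>H i\<^esub>" if y: "y \<in> ?I"
        using bounded_ops_zero[OF pre pre \<xi>(1)[OF i cocycle_in[OF t y]]] i Cons.prems by simp
      show "\<xi>' (Suc i) t (single (H (Suc i)) (\<Gamma> #> ?p) ?w) y
          = single (H i) (\<Gamma> #> (t \<otimes> ?p)) (\<xi> (Suc i) k ?w) y"
        using t p by (cases "y \<in> ?I") (auto simp: \<xi>'_def shift_op_def single_def eq zero k_def)
    qed
    moreover have "\<xi> (Suc i) k ?w \<in> carrier (H i)"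
      using \<xi>_lin(1)[OF i k w(1)] by simp
    moreover have "k \<otimes> remainder ?p = remainder (t \<otimes> ?p)"
      unfolding k_def by (rule cocycle_remainder[OF t p])
    ultimately show ?case
      using ts' w k t p by (intro exI[of _ "k # ts'"]) simp
  qed
  have fac: "Md_factorization G d (twist c \<phi>) H' \<alpha>' \<xi>' \<beta>'"
    unfolding Md_factorization_def
  proof (intro conjI ballI impI)
    fix s ts u assume h: "s \<in> carrier G" "ts \<in> lists (carrier G)" "u \<in> carrier G" "length ts = d - 2"
    let ?p = "foldr (\<otimes>) ts u"
    \<comment> \<open>With truncated subtraction, \<open>1 + (d - 2) = d - 1\<close> relies on
      \<open>d \<ge> 2\<close>.\<close>
    have "1 + length ts = d - 1" using h(4) d by linarith
    then obtain ts' where ts': "set ts' \<subseteq> \<Gamma>" "length ts' = length ts"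
      "foldr (\<otimes>) ts' (remainder u) = remainder ?p" and p: "?p \<in> carrier G"
      and w: "op_prod \<xi> 2 ts' (\<beta> (remainder u) 1) \<in> carrier (H 1)"
        "op_prod \<xi>' 2 ts (\<beta>' u 1) = single (H 1) (\<Gamma> #> ?p) (op_prod \<xi> 2 ts' (\<beta> (remainder u) 1))"
      using op[of 1 ts u] h(2,3) by (auto simp: numeral_2_eq_2 lists_eq_set)
    let ?w = "op_prod \<xi> 2 ts' (\<beta> (remainder u) 1)"
    let ?y = "\<Gamma> #> (s \<otimes> ?p)"
    have y: "?y \<in> ?I" using h p by simp
    have k: "cocycle s ?y \<in> \<Gamma>" using h(1) y by (rule cocycle_in)
    have eq: "\<alpha> (cocycle s y) (single (H 1) (\<Gamma> #> ?p) ?w (shift s y))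
        = (if y = ?y then \<alpha> (cocycle s ?y) ?w else 0)" if "c y \<noteq> 0" for y
    proof -
      have "shift s y = \<Gamma> #> ?p \<longleftrightarrow> y = ?y"
        using bij_betw_imp_inj_on[OF bij_betw_shift[OF h(1)]] y h p cI[OF that]
          inj_on_eq_iff[of "shift s" ?I y ?y] by (simp add: shift_mult)
      moreover have "\<alpha> (cocycle s y) \<zero>\<^bsub>H 1\<^esub> = 0"
        using bounded_ops_zero[OF pre C \<alpha>(1)] cI[OF that] h d by simp
      ultimately show ?thesis by (auto simp: single_def)
    qed
    have "\<alpha>' s (op_prod \<xi>' 2 ts (\<beta>' u 1))
        = (\<Sum>y | c y \<noteq> 0. if y = ?y then c ?y * \<alpha> (cocycle s ?y) ?w else 0)"
      unfolding \<alpha>'_def w(2)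
    proof (intro sum.cong refl)
      fix y assume "y \<in> {y. c y \<noteq> 0}"
      then have cy: "c y \<noteq> 0" by simp
      show "c y * \<alpha> (cocycle s y) (single (H 1) (\<Gamma> #> ?p) ?w (shift s y))
          = (if y = ?y then c ?y * \<alpha> (cocycle s ?y) ?w else 0)"
        unfolding eq[OF cy] by simp
    qed
    \<comment> \<open>If \<open>?y\<close> lies outside the support of \<open>c\<close>, no summand
      survives and \<open>c ?y\<close> is zero, so the formula covers both cases.\<close>
    also have "\<dots> = c ?y * \<alpha> (cocycle s ?y) ?w"
      using c(1) by (subst sum.delta) auto
    also have "\<alpha> (cocycle s ?y) ?w = \<phi> (cocycle s ?y \<otimes> foldr (\<otimes>) ts' (remainder u))"
      using F(5)[of "cocycle s ?y" ts' "remainder u"] k ts' h by simp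
    also have "\<dots> = \<phi> (remainder (s \<otimes> ?p))"
      using cocycle_remainder[OF h(1) p] ts'(3) by simp
    finally show "twist c \<phi> (s \<otimes> ?p) = \<alpha>' s (op_prod \<xi>' 2 ts (\<beta>' u 1))"
      using h p by (simp add: twist_def)
  qed (use a x b hil' in auto)
  have "Md_bound G d H' \<alpha>' \<xi>' \<beta>' \<le> (S * A) * (\<Prod>i\<in>{2..<d}. X i) * B"
    unfolding Md_bound_def using d nonneg
    by (intro mult_mono prod_mono a x b conjI prod_nonneg mult_nonneg_nonneg)
      (auto intro!: sup_norm_nonneg pre' C ne a[unfolded One_nat_def] x[unfolded One_nat_def]
        b[unfolded One_nat_def])
  then have "Md_bound G d H' \<alpha>' \<xi>' \<beta>' \<le> S * Md_bound ?\<Gamma> d H \<alpha> \<xi> \<beta>"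
    by (simp add: Md_bound_def A_def X_def B_def mult.assoc)
  with fac show thesis
    unfolding S_def by (rule that)
qed

text \<open>All maps are composed with the quotient homomorphism \<open>q\<close>, over the same
  Hilbert spaces. Products are preserved because \<open>q\<close> is multiplicative, and the suprema
  do not change because \<open>q\<close> is onto.\<close>

lemma Md_factorization_coset:
  assumes F: "Md_factorization (G Mod \<Gamma>) d c H \<alpha> \<xi> \<beta>"
  defines "q \<equiv> \<lambda>t. \<Gamma> #> t"
  shows "Md_factorization G d (twist c (const_one (G\<lparr>carrier := \<Gamma>\<rparr>))) H
      (\<alpha> \<circ> q) (\<lambda>i. \<xi> i \<circ> q) (\<beta> \<circ> q)"
    and "Md_bound G d H (\<alpha> \<circ> q) (\<lambda>i. \<xi> i \<circ> q) (\<beta> \<circ> q) = Md_bound (G Mod \<Gamma>) d H \<alpha> \<xi> \<beta>"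
proof -
  have q: "q ` carrier G = carrier (G Mod \<Gamma>)"
    by (auto simp: q_def FactGroup_def RCOSETS_def)
  have m: "s \<otimes>\<^bsub>G Mod \<Gamma>\<^esub> t = s <#> t" for s t by (simp add: FactGroup_def)
  have b: "bounded_map G K L (T \<circ> q)" if "bounded_map (G Mod \<Gamma>) K L T"
    for T :: "'a set \<Rightarrow> 'x \<Rightarrow> 'y" and K L
    using that unfolding bounded_map_def q[symmetric] by (simp add: image_image)
  have fold: "foldr (\<otimes>) ts u \<in> carrier G \<and>
      foldr (\<otimes>\<^bsub>G Mod \<Gamma>\<^esub>) (map q ts) (q u) = q (foldr (\<otimes>) ts u)"
    if "set ts \<subseteq> carrier G" "u \<in> carrier G" for ts u
    using that by (induction ts) (auto simp: m q_def rcos_sum)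
  have op: "op_prod (\<lambda>i. \<xi> i \<circ> q) i ts v = op_prod \<xi> i (map q ts) v" for i ts v
    by (induction ts arbitrary: i) auto
  note F = Md_factorizationD[OF F]
  show "Md_factorization G d (twist c (const_one (G\<lparr>carrier := \<Gamma>\<rparr>))) H
      (\<alpha> \<circ> q) (\<lambda>i. \<xi> i \<circ> q) (\<beta> \<circ> q)"
    unfolding Md_factorization_def
  proof (intro conjI ballI impI)
    fix s ts u assume h: "s \<in> carrier G" "ts \<in> lists (carrier G)" "u \<in> carrier G" "length ts = d - 2"
    let ?p = "foldr (\<otimes>) ts u"
    have p: "?p \<in> carrier G" "foldr (\<otimes>\<^bsub>G Mod \<Gamma>\<^esub>) (map q ts) (q u) = q ?p"
      using fold[of ts u] h by (auto simp: lists_eq_set)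
    have "set (map q ts) \<subseteq> carrier (G Mod \<Gamma>)"
      unfolding q[symmetric] using h by (auto simp: lists_eq_set)
    then have "c (q s \<otimes>\<^bsub>G Mod \<Gamma>\<^esub> q ?p) = \<alpha> (q s) (op_prod \<xi> 2 (map q ts) (\<beta> (q u) 1))"
      using F(5)[of "q s" "map q ts" "q u"] h p(2) imageI[OF h(1), of q] imageI[OF h(3), of q]
      unfolding q by simp
    then show "twist c (const_one (G\<lparr>carrier := \<Gamma>\<rparr>)) (s \<otimes> ?p)
        = (\<alpha> \<circ> q) s (op_prod (\<lambda>i. \<xi> i \<circ> q) 2 ts ((\<beta> \<circ> q) u 1))"
      using h p by (simp add: twist_def const_one_def op[unfolded q_def] m q_def rcos_sum)
  qed (use F in \<open>auto intro!: b\<close>)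
  have s: "sup_norm G K L (T \<circ> q) = sup_norm (G Mod \<Gamma>) K L T" for T :: "'a set \<Rightarrow> 'x \<Rightarrow> 'y" and K L
    unfolding sup_norm_def q[symmetric] by (simp add: image_image)
  show "Md_bound G d H (\<alpha> \<circ> q) (\<lambda>i. \<xi> i \<circ> q) (\<beta> \<circ> q) = Md_bound (G Mod \<Gamma>) d H \<alpha> \<xi> \<beta>"
    unfolding Md_bound_def s ..
qed

end

section \<open>Summability in coset coordinates and the preadjoints\<close>

lemma l1_iff: "g \<in> l1 G \<longleftrightarrow> g \<in> functions_on G \<and> g summable_on carrier G"
  by (simp add: l1_def summable_on_iff_abs_summable_on_complex[symmetric])

lemma summable_on_Sigma_section:
  fixes f :: "'x \<Rightarrow> 'y \<Rightarrow> complex"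
  assumes "(\<lambda>(x, y). f x y) summable_on A \<times> B" "x \<in> A"
  shows "f x summable_on B"
proof -
  have "(\<lambda>(x, y). f x y) summable_on {x} \<times> B"
    by (rule summable_on_subset_banach[OF assms(1)]) (use assms(2) in auto)
  moreover have "bij_betw (Pair x) B ({x} \<times> B)"
    by (auto simp: bij_betw_def inj_on_def)
  ultimately show ?thesis
    using summable_on_reindex_bij_betw[of "Pair x" B "{x} \<times> B" "\<lambda>(x, y). f x y"] by simp
qed

lemma infsum_diff:
  fixes f g :: "'x \<Rightarrow> complex"
  assumes "f summable_on A" "g summable_on A"
  shows "(\<Sum>\<^sub>\<infinity>x\<in>A. f x - g x) = infsum f A - infsum g A"
  using infsum_add[OF assms(1) assms(2)[THEN summable_on_uminus[THEN iffD2]]] by (simp add: infsum_uminus)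

context coset_section
begin

lemma twist_functions_on: "twist c \<phi> \<in> functions_on G"
  by (simp add: functions_on_def twist_def)

lemma twist_section_mult: "\<lbrakk>x \<in> rcosets \<Gamma>; \<gamma> \<in> \<Gamma>\<rbrakk> \<Longrightarrow> twist c \<phi> (\<sigma> x \<otimes> \<gamma>) = c x * \<phi> \<gamma>"
  by (simp add: twist_def)

text \<open>In the coordinates of \<open>bij_betw_section_mult\<close> the support lies in the
  product of the two supports.\<close>

lemma finite_support_twist:
  assumes "finite {x. c x \<noteq> 0}" "finite {\<gamma>. \<phi> \<gamma> \<noteq> 0}"
  shows "finite {t. twist c \<phi> t \<noteq> 0}"
proof (rule finite_subset)
  show "{t. twist c \<phi> t \<noteq> 0} \<subseteq> (\<lambda>(x, \<gamma>). \<sigma> x \<otimes> \<gamma>) ` ({x. c x \<noteq> 0} \<times> {\<gamma>. \<phi> \<gamma> \<noteq> 0})"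
  proof
    fix t assume t: "t \<in> {t. twist c \<phi> t \<noteq> 0}"
    then have "t \<in> carrier G" by (auto simp: twist_def split: if_splits)
    then show "t \<in> (\<lambda>(x, \<gamma>). \<sigma> x \<otimes> \<gamma>) ` ({x. c x \<noteq> 0} \<times> {\<gamma>. \<phi> \<gamma> \<noteq> 0})"
      using t by (intro image_eqI[of _ _ "(\<Gamma> #> t, remainder t)"])
        (auto simp: section_remainder twist_def)
  qed
qed (use assms in simp)

text \<open>Bounded coefficients multiply an absolutely summable family, namely \<open>g\<close> in
  coset coordinates. This licenses the interchanges of sums below.\<close>

lemma twist_summable:
  assumes g: "g \<in> l1 G" and c: "bounded (c ` (rcosets \<Gamma>))" and \<phi>: "bounded (\<phi> ` \<Gamma>)"
  shows "(\<lambda>(x, \<gamma>). c x * \<phi> \<gamma> * g (\<sigma> x \<otimes> \<gamma>)) summable_on (rcosets \<Gamma>) \<times> \<Gamma>"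
proof -
  obtain a where a: "\<And>x. x \<in> rcosets \<Gamma> \<Longrightarrow> cmod (c x) \<le> a"
    using c by (auto simp: bounded_iff)
  obtain b where b: "\<And>\<gamma>. \<gamma> \<in> \<Gamma> \<Longrightarrow> cmod (\<phi> \<gamma>) \<le> b"
    using \<phi> by (auto simp: bounded_iff)
  have "(\<lambda>t. cmod (g t)) summable_on carrier G" using g by (simp add: l1_def)
  then have "(\<lambda>p. cmod (g (case p of (x, \<gamma>) \<Rightarrow> \<sigma> x \<otimes> \<gamma>))) summable_on (rcosets \<Gamma>) \<times> \<Gamma>"
    using summable_on_reindex_bij_betw[OF bij_betw_section_mult, of "\<lambda>t. cmod (g t)"] by simp
  then have "(\<lambda>p. a * b * cmod (g (case p of (x, \<gamma>) \<Rightarrow> \<sigma> x \<otimes> \<gamma>))) summable_on (rcosets \<Gamma>) \<times> \<Gamma>"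
    by (rule summable_on_cmult_right)
  then have "(\<lambda>p. cmod (case p of (x, \<gamma>) \<Rightarrow> c x * \<phi> \<gamma> * g (\<sigma> x \<otimes> \<gamma>))) summable_on (rcosets \<Gamma>) \<times> \<Gamma>"
  proof (rule Infinite_Sum.abs_summable_on_comparison_test')
    fix p assume "p \<in> (rcosets \<Gamma>) \<times> \<Gamma>"
    then obtain x \<gamma> where p: "p = (x, \<gamma>)" "x \<in> rcosets \<Gamma>" "\<gamma> \<in> \<Gamma>" by auto
    have "cmod (c x) * cmod (\<phi> \<gamma>) \<le> a * b"
      using a[OF p(2)] b[OF p(3)] by (intro mult_mono) (auto intro: order_trans[OF norm_ge_zero])
    then show "cmod (case p of (x, \<gamma>) \<Rightarrow> c x * \<phi> \<gamma> * g (\<sigma> x \<otimes> \<gamma>))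
        \<le> a * b * cmod (g (case p of (x, \<gamma>) \<Rightarrow> \<sigma> x \<otimes> \<gamma>))"
      by (simp add: p norm_mult mult_right_mono)
  qed
  then show ?thesis by (rule Infinite_Sum.abs_summable_summable)
qed

lemma pairing_twist:
  "pairing G (twist c \<phi>) g = (\<Sum>\<^sub>\<infinity>(x, \<gamma>)\<in>(rcosets \<Gamma>) \<times> \<Gamma>. c x * \<phi> \<gamma> * g (\<sigma> x \<otimes> \<gamma>))"
proof -
  have "pairing G (twist c \<phi>) g = (\<Sum>\<^sub>\<infinity>p\<in>(rcosets \<Gamma>) \<times> \<Gamma>.
      twist c \<phi> (case p of (x, \<gamma>) \<Rightarrow> \<sigma> x \<otimes> \<gamma>) * g (case p of (x, \<gamma>) \<Rightarrow> \<sigma> x \<otimes> \<gamma>))"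
    unfolding pairing_def
    by (rule infsum_reindex_bij_betw[OF bij_betw_section_mult, of "\<lambda>t. twist c \<phi> t * g t", symmetric])
  also have "\<dots> = (\<Sum>\<^sub>\<infinity>(x, \<gamma>)\<in>(rcosets \<Gamma>) \<times> \<Gamma>. c x * \<phi> \<gamma> * g (\<sigma> x \<otimes> \<gamma>))"
    by (rule infsum_cong) (auto simp: twist_section_mult)
  finally show ?thesis .
qed

definition subgroup_preadjoint :: "('a set \<Rightarrow> complex) \<Rightarrow> ('a \<Rightarrow> complex) \<Rightarrow> 'a \<Rightarrow> complex" where
  "subgroup_preadjoint c g \<gamma> = (if \<gamma> \<in> \<Gamma> then \<Sum>\<^sub>\<infinity>x\<in>rcosets \<Gamma>. c x * g (\<sigma> x \<otimes> \<gamma>) else 0)"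

definition quotient_preadjoint :: "('a \<Rightarrow> complex) \<Rightarrow> ('a \<Rightarrow> complex) \<Rightarrow> 'a set \<Rightarrow> complex" where
  "quotient_preadjoint \<phi> g x = (if x \<in> rcosets \<Gamma> then \<Sum>\<^sub>\<infinity>\<gamma>\<in>\<Gamma>. \<phi> \<gamma> * g (\<sigma> x \<otimes> \<gamma>) else 0)"

text \<open>Summing out the coset variable against \<open>c\<close> is the preadjoint of
  \<open>\<phi> \<mapsto> twist c \<phi>\<close>: the partial sums of a summable double family are
  summable, and the pairing identity is Fubini with the order of summation exchanged.\<close>

lemma subgroup_preadjoint:
  assumes c: "bounded (c ` (rcosets \<Gamma>))"
  shows "g \<in> l1 G \<Longrightarrow> subgroup_preadjoint c g \<in> l1 (G\<lparr>carrier := \<Gamma>\<rparr>)"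
    and "\<lbrakk>g \<in> l1 G; h \<in> l1 G\<rbrakk> \<Longrightarrow> subgroup_preadjoint c (\<lambda>t. g t - h t)
      = (\<lambda>\<gamma>. subgroup_preadjoint c g \<gamma> - subgroup_preadjoint c h \<gamma>)"
    and "\<lbrakk>\<phi> \<in> Md (G\<lparr>carrier := \<Gamma>\<rparr>) d; g \<in> l1 G\<rbrakk>
      \<Longrightarrow> pairing G (twist c \<phi>) g = pairing (G\<lparr>carrier := \<Gamma>\<rparr>) \<phi> (subgroup_preadjoint c g)"
proof -
  have sm: "(\<lambda>(\<gamma>, x). c x * g (\<sigma> x \<otimes> \<gamma>)) summable_on \<Gamma> \<times> (rcosets \<Gamma>)" if "g \<in> l1 G" for g
  proof -
    \<comment> \<open>The constant 1 takes the place of the bounded function on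
      \<open>\<Gamma>\<close>, since the preadjoint must not depend on
      \<open>\<phi>\<close>.\<close>
    have "(\<lambda>(x, \<gamma>). c x * 1 * g (\<sigma> x \<otimes> \<gamma>)) summable_on (rcosets \<Gamma>) \<times> \<Gamma>"
      by (rule twist_summable[OF that c]) (auto simp: bounded_iff intro: exI[of _ 1])
    then show ?thesis by (subst summable_on_swap) (simp add: case_prod_beta)
  qed
  show "subgroup_preadjoint c g \<in> l1 (G\<lparr>carrier := \<Gamma>\<rparr>)" if g: "g \<in> l1 G"
  proof -
    have "(\<lambda>\<gamma>. \<Sum>\<^sub>\<infinity>x\<in>rcosets \<Gamma>. c x * g (\<sigma> x \<otimes> \<gamma>)) summable_on \<Gamma>"
      using sm[OF g] by (rule summable_on_Sigma_banach)
    then have "subgroup_preadjoint c g summable_on \<Gamma>"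
      by (rule summable_on_cong[THEN iffD1, rotated]) (simp add: subgroup_preadjoint_def)
    then show ?thesis by (simp add: l1_iff functions_on_def subgroup_preadjoint_def)
  qed
  show "subgroup_preadjoint c (\<lambda>t. g t - h t)
      = (\<lambda>\<gamma>. subgroup_preadjoint c g \<gamma> - subgroup_preadjoint c h \<gamma>)" if gh: "g \<in> l1 G" "h \<in> l1 G"
  proof
    fix \<gamma>
    have s: "(\<lambda>x. c x * f (\<sigma> x \<otimes> \<gamma>)) summable_on rcosets \<Gamma>" if "\<gamma> \<in> \<Gamma>" "f \<in> l1 G" for f
      by (rule summable_on_Sigma_section[OF sm[OF that(2)] that(1)])
    show "subgroup_preadjoint c (\<lambda>t. g t - h t) \<gamma> = subgroup_preadjoint c g \<gamma> - subgroup_preadjoint c h \<gamma>"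
      using infsum_diff[OF s[OF _ gh(1)] s[OF _ gh(2)]]
      by (auto simp: subgroup_preadjoint_def right_diff_distrib)
  qed
  show "pairing G (twist c \<phi>) g = pairing (G\<lparr>carrier := \<Gamma>\<rparr>) \<phi> (subgroup_preadjoint c g)"
    if \<phi>: "\<phi> \<in> Md (G\<lparr>carrier := \<Gamma>\<rparr>) d" and g: "g \<in> l1 G"
  proof -
    have sm: "(\<lambda>(x, \<gamma>). c x * \<phi> \<gamma> * g (\<sigma> x \<otimes> \<gamma>)) summable_on (rcosets \<Gamma>) \<times> \<Gamma>"
      using \<phi> by (intro twist_summable[OF g c]) (simp add: Md_def)
    have car: "carrier (G\<lparr>carrier := \<Gamma>\<rparr>) = \<Gamma>" by simp
    have "pairing (G\<lparr>carrier := \<Gamma>\<rparr>) \<phi> (subgroup_preadjoint c g)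
        = (\<Sum>\<^sub>\<infinity>\<gamma>\<in>\<Gamma>. \<Sum>\<^sub>\<infinity>x\<in>rcosets \<Gamma>. c x * \<phi> \<gamma> * g (\<sigma> x \<otimes> \<gamma>))"
      unfolding pairing_def car
      by (intro infsum_cong) (auto simp: subgroup_preadjoint_def mult_ac simp flip: infsum_cmult_right')
    also have "\<dots> = pairing G (twist c \<phi>) g"
      unfolding pairing_twist infsum_swap_banach[OF sm, symmetric] by (rule infsum_Sigma'_banach[OF sm])
    finally show ?thesis ..
  qed
qed

text \<open>The mirror image of \<open>subgroup_preadjoint\<close>: now the variable in
  \<open>\<Gamma>\<close> is summed out. The cosets already form the outer sum, so Fubini applies
  without an exchange.\<close>

lemma quotient_preadjoint:
  assumes \<phi>: "bounded (\<phi> ` \<Gamma>)"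
  shows "g \<in> l1 G \<Longrightarrow> quotient_preadjoint \<phi> g \<in> l1 (G Mod \<Gamma>)"
    and "\<lbrakk>g \<in> l1 G; h \<in> l1 G\<rbrakk> \<Longrightarrow> quotient_preadjoint \<phi> (\<lambda>t. g t - h t)
      = (\<lambda>x. quotient_preadjoint \<phi> g x - quotient_preadjoint \<phi> h x)"
    and "\<lbrakk>c \<in> Md (G Mod \<Gamma>) d; g \<in> l1 G\<rbrakk>
      \<Longrightarrow> pairing G (twist c \<phi>) g = pairing (G Mod \<Gamma>) c (quotient_preadjoint \<phi> g)"
proof -
  have car: "carrier (G Mod \<Gamma>) = rcosets \<Gamma>" by (simp add: FactGroup_def)
  have sm: "(\<lambda>(x, \<gamma>). \<phi> \<gamma> * g (\<sigma> x \<otimes> \<gamma>)) summable_on (rcosets \<Gamma>) \<times> \<Gamma>" if "g \<in> l1 G" for g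
    using twist_summable[OF that _ \<phi>, of "\<lambda>_. 1"] by (auto simp: bounded_iff)
  show "quotient_preadjoint \<phi> g \<in> l1 (G Mod \<Gamma>)" if g: "g \<in> l1 G"
  proof -
    have "(\<lambda>x. \<Sum>\<^sub>\<infinity>\<gamma>\<in>\<Gamma>. \<phi> \<gamma> * g (\<sigma> x \<otimes> \<gamma>)) summable_on rcosets \<Gamma>"
      using sm[OF g] by (rule summable_on_Sigma_banach)
    then have "quotient_preadjoint \<phi> g summable_on rcosets \<Gamma>"
      by (rule summable_on_cong[THEN iffD1, rotated]) (simp add: quotient_preadjoint_def)
    then show ?thesis by (simp add: l1_iff functions_on_def quotient_preadjoint_def car)
  qed
  show "quotient_preadjoint \<phi> (\<lambda>t. g t - h t)
      = (\<lambda>x. quotient_preadjoint \<phi> g x - quotient_preadjoint \<phi> h x)" if gh: "g \<in> l1 G" "h \<in> l1 G"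
  proof
    fix x
    have s: "(\<lambda>\<gamma>. \<phi> \<gamma> * f (\<sigma> x \<otimes> \<gamma>)) summable_on \<Gamma>" if "x \<in> rcosets \<Gamma>" "f \<in> l1 G" for f
      by (rule summable_on_Sigma_section[OF sm[OF that(2)] that(1)])
    show "quotient_preadjoint \<phi> (\<lambda>t. g t - h t) x = quotient_preadjoint \<phi> g x - quotient_preadjoint \<phi> h x"
      using infsum_diff[OF s[OF _ gh(1)] s[OF _ gh(2)]]
      by (auto simp: quotient_preadjoint_def right_diff_distrib)
  qed
  show "pairing G (twist c \<phi>) g = pairing (G Mod \<Gamma>) c (quotient_preadjoint \<phi> g)"
    if c: "c \<in> Md (G Mod \<Gamma>) d" and g: "g \<in> l1 G"
  proof -
    have sm: "(\<lambda>(x, \<gamma>). c x * \<phi> \<gamma> * g (\<sigma> x \<otimes> \<gamma>)) summable_on (rcosets \<Gamma>) \<times> \<Gamma>"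
      using c by (intro twist_summable[OF g _ \<phi>]) (simp add: Md_def car)
    have "pairing (G Mod \<Gamma>) c (quotient_preadjoint \<phi> g)
        = (\<Sum>\<^sub>\<infinity>x\<in>rcosets \<Gamma>. \<Sum>\<^sub>\<infinity>\<gamma>\<in>\<Gamma>. c x * \<phi> \<gamma> * g (\<sigma> x \<otimes> \<gamma>))"
      unfolding pairing_def car
      by (intro infsum_cong) (auto simp: quotient_preadjoint_def mult.assoc simp flip: infsum_cmult_right')
    also have "\<dots> = pairing G (twist c \<phi>) g"
      unfolding pairing_twist by (rule infsum_Sigma'_banach[OF sm])
    finally show ?thesis ..
  qed
qed

section \<open>Weak* continuity of the two maps and the iterated limit\<close>

lemma continuous_map_twist_subgroup:
  assumes d: "d \<ge> 2" and ne: "Md (G\<lparr>carrier := \<Gamma>\<rparr>) d \<noteq> {}"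
    and c: "c \<in> functions_on (G Mod \<Gamma>)" "finite {x. c x \<noteq> 0}"
  shows "continuous_map (Md_weak_star (G\<lparr>carrier := \<Gamma>\<rparr>) d) (Md_weak_star G d) (twist c)"
proof (rule continuous_map_Md_weak_star[where S = "subgroup_preadjoint c"])
  have sub: "{x. c x \<noteq> 0} \<subseteq> rcosets \<Gamma>"
    using c(1) by (auto simp: functions_on_def FactGroup_def)
  \<comment> \<open>The type annotation selects vectors that are functions on cosets, as produced by
    the Hilbert sums over the quotient.\<close>
  show "\<exists>(H' :: nat \<Rightarrow> ('a set \<Rightarrow> 'a list \<Rightarrow> complex) inner_space) \<alpha>' \<xi>' \<beta>'.
      Md_factorization G d (twist c \<phi>) H' \<alpha>' \<xi>' \<beta>' \<and> Md_bound G d H' \<alpha>' \<xi>' \<beta>'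
        \<le> (\<Sum>y | c y \<noteq> 0. cmod (c y)) * Md_bound (G\<lparr>carrier := \<Gamma>\<rparr>) d H \<alpha> \<xi> \<beta>"
    if F: "Md_factorization (G\<lparr>carrier := \<Gamma>\<rparr>) d \<phi> H \<alpha> \<xi> \<beta>"
    for \<phi> and H :: "nat \<Rightarrow> ('a list \<Rightarrow> complex) inner_space" and \<alpha> \<xi> \<beta>
    by (rule Md_factorization_twist[OF d F c(2) sub]) blast
  have "c ` (rcosets \<Gamma>) \<subseteq> insert 0 (c ` {x. c x \<noteq> 0})" by auto
  then have bdd: "bounded (c ` (rcosets \<Gamma>))"
    using c(2) by (meson bounded_subset finite.insertI finite_imageI finite_imp_bounded)
  note pre = subgroup_preadjoint[OF bdd]
  show "\<And>g. g \<in> l1 G \<Longrightarrow> subgroup_preadjoint c g \<in> l1 (G\<lparr>carrier := \<Gamma>\<rparr>)"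
    "\<And>g h. \<lbrakk>g \<in> l1 G; h \<in> l1 G\<rbrakk> \<Longrightarrow> subgroup_preadjoint c (\<lambda>t. g t - h t)
      = (\<lambda>\<gamma>. subgroup_preadjoint c g \<gamma> - subgroup_preadjoint c h \<gamma>)"
    "\<And>\<phi> g. \<lbrakk>\<phi> \<in> Md (G\<lparr>carrier := \<Gamma>\<rparr>) d; g \<in> l1 G\<rbrakk>
      \<Longrightarrow> pairing G (twist c \<phi>) g = pairing (G\<lparr>carrier := \<Gamma>\<rparr>) \<phi> (subgroup_preadjoint c g)"
    by (fact pre)+
qed (use d ne in \<open>auto intro!: sum_nonneg twist_functions_on subgroup_imp_group is_sub is_group\<close>)

text \<open>Composition with the quotient map preserves the bound of a factorization, hence the
  constant \<open>K = 1\<close>.\<close>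

lemma continuous_map_twist_quotient:
  assumes d: "d \<ge> 2" and ne: "Md (G Mod \<Gamma>) d \<noteq> {}"
  defines "\<phi> \<equiv> const_one (G\<lparr>carrier := \<Gamma>\<rparr>)"
  shows "continuous_map (Md_weak_star (G Mod \<Gamma>) d) (Md_weak_star G d) (\<lambda>c. twist c \<phi>)"
proof (rule continuous_map_Md_weak_star[where S = "quotient_preadjoint \<phi>" and K = 1])
  show "\<exists>(H' :: nat \<Rightarrow> ('a set list \<Rightarrow> complex) inner_space) \<alpha>' \<xi>' \<beta>'.
      Md_factorization G d (twist c \<phi>) H' \<alpha>' \<xi>' \<beta>' \<and> Md_bound G d H' \<alpha>' \<xi>' \<beta>'
        \<le> 1 * Md_bound (G Mod \<Gamma>) d H \<alpha> \<xi> \<beta>"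
    if F: "Md_factorization (G Mod \<Gamma>) d c H \<alpha> \<xi> \<beta>"
    for c and H :: "nat \<Rightarrow> ('a set list \<Rightarrow> complex) inner_space" and \<alpha> \<xi> \<beta>
    using Md_factorization_coset[OF F] unfolding \<phi>_def by (metis mult_1 order_refl)
  have bdd: "bounded (\<phi> ` \<Gamma>)" by (auto simp: \<phi>_def const_one_def bounded_iff)
  note pre = quotient_preadjoint[OF bdd]
  show "\<And>g. g \<in> l1 G \<Longrightarrow> quotient_preadjoint \<phi> g \<in> l1 (G Mod \<Gamma>)"
    "\<And>g h. \<lbrakk>g \<in> l1 G; h \<in> l1 G\<rbrakk> \<Longrightarrow> quotient_preadjoint \<phi> (\<lambda>t. g t - h t)
      = (\<lambda>x. quotient_preadjoint \<phi> g x - quotient_preadjoint \<phi> h x)"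
    "\<And>c g. \<lbrakk>c \<in> Md (G Mod \<Gamma>) d; g \<in> l1 G\<rbrakk>
      \<Longrightarrow> pairing G (twist c \<phi>) g = pairing (G Mod \<Gamma>) c (quotient_preadjoint \<phi> g)"
    by (fact pre)+
qed (use d ne in \<open>auto intro: twist_functions_on factorgroup_is_group is_group\<close>)

end

theorem theorem1p3:
  fixes G :: "('a, 'b) monoid_scheme" and \<Gamma> :: "'a set" and d :: nat
  assumes "group G"
    and "\<Gamma> \<lhd> G"
    and "d \<ge> 2"
    and "Md_AP (G\<lparr>carrier := \<Gamma>\<rparr>) d"
    and "Md_AP (G Mod \<Gamma>) d"
  shows "Md_AP G d"
proof -
  interpret normal \<Gamma> G by fact
  define \<sigma> :: "'a set \<Rightarrow> 'a" where "\<sigma> x = (SOME t. t \<in> x)" for x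
  interpret coset_section \<Gamma> G \<sigma>
  proof
    fix x assume "x \<in> rcosets\<^bsub>G\<^esub> \<Gamma>"
    then obtain t where "t \<in> carrier G" "x = \<Gamma> #>\<^bsub>G\<^esub> t" by (auto simp: RCOSETS_def)
    then have "t \<in> x" using rcos_self subgroup_axioms by blast
    then show "\<sigma> x \<in> x" unfolding \<sigma>_def by (rule someI)
  qed
  let ?\<Gamma> = "G\<lparr>carrier := \<Gamma>\<rparr>" and ?Q = "G Mod \<Gamma>"
  let ?F = "{\<phi> \<in> functions_on G. finite {t. \<phi> t \<noteq> 0}}"
    and ?F\<Gamma> = "{\<phi> \<in> functions_on ?\<Gamma>. finite {t. \<phi> t \<noteq> 0}}"
    and ?FQ = "{c \<in> functions_on ?Q. finite {x. c x \<noteq> 0}}"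
  let ?W = "Md_weak_star G d closure_of ?F"
  have AP: "const_one ?\<Gamma> \<in> Md_weak_star ?\<Gamma> d closure_of ?F\<Gamma>" "const_one ?Q \<in> Md_weak_star ?Q d closure_of ?FQ"
    using assms(4,5) by (simp_all add: Md_AP_def)
  \<comment> \<open>A weak* closure is contained in the space of multipliers, so each approximation
    hypothesis already provides a multiplier.\<close>
  then have ne: "Md ?\<Gamma> d \<noteq> {}" "Md ?Q d \<noteq> {}"
    using closure_of_subset_topspace by fastforce+
  \<comment> \<open>The inner limit: \<open>c\<close> stays fixed while finitely supported functions
    on \<open>\<Gamma>\<close> approximate the constant 1.\<close>
  have sub: "twist c (const_one ?\<Gamma>) \<in> ?W" if c: "c \<in> ?FQ" for c
  proof -
    have "twist c ` (Md_weak_star ?\<Gamma> d closure_of ?F\<Gamma>) \<subseteq> Md_weak_star G d closure_of twist c ` ?F\<Gamma>"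
      using c by (intro continuous_map_image_closure_subset continuous_map_twist_subgroup assms(3) ne) auto
    also have "\<dots> \<subseteq> ?W"
      using c by (intro closure_of_mono) (auto intro: twist_functions_on finite_support_twist)
    finally show ?thesis using AP(1) by blast
  qed
  let ?T = "\<lambda>c. twist c (const_one ?\<Gamma>)"
  \<comment> \<open>The outer limit, now in \<open>c\<close>. Its approximants are themselves only
    limits of finitely supported functions, and idempotence of the closure merges the two
    limits.\<close>
  have "?T ` (Md_weak_star ?Q d closure_of ?FQ) \<subseteq> Md_weak_star G d closure_of ?T ` ?FQ"
    by (intro continuous_map_image_closure_subset continuous_map_twist_quotient assms(3) ne)
  also have "\<dots> \<subseteq> Md_weak_star G d closure_of ?W"
    using sub by (intro closure_of_mono) blast
  also have "\<dots> = ?W" by (rule closure_of_closure_of)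
  finally have "?T (const_one ?Q) \<in> ?W" using AP(2) by blast
  moreover have "?T (const_one ?Q) = const_one G"
    by (auto simp: twist_def const_one_def FactGroup_def)
  ultimately show ?thesis by (simp add: Md_AP_def)
qed

end
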